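(* Let $(\boldsymbol{u},\boldsymbol{\sigma})$ solve the continuous elasticity problem, let $(\boldsymbol{u}_h,\boldsymbol{\sigma}_h)\in V_h\times S_h^g$ solve the discrete mixed problem, and let $(\boldsymbol{r}_h,\boldsymbol{w}_h)\in(I-P_h)V_h^{l+1}\times V_h^l$ solve the local residual minimization system. Then there is a constant $C>0$, independent of the mesh parameter $h$ and remaining bounded as $\lambda\to\infty$, such that for all $K\in\mathcal{T}_h$ $$\eta_K\le C\Big(\mu^{-1/2}\|\boldsymbol{\sigma}-\boldsymbol{\sigma}_h\|_K+\mu^{1/2}\|\boldsymbol{u}-\boldsymbol{w}_h\|_{h,K}\Big).$$
   Context: Let $d\in\{2,3\}$ and let $\Omega\subset\mathbb{R}^d$ be a polygonal/polyhedral domain with boundary $\Gamma$ split into disjoint parts $\Gamma_D,\Gamma_N$, $|\Gamma_D|>0$. $(\cdot,\cdot)_K$ and $\|\cdot\|_K$ are the $L^2(K)$ inner product and norm; without subscript they are over $\Omega$. On piecewise polynomial functions $\varepsilon$ is applied elementwise. $\varepsilon(\boldsymbol{v})=\frac12(\nabla\boldsymbol{v}+(\nabla\boldsymbol{v})^{T})$. With Lamé parameters $\mu,\lambda>0$, $\mathcal{C}\boldsymbol{\tau}=\frac1{2\mu}\big(\boldsymbol{\tau}-\frac{\lambda}{2\mu+d\lambda}\mathrm{tr}(\boldsymbol{\tau})I\big)$. Continuous problem. Given a load $\boldsymbol{f}$ and a traction $\boldsymbol{g}$, find $\boldsymbol{u}\in[H^1_D(\Omega)]^d$ ($H^1$ functions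 vanishing on $\Gamma_D$) and a symmetric $\boldsymbol{\sigma}$ with $\mathcal{C}\boldsymbol{\sigma}-\varepsilon(\boldsymbol{u})=\boldsymbol{0}$ and $-\mathrm{div}\,\boldsymbol{\sigma}=\boldsymbol{f}$ in $\Omega$, $\boldsymbol{u}=\boldsymbol{0}$ on $\Gamma_D$, $\boldsymbol{\sigma}\boldsymbol{n}=\boldsymbol{g}$ on $\Gamma_N$. Mesh and discrete spaces. $\mathcal{T}_h$ is a triangular/tetrahedral mesh of $\Omega$ with mesh parameter $h$. $H(\mathrm{div};\Omega)$ is the space of symmetric $L^2$ matrix fields with row-wise divergence in $L^2$. One of the following exactly symmetric mixed element families is fixed: Arnold–Douglas–Gupta (ADG, triangles, 1984), Guzmán–Neilan (GN, triangles, 2014), Arnold–Awanou–Winther (AAW, tetrahedra, 2008), each of degree $k\ge2$, or the linear Johnson–Mercier method (JM, triangles, 1978). $V_h$ is the space of $\boldsymbol{v}\in[L^2(\Omega)]^d$ with $\boldsymbol{v}|_K\in V(K)$ for all $K\in\mathcal{T}_h$, where $V(K)=[P_{k-1}(K)]^d$ for ADG, GN, AAW and $V(K)=[P_1(K)]^d$ for JM. $S_h$ is the space of $\boldsymbol{\tau}\in H(\mathrm{div};\Omega)$ with $\boldsymbol{\tau}|_K\in S(K)$ for all $K$, where $S(K)$ is the local space of symmetric matrix fields of the chosen family. For ADG, GN, AAW one has $[P_k(K)]^{d\times d}_{\mathrm{sym}}\subset S(K)$, local degrees of freedom $\int_K\boldsymbol{\tau}:\varepsilon(\boldsymbol{v})$,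 $\boldsymbol{v}\in[P_{k-1}(K)]^d$, and $\int_E\boldsymbol{\tau}\boldsymbol{n}\cdot\boldsymbol{v}$, $\boldsymbol{v}\in[P_k(E)]^d$, for each edge/face $E$ of $K$, and $\mathrm{div}\,S_h\subset V_h$. For JM, $S(K)$ consists of the symmetric, $H(\mathrm{div})$-conforming, piecewise linear fields on the Alfeld (barycentric) split of $K$. For edges/faces $E\subset\Gamma_N$, $Q_h|_E$ is the $L^2(E)$-projection onto $[P_k(E)]^d$ ($[P_1(E)]^d$ for JM). $S_h^g=\{\boldsymbol{\tau}\in S_h:\boldsymbol{\tau}\boldsymbol{n}=Q_h\boldsymbol{g}\text{ on }\Gamma_N\}$, $S_h^0=\{\boldsymbol{\tau}\in S_h:\boldsymbol{\tau}\boldsymbol{n}=\boldsymbol{0}\text{ on }\Gamma_N\}$. The discrete mixed problem is: find $(\boldsymbol{\sigma}_h,\boldsymbol{u}_h)\in S_h^g\times V_h$ with $$(\mathcal{C}\boldsymbol{\sigma}_h,\boldsymbol{\tau})+(\boldsymbol{u}_h,\mathrm{div}\,\boldsymbol{\tau})+(\boldsymbol{v},\mathrm{div}\,\boldsymbol{\sigma}_h)+(\boldsymbol{f},\boldsymbol{v})=0\quad\forall(\boldsymbol{\tau},\boldsymbol{v})\in S_h^0\times V_h.$$ Local problem. $P_h:[L^2(\Omega)]^d\to V_h$ is the $L^2$-projection. $V_h^m=\{\boldsymbol{v}\in[L^2(\Omega)]^d:\boldsymbol{v}|_K\in[P_m(K)]^d\ \forall K\}$; $l=k+1$ for ADG,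 GN, AAW, and $l=2$ for JM; $|_K$ on a space denotes restrictions to $K$. The local residual minimization system: find $\boldsymbol{r}_h\in(I-P_h)V_h^{l+1}$, $\boldsymbol{w}_h\in V_h^l$ such that for each $K\in\mathcal{T}_h$ $$(\varepsilon(\boldsymbol{r}_h),\varepsilon(\boldsymbol{v}_K))_K+(\varepsilon(\boldsymbol{w}_h),\varepsilon(\boldsymbol{v}_K))_K=(\mathcal{C}\boldsymbol{\sigma}_h,\varepsilon(\boldsymbol{v}_K))_K\ \ \forall\boldsymbol{v}_K\in(I-P_h)V_h^{l+1}|_K,$$ $$(\varepsilon(\boldsymbol{v}_K),\varepsilon(\boldsymbol{r}_h))_K=0\ \ \forall\boldsymbol{v}_K\in(I-P_h)V_h^{l}|_K,\qquad(\boldsymbol{w}_h,\boldsymbol{v}_K)_K=(\boldsymbol{u}_h,\boldsymbol{v}_K)_K\ \ \forall\boldsymbol{v}_K\in P_hV_h^{l}|_K.$$ Local norm and indicator. $\mathcal{E}_K^0$ and $\mathcal{E}_K^D$ are the sets of edges/faces of $K$ that are interior to $\Omega$, respectively on $\Gamma_D$; $h_E$ is the size of $E$; $[\![\boldsymbol{v}]\!]|_E=\boldsymbol{v}|_{K^+}-\boldsymbol{v}|_{K^-}$ for $E$ shared by $K^+,K^-$. For piecewise polynomials and functions in $[H^1(\Omega)]^d$ (and sums), $$\|\boldsymbol{v}\|_{h,K}^2=\|\varepsilon(\boldsymbol{v})\|_K^2+\frac12\sum_{E\in\mathcal{E}_K^0}h_E^{-1}\|[\![\boldsymbol{v}]\!]\|_E^2+\sum_{E\in\mathcal{E}_K^D}h_E^{-1}\|\boldsymbol{v}\|_E^2,$$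 $$\eta_K^2=\mu\|\varepsilon(\boldsymbol{r}_h)\|_K^2+\mu\|\mathcal{C}\boldsymbol{\sigma}_h-\varepsilon(\boldsymbol{w}_h)\|_K^2+\frac{\mu}{2}\sum_{E\in\mathcal{E}_K^0}h_E^{-1}\|[\![\boldsymbol{w}_h]\!]\|_E^2+\mu\sum_{E\in\mathcal{E}_K^D}h_E^{-1}\|\boldsymbol{w}_h\|_E^2.$$ *)

theory Defs
  imports "HOL-Analysis.Analysis"
begin

section \<open>Square-integrable fields and surface measure\<close>

text \<open>Fields are total functions on the whole space; only their values almost everywhere on the set
  under consideration matter.\<close>

definition square_integrable :: "'a measure \<Rightarrow> ('a \<Rightarrow> 'b::euclidean_space) \<Rightarrow> bool" where
  "square_integrable M v \<longleftrightarrow>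
     v \<in> borel_measurable M \<and> integrable M (\<lambda>x. (norm (v x))\<^sup>2)"

definition L2_inner :: "'a measure \<Rightarrow> ('a \<Rightarrow> 'b::euclidean_space) \<Rightarrow> ('a \<Rightarrow> 'b) \<Rightarrow> real" where
  "L2_inner M v w = (LINT x|M. v x \<bullet> w x)"

definition L2_norm :: "'a measure \<Rightarrow> ('a \<Rightarrow> 'b::euclidean_space) \<Rightarrow> real" where
  "L2_norm M v = sqrt (L2_inner M v v)"

text \<open>The Lebesgue measure of a hyperplane \<open>P\<close>: by Fubini, the measure of \<open>A \<subseteq> P\<close> is the
  volume of the part of the slab of thickness 1 around \<open>P\<close> that projects orthogonally into \<open>A\<close>.\<close>

definition hyperplane_measure :: "'a::euclidean_space set \<Rightarrow> 'a measure" where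
  "hyperplane_measure P =
     distr (restrict_space lborel {x. infdist x P \<le> 1/2}) borel (closest_point P)"

definition is_hyperplane :: "'a::euclidean_space set \<Rightarrow> bool" where
  "is_hyperplane P \<longleftrightarrow> affine P \<and> aff_dim P = int DIM('a) - 1"

text \<open>Surface measure on a set \<open>S\<close> contained in a finite union of hyperplanes, such as the
  boundary of a polyhedral domain, a Borel part of it, or a single face. Only the finitely many
  hyperplanes that meet \<open>S\<close> in positive measure contribute, and two of them overlap in a null set.\<close>

definition surface_measure :: "'a::euclidean_space set \<Rightarrow> 'a measure" where
  "surface_measure S = measure_of UNIV (sets borel)
     (\<lambda>A. \<Sum>P | is_hyperplane P \<and> 0 < emeasure (hyperplane_measure P) S.
            emeasure (hyperplane_measure P) (A \<inter> S))"

section \<open>Weak derivatives, Sobolev spaces, traces\<close>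

coinductive smooth :: "('a::euclidean_space \<Rightarrow> 'b::real_normed_vector) \<Rightarrow> bool" where
  "(\<And>x. f differentiable at x) \<Longrightarrow>
   (\<And>b. b \<in> Basis \<Longrightarrow> smooth (\<lambda>x. frechet_derivative f (at x) b)) \<Longrightarrow> smooth f"

definition test_function :: "'a::euclidean_space set \<Rightarrow> ('a \<Rightarrow> real) \<Rightarrow> bool" where
  "test_function U \<phi> \<longleftrightarrow>
     smooth \<phi> \<and> compact (closure {x. \<phi> x \<noteq> 0}) \<and> closure {x. \<phi> x \<noteq> 0} \<subseteq> U"

definition partial :: "'d::finite \<Rightarrow> (real^'d \<Rightarrow> real) \<Rightarrow> real^'d \<Rightarrow> real" where
  "partial j \<phi> x = frechet_derivative \<phi> (at x) (axis j 1)"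

text \<open>Row \<open>i\<close> of the gradient of a vector field is the gradient of its \<open>i\<close>-th component, so that
  \<^term>\<open>jacobian v (at x)\<close> is the gradient of a smooth field.\<close>

definition is_weak_grad :: "(real^'d) set \<Rightarrow> (real^'d \<Rightarrow> real^'d) \<Rightarrow> (real^'d \<Rightarrow> real^'d^'d) \<Rightarrow> bool"
  where
  "is_weak_grad U v G \<longleftrightarrow> square_integrable (lebesgue_on U) G \<and>
     (\<forall>\<phi> i j. test_function U \<phi> \<longrightarrow>
        (LINT x|lebesgue_on U. v x $ i * partial j \<phi> x)
          = - (LINT x|lebesgue_on U. G x $ i $ j * \<phi> x))"

definition H1 :: "(real^'d) set \<Rightarrow> (real^'d \<Rightarrow> real^'d) set" where
  "H1 U = {v. square_integrable (lebesgue_on U) v \<and> (\<exists>G. is_weak_grad U v G)}"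

definition weak_grad :: "(real^'d) set \<Rightarrow> (real^'d \<Rightarrow> real^'d) \<Rightarrow> real^'d \<Rightarrow> real^'d^'d" where
  "weak_grad U v = (SOME G. is_weak_grad U v G)"

definition strain :: "(real^'d) set \<Rightarrow> (real^'d \<Rightarrow> real^'d) \<Rightarrow> real^'d \<Rightarrow> real^'d^'d" where
  "strain U v x = (1/2) *\<^sub>R (weak_grad U v x + transpose (weak_grad U v x))"

definition is_weak_div :: "(real^'d) set \<Rightarrow> (real^'d \<Rightarrow> real^'d^'d) \<Rightarrow> (real^'d \<Rightarrow> real^'d) \<Rightarrow> bool"
  where
  "is_weak_div U \<tau> q \<longleftrightarrow> square_integrable (lebesgue_on U) q \<and>
     (\<forall>\<phi> i. test_function U \<phi> \<longrightarrow>
        (LINT x|lebesgue_on U. (\<Sum>j\<in>UNIV. \<tau> x $ i $ j * partial j \<phi> x))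
          = - (LINT x|lebesgue_on U. q x $ i * \<phi> x))"

definition weak_div :: "(real^'d) set \<Rightarrow> (real^'d \<Rightarrow> real^'d^'d) \<Rightarrow> real^'d \<Rightarrow> real^'d" where
  "weak_div U \<tau> = (SOME q. is_weak_div U \<tau> q)"

definition Hdiv :: "(real^'d) set \<Rightarrow> (real^'d \<Rightarrow> real^'d^'d) set" where
  "Hdiv U = {\<tau>. square_integrable (lebesgue_on U) \<tau> \<and>
     (AE x in lebesgue_on U. transpose (\<tau> x) = \<tau> x) \<and> (\<exists>q. is_weak_div U \<tau> q)}"

text \<open>The trace of an \<open>H1\<close> field on a part \<open>S\<close> of the boundary, as the continuous extension of the
  restriction map from fields that are smooth up to the boundary.\<close>

definition has_trace ::
  "(real^'d) set \<Rightarrow> (real^'d) set \<Rightarrow> (real^'d \<Rightarrow> real^'d) \<Rightarrow> (real^'d \<Rightarrow> real^'d) \<Rightarrow> bool" where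
  "has_trace U S v g \<longleftrightarrow> v \<in> H1 U \<and> square_integrable (surface_measure S) g \<and>
     (\<exists>\<phi> :: nat \<Rightarrow> real^'d \<Rightarrow> real^'d. (\<forall>n. smooth (\<phi> n)) \<and>
        (\<lambda>n. L2_norm (lebesgue_on U) (\<lambda>x. \<phi> n x - v x)) \<longlonglongrightarrow> 0 \<and>
        (\<lambda>n. L2_norm (lebesgue_on U) (\<lambda>x. jacobian (\<phi> n) (at x) - weak_grad U v x)) \<longlonglongrightarrow> 0 \<and>
        (\<lambda>n. L2_norm (surface_measure S) (\<lambda>x. \<phi> n x - g x)) \<longlonglongrightarrow> 0)"

definition trace_on ::
  "(real^'d) set \<Rightarrow> (real^'d) set \<Rightarrow> (real^'d \<Rightarrow> real^'d) \<Rightarrow> real^'d \<Rightarrow> real^'d" where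
  "trace_on U S v = (SOME g. has_trace U S v g)"

text \<open>\<open>\<tau> n = q\<close> on the part \<open>S\<close> of the boundary, in the sense of Green's formula
  \<open>(div \<tau>, \<phi>) + (\<tau>, grad \<phi>) = \<integral>\<^sub>S q \<cdot> \<phi>\<close> for all \<open>\<phi>\<close> vanishing near the rest of the boundary.\<close>

definition has_normal_trace ::
  "(real^'d) set \<Rightarrow> (real^'d) set \<Rightarrow> (real^'d \<Rightarrow> real^'d^'d) \<Rightarrow> (real^'d \<Rightarrow> real^'d) \<Rightarrow> bool" where
  "has_normal_trace U S \<tau> q \<longleftrightarrow> \<tau> \<in> Hdiv U \<and> square_integrable (surface_measure S) q \<and>
     (\<forall>\<phi> :: real^'d \<Rightarrow> real^'d. smooth \<phi> \<and>
        (\<exists>N. open N \<and> frontier U - S \<subseteq> N \<and> (\<forall>x\<in>N. \<phi> x = 0)) \<longrightarrow>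
        L2_inner (lebesgue_on U) (weak_div U \<tau>) \<phi>
          + L2_inner (lebesgue_on U) \<tau> (\<lambda>x. jacobian \<phi> (at x))
          = L2_inner (surface_measure S) q \<phi>)"

section \<open>The elasticity problem\<close>

definition polyhedral_domain :: "'a::euclidean_space set \<Rightarrow> bool" where
  "polyhedral_domain \<Omega> \<longleftrightarrow> open \<Omega> \<and> connected \<Omega> \<and> \<Omega> \<noteq> {} \<and> bounded \<Omega> \<and>
     interior (closure \<Omega>) = \<Omega> \<and>
     (\<exists>\<P>. finite \<P> \<and> (\<forall>P\<in>\<P>. polytope P) \<and> closure \<Omega> = \<Union>\<P>)"

definition boundary_splitting ::
  "'a::euclidean_space set \<Rightarrow> 'a set \<Rightarrow> 'a set \<Rightarrow> bool" where
  "boundary_splitting \<Omega> \<Gamma>D \<Gamma>N \<longleftrightarrow> \<Gamma>D \<union> \<Gamma>N = frontier \<Omega> \<and> \<Gamma>D \<inter> \<Gamma>N = {} \<and>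
     \<Gamma>D \<in> sets borel \<and> \<Gamma>N \<in> sets borel \<and> 0 < emeasure (surface_measure (frontier \<Omega>)) \<Gamma>D"

definition compliance :: "real \<Rightarrow> real \<Rightarrow> real^'d^'d \<Rightarrow> real^'d^'d" where
  "compliance \<mu> lam \<tau> =
     (1 / (2 * \<mu>)) *\<^sub>R (\<tau> - (lam / (2 * \<mu> + real CARD('d) * lam) * trace \<tau>) *\<^sub>R mat 1)"

definition H1D :: "(real^'d) set \<Rightarrow> (real^'d) set \<Rightarrow> (real^'d \<Rightarrow> real^'d) set" where
  "H1D \<Omega> \<Gamma>D = {v \<in> H1 \<Omega>. has_trace \<Omega> \<Gamma>D v (\<lambda>x. 0)}"

definition elasticity_solution ::
  "(real^'d) set \<Rightarrow> (real^'d) set \<Rightarrow> (real^'d) set \<Rightarrow> real \<Rightarrow> real \<Rightarrow>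
   (real^'d \<Rightarrow> real^'d) \<Rightarrow> (real^'d \<Rightarrow> real^'d) \<Rightarrow>
   (real^'d \<Rightarrow> real^'d) \<Rightarrow> (real^'d \<Rightarrow> real^'d^'d) \<Rightarrow> bool" where
  "elasticity_solution \<Omega> \<Gamma>D \<Gamma>N \<mu> lam f g u \<sigma> \<longleftrightarrow>
     u \<in> H1D \<Omega> \<Gamma>D \<and> \<sigma> \<in> Hdiv \<Omega> \<and>
     (AE x in lebesgue_on \<Omega>. compliance \<mu> lam (\<sigma> x) - strain \<Omega> u x = 0) \<and>
     (AE x in lebesgue_on \<Omega>. - weak_div \<Omega> \<sigma> x = f x) \<and>
     has_normal_trace \<Omega> \<Gamma>N \<sigma> g"

section \<open>Meshes and piecewise polynomials\<close>

definition simplicial_mesh :: "(real^'d) set \<Rightarrow> (real^'d) set set \<Rightarrow> bool" where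
  "simplicial_mesh \<Omega> \<T> \<longleftrightarrow> triangulation \<T> \<and> (\<forall>K\<in>\<T>. int CARD('d) simplex K) \<and>
     \<Union>\<T> = closure \<Omega>"

definition faces_in :: "'a::euclidean_space set \<Rightarrow> 'a set \<Rightarrow> 'a set set" where
  "faces_in S K = {E. E facet_of K \<and> rel_interior E \<subseteq> S}"

definition mesh_fits_boundary ::
  "(real^'d) set \<Rightarrow> (real^'d) set \<Rightarrow> (real^'d) set \<Rightarrow> (real^'d) set set \<Rightarrow> bool" where
  "mesh_fits_boundary \<Omega> \<Gamma>D \<Gamma>N \<T> \<longleftrightarrow>
     (\<forall>K\<in>\<T>. \<forall>E. E facet_of K \<and> E \<subseteq> frontier \<Omega> \<longrightarrow> E \<in> faces_in \<Gamma>D K \<or> E \<in> faces_in \<Gamma>N K)"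

definition poly_deg_le :: "nat \<Rightarrow> (real^'d \<Rightarrow> real) \<Rightarrow> bool" where
  "poly_deg_le m p \<longleftrightarrow> (\<exists>c :: ('d \<Rightarrow> nat) \<Rightarrow> real.
     \<forall>x. p x = (\<Sum>\<alpha> | sum \<alpha> UNIV \<le> m. c \<alpha> * (\<Prod>i\<in>UNIV. x $ i ^ \<alpha> i)))"

definition vec_poly :: "nat \<Rightarrow> (real^'d \<Rightarrow> real^'d) \<Rightarrow> bool" where
  "vec_poly m p \<longleftrightarrow> (\<forall>i. poly_deg_le m (\<lambda>x. p x $ i))"

definition mat_poly :: "nat \<Rightarrow> (real^'d \<Rightarrow> real^'d^'d) \<Rightarrow> bool" where
  "mat_poly m p \<longleftrightarrow> (\<forall>i j. poly_deg_le m (\<lambda>x. p x $ i $ j))"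

definition pw_poly :: "(real^'d) set \<Rightarrow> (real^'d) set set \<Rightarrow> nat \<Rightarrow> (real^'d \<Rightarrow> real^'d) set" where
  "pw_poly \<Omega> \<T> m = {v. square_integrable (lebesgue_on \<Omega>) v \<and>
     (\<forall>K\<in>\<T>. \<exists>p. vec_poly m p \<and> (AE x in lebesgue_on K. v x = p x))}"

section \<open>The mixed elements\<close>

text \<open>The argument is the degree \<open>k\<close> of the family.\<close>

datatype mixed_family = ADG nat | GN nat | AAW nat | JM

fun disp_degree :: "mixed_family \<Rightarrow> nat" where
  "disp_degree (ADG k) = k - 1"
| "disp_degree (GN k) = k - 1"
| "disp_degree (AAW k) = k - 1"
| "disp_degree JM = 1"

fun traction_degree :: "mixed_family \<Rightarrow> nat" where
  "traction_degree (ADG k) = k"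
| "traction_degree (GN k) = k"
| "traction_degree (AAW k) = k"
| "traction_degree JM = 1"

fun post_degree :: "mixed_family \<Rightarrow> nat" where
  "post_degree (ADG k) = k + 1"
| "post_degree (GN k) = k + 1"
| "post_degree (AAW k) = k + 1"
| "post_degree JM = 2"

definition disp_space ::
  "(real^'d) set \<Rightarrow> (real^'d) set set \<Rightarrow> mixed_family \<Rightarrow> (real^'d \<Rightarrow> real^'d) set" where
  "disp_space \<Omega> \<T> fam = pw_poly \<Omega> \<T> (disp_degree fam)"

text \<open>Here and below, \<open>S\<close> assigns to each simplex \<open>K\<close> the local stress space \<open>S(K)\<close>.\<close>

definition stress_space ::
  "((real^'d) set \<Rightarrow> (real^'d \<Rightarrow> real^'d^'d) set) \<Rightarrow> (real^'d) set \<Rightarrow> (real^'d) set set \<Rightarrow>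
   (real^'d \<Rightarrow> real^'d^'d) set" where
  "stress_space S \<Omega> \<T> =
     {\<tau> \<in> Hdiv \<Omega>. \<forall>K\<in>\<T>. \<exists>s\<in>S K. AE x in lebesgue_on K. \<tau> x = s x}"

definition alfeld_split :: "'a::euclidean_space set \<Rightarrow> 'a set set" where
  "alfeld_split K = (let C = {x. x extreme_point_of K}; b = (1 / real (card C)) *\<^sub>R \<Sum>C
     in (\<lambda>v. convex hull (insert b (C - {v}))) ` C)"

definition johnson_mercier_space :: "(real^'d) set \<Rightarrow> (real^'d \<Rightarrow> real^'d^'d) set" where
  "johnson_mercier_space K = {\<tau> \<in> Hdiv (interior K).
     \<forall>T\<in>alfeld_split K. \<exists>p. mat_poly 1 p \<and> (AE x in lebesgue_on T. \<tau> x = p x)}"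

definition stress_subspace :: "(real^'d) set \<Rightarrow> (real^'d \<Rightarrow> real^'d^'d) set \<Rightarrow> bool" where
  "stress_subspace K W \<longleftrightarrow>
     (\<forall>\<tau>\<in>W. \<exists>q. has_normal_trace (interior K) (frontier K) \<tau> q) \<and>
     (\<forall>\<tau>\<in>W. \<forall>\<tau>'\<in>W. \<forall>a b. (\<lambda>x. a *\<^sub>R \<tau> x + b *\<^sub>R \<tau>' x) \<in> W)"

text \<open>The moments \<open>\<integral>\<^sub>K \<tau> : \<epsilon>(v)\<close> and \<open>\<integral>\<^sub>E \<tau> n \<cdot> \<psi>\<^sub>E\<close> belong to a set of degrees of freedom, i.e. they
  are linearly independent functionals on \<open>W\<close>. They need not determine \<open>\<tau>\<close> on their own: for large
  \<open>k\<close> they are fewer than the dimension of the symmetric polynomials of degree \<open>k\<close>.\<close>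

definition independent_moments :: "nat \<Rightarrow> (real^'d) set \<Rightarrow> (real^'d \<Rightarrow> real^'d^'d) set \<Rightarrow> bool" where
  "independent_moments k K W \<longleftrightarrow>
     (\<forall>v \<psi>. vec_poly (k - 1) v \<and> (\<forall>E. vec_poly k (\<psi> E)) \<and>
        (\<forall>\<tau>\<in>W. \<forall>q. has_normal_trace (interior K) (frontier K) \<tau> q \<longrightarrow>
           L2_inner (lebesgue_on K) \<tau> (strain (interior K) v)
             + (\<Sum>E | E facet_of K. L2_inner (surface_measure E) q (\<psi> E)) = 0) \<longrightarrow>
        (AE x in lebesgue_on K. strain (interior K) v x = 0) \<and>
        (\<forall>E. E facet_of K \<longrightarrow> (\<forall>x\<in>E. \<psi> E x = 0)))"

definition polynomial_rich_family ::
  "nat \<Rightarrow> ((real^'d) set \<Rightarrow> (real^'d \<Rightarrow> real^'d^'d) set) \<Rightarrow> bool" where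
  "polynomial_rich_family k S \<longleftrightarrow>
     (\<forall>K. int CARD('d) simplex K \<longrightarrow>
        stress_subspace K (S K) \<and>
        {p. mat_poly k p \<and> (\<forall>x. transpose (p x) = p x)} \<subseteq> S K \<and>
        independent_moments k K (S K)) \<and>
     (\<forall>\<Omega> \<T>. polyhedral_domain \<Omega> \<and> simplicial_mesh \<Omega> \<T> \<longrightarrow>
        weak_div \<Omega> ` stress_space S \<Omega> \<T> \<subseteq> pw_poly \<Omega> \<T> (k - 1))"

text \<open>The Johnson-Mercier space is given explicitly. For the composite, rational and polynomial
  constructions of the other families, \<open>S\<close> may be any assignment of local spaces with the
  properties collected in \<open>polynomial_rich_family\<close>.\<close>

fun is_stress_family ::
  "mixed_family \<Rightarrow> ((real^'d) set \<Rightarrow> (real^'d \<Rightarrow> real^'d^'d) set) \<Rightarrow> bool" where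
  "is_stress_family (ADG k) S \<longleftrightarrow> CARD('d) = 2 \<and> 2 \<le> k \<and> polynomial_rich_family k S"
| "is_stress_family (GN k) S \<longleftrightarrow> CARD('d) = 2 \<and> 2 \<le> k \<and> polynomial_rich_family k S"
| "is_stress_family (AAW k) S \<longleftrightarrow> CARD('d) = 3 \<and> 2 \<le> k \<and> polynomial_rich_family k S"
| "is_stress_family JM S \<longleftrightarrow> CARD('d) = 2 \<and>
     (\<forall>K. int CARD('d) simplex K \<longrightarrow> S K = johnson_mercier_space K)"

section \<open>The discrete mixed problem\<close>

text \<open>\<open>q = Q\<^sub>h g\<close> on the faces contained in \<open>\<Gamma>N\<close>.\<close>

definition is_traction_projection ::
  "(real^'d) set \<Rightarrow> (real^'d) set set \<Rightarrow> nat \<Rightarrow> (real^'d \<Rightarrow> real^'d) \<Rightarrow> (real^'d \<Rightarrow> real^'d) \<Rightarrow> bool"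
  where
  "is_traction_projection \<Gamma>N \<T> m g q \<longleftrightarrow>
     (\<forall>K\<in>\<T>. \<forall>E\<in>faces_in \<Gamma>N K. \<exists>p. vec_poly m p \<and> (AE x in surface_measure E. q x = p x) \<and>
        (\<forall>p'. vec_poly m p' \<longrightarrow> L2_inner (surface_measure E) (\<lambda>x. g x - p x) p' = 0))"

definition stress_space_g ::
  "((real^'d) set \<Rightarrow> (real^'d \<Rightarrow> real^'d^'d) set) \<Rightarrow> (real^'d) set \<Rightarrow> (real^'d) set \<Rightarrow>
   (real^'d) set set \<Rightarrow> mixed_family \<Rightarrow> (real^'d \<Rightarrow> real^'d) \<Rightarrow> (real^'d \<Rightarrow> real^'d^'d) set" where
  "stress_space_g S \<Omega> \<Gamma>N \<T> fam g = {\<tau> \<in> stress_space S \<Omega> \<T>.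
     \<exists>q. is_traction_projection \<Gamma>N \<T> (traction_degree fam) g q \<and> has_normal_trace \<Omega> \<Gamma>N \<tau> q}"

definition stress_space_0 ::
  "((real^'d) set \<Rightarrow> (real^'d \<Rightarrow> real^'d^'d) set) \<Rightarrow> (real^'d) set \<Rightarrow> (real^'d) set \<Rightarrow>
   (real^'d) set set \<Rightarrow> (real^'d \<Rightarrow> real^'d^'d) set" where
  "stress_space_0 S \<Omega> \<Gamma>N \<T> =
     {\<tau> \<in> stress_space S \<Omega> \<T>. has_normal_trace \<Omega> \<Gamma>N \<tau> (\<lambda>x. 0)}"

definition discrete_mixed_solution ::
  "mixed_family \<Rightarrow> ((real^'d) set \<Rightarrow> (real^'d \<Rightarrow> real^'d^'d) set) \<Rightarrow> (real^'d) set \<Rightarrow> (real^'d) set \<Rightarrow>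
   (real^'d) set set \<Rightarrow> real \<Rightarrow> real \<Rightarrow> (real^'d \<Rightarrow> real^'d) \<Rightarrow> (real^'d \<Rightarrow> real^'d) \<Rightarrow>
   (real^'d \<Rightarrow> real^'d^'d) \<Rightarrow> (real^'d \<Rightarrow> real^'d) \<Rightarrow> bool" where
  "discrete_mixed_solution fam S \<Omega> \<Gamma>N \<T> \<mu> lam f g \<sigma>h uh \<longleftrightarrow>
     \<sigma>h \<in> stress_space_g S \<Omega> \<Gamma>N \<T> fam g \<and> uh \<in> disp_space \<Omega> \<T> fam \<and>
     (\<forall>\<tau>\<in>stress_space_0 S \<Omega> \<Gamma>N \<T>. \<forall>v\<in>disp_space \<Omega> \<T> fam.
        L2_inner (lebesgue_on \<Omega>) (\<lambda>x. compliance \<mu> lam (\<sigma>h x)) \<tau>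
        + L2_inner (lebesgue_on \<Omega>) uh (weak_div \<Omega> \<tau>)
        + L2_inner (lebesgue_on \<Omega>) v (weak_div \<Omega> \<sigma>h)
        + L2_inner (lebesgue_on \<Omega>) f v = 0)"

section \<open>The local residual minimization\<close>

definition is_L2_projection ::
  "(real^'d) set \<Rightarrow> (real^'d \<Rightarrow> real^'d) set \<Rightarrow> (real^'d \<Rightarrow> real^'d) \<Rightarrow> (real^'d \<Rightarrow> real^'d) \<Rightarrow> bool"
  where
  "is_L2_projection \<Omega> V v p \<longleftrightarrow>
     p \<in> V \<and> (\<forall>q\<in>V. L2_inner (lebesgue_on \<Omega>) (\<lambda>x. v x - p x) q = 0)"

text \<open>For the \<open>L\<^sup>2\<close>-projection \<open>P\<^sub>h\<close> onto \<open>V\<^sub>h\<close>, the spaces \<open>P\<^sub>h V\<^sub>h\<^sup>m\<close> and \<open>(I - P\<^sub>h) V\<^sub>h\<^sup>m\<close>; as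
  \<open>P\<^sub>h v\<close> is determined almost everywhere only, both contain all representatives.\<close>

definition proj_space ::
  "(real^'d) set \<Rightarrow> (real^'d) set set \<Rightarrow> mixed_family \<Rightarrow> nat \<Rightarrow> (real^'d \<Rightarrow> real^'d) set" where
  "proj_space \<Omega> \<T> fam m =
     {p. \<exists>v\<in>pw_poly \<Omega> \<T> m. is_L2_projection \<Omega> (disp_space \<Omega> \<T> fam) v p}"

definition coproj_space ::
  "(real^'d) set \<Rightarrow> (real^'d) set set \<Rightarrow> mixed_family \<Rightarrow> nat \<Rightarrow> (real^'d \<Rightarrow> real^'d) set" where
  "coproj_space \<Omega> \<T> fam m =
     {\<lambda>x. v x - p x | v p. v \<in> pw_poly \<Omega> \<T> m \<and> is_L2_projection \<Omega> (disp_space \<Omega> \<T> fam) v p}"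

definition local_residual_solution ::
  "mixed_family \<Rightarrow> (real^'d) set \<Rightarrow> (real^'d) set set \<Rightarrow> real \<Rightarrow> real \<Rightarrow>
   (real^'d \<Rightarrow> real^'d^'d) \<Rightarrow> (real^'d \<Rightarrow> real^'d) \<Rightarrow>
   (real^'d \<Rightarrow> real^'d) \<Rightarrow> (real^'d \<Rightarrow> real^'d) \<Rightarrow> bool" where
  "local_residual_solution fam \<Omega> \<T> \<mu> lam \<sigma>h uh rh wh \<longleftrightarrow>
     (let l = post_degree fam in
      rh \<in> coproj_space \<Omega> \<T> fam (l + 1) \<and> wh \<in> pw_poly \<Omega> \<T> l \<and>
      (\<forall>K\<in>\<T>. let \<epsilon> = strain (interior K); ip = L2_inner (lebesgue_on K) in
        (\<forall>v\<in>coproj_space \<Omega> \<T> fam (l + 1).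
           ip (\<epsilon> rh) (\<epsilon> v) + ip (\<epsilon> wh) (\<epsilon> v) = ip (\<lambda>x. compliance \<mu> lam (\<sigma>h x)) (\<epsilon> v)) \<and>
        (\<forall>v\<in>coproj_space \<Omega> \<T> fam l. ip (\<epsilon> v) (\<epsilon> rh) = 0) \<and>
        (\<forall>v\<in>proj_space \<Omega> \<T> fam l.
           L2_inner (lebesgue_on K) wh v = L2_inner (lebesgue_on K) uh v)))"

section \<open>Broken norm and error indicator\<close>

definition neighbour :: "'a::euclidean_space set set \<Rightarrow> 'a set \<Rightarrow> 'a set \<Rightarrow> 'a set" where
  "neighbour \<T> K E = (SOME K'. K' \<in> \<T> \<and> K' \<noteq> K \<and> E facet_of K')"

text \<open>The jump is oriented from \<open>K\<close> to its neighbour; only its norm is used.\<close>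

definition jump ::
  "(real^'d) set set \<Rightarrow> (real^'d) set \<Rightarrow> (real^'d) set \<Rightarrow> (real^'d \<Rightarrow> real^'d) \<Rightarrow> real^'d \<Rightarrow> real^'d"
  where
  "jump \<T> K E v x =
     trace_on (interior K) E v x - trace_on (interior (neighbour \<T> K E)) E v x"

text \<open>The size of a face is its diameter.\<close>

definition jump_terms ::
  "(real^'d) set \<Rightarrow> (real^'d) set \<Rightarrow> (real^'d) set set \<Rightarrow> (real^'d) set \<Rightarrow>
   (real^'d \<Rightarrow> real^'d) \<Rightarrow> real" where
  "jump_terms \<Omega> \<Gamma>D \<T> K v =
     1/2 * (\<Sum>E\<in>faces_in \<Omega> K. 1 / diameter E * (L2_norm (surface_measure E) (jump \<T> K E v))\<^sup>2)
     + (\<Sum>E\<in>faces_in \<Gamma>D K.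
          1 / diameter E * (L2_norm (surface_measure E) (trace_on (interior K) E v))\<^sup>2)"

definition local_norm ::
  "(real^'d) set \<Rightarrow> (real^'d) set \<Rightarrow> (real^'d) set set \<Rightarrow> (real^'d) set \<Rightarrow>
   (real^'d \<Rightarrow> real^'d) \<Rightarrow> real" where
  "local_norm \<Omega> \<Gamma>D \<T> K v =
     sqrt ((L2_norm (lebesgue_on K) (strain (interior K) v))\<^sup>2 + jump_terms \<Omega> \<Gamma>D \<T> K v)"

definition error_indicator ::
  "(real^'d) set \<Rightarrow> (real^'d) set \<Rightarrow> (real^'d) set set \<Rightarrow> real \<Rightarrow> real \<Rightarrow>
   (real^'d \<Rightarrow> real^'d^'d) \<Rightarrow> (real^'d \<Rightarrow> real^'d) \<Rightarrow> (real^'d \<Rightarrow> real^'d) \<Rightarrow>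
   (real^'d) set \<Rightarrow> real" where
  "error_indicator \<Omega> \<Gamma>D \<T> \<mu> lam \<sigma>h rh wh K =
     sqrt (\<mu> * (L2_norm (lebesgue_on K) (strain (interior K) rh))\<^sup>2
       + \<mu> * (L2_norm (lebesgue_on K)
                 (\<lambda>x. compliance \<mu> lam (\<sigma>h x) - strain (interior K) wh x))\<^sup>2
       + \<mu> * jump_terms \<Omega> \<Gamma>D \<T> K wh)"

end

theory Submission
  imports Defs "HOL-Computational_Algebra.Polynomial"
begin

text \<open>Write \<open>C\<close> for the compliance and \<open>\<epsilon>\<close> for the strain. The estimate is local and elementary once the
  terms of the indicator are compared with those of the error. Testing the first equation of the
  local system with \<open>rh\<close> itself bounds the norm of \<open>\<epsilon>(rh)\<close> by that of the constitutive residual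
  \<open>C \<sigma>h - \<epsilon>(wh)\<close> (\<open>residual_norm_le\<close>). As \<open>C \<sigma> = \<epsilon>(u)\<close>, this residual equals
  \<open>\<epsilon>(u - wh) - C (\<sigma> - \<sigma>h)\<close>, and \<open>C\<close> has norm at most \<open>1 / (2 \<mu>)\<close> whatever the second Lame parameter is
  (\<open>norm_compliance_le\<close>, \<open>constitutive_residual_le\<close>). The exact displacement has no jumps and
  vanishes on the Dirichlet boundary, so the jump terms of \<open>wh\<close> are those of \<open>u - wh\<close>
  (\<open>jump_terms_eq\<close>). Adding up gives the constant 2 for all meshes and all parameters.

  The work lies in making these comparisons for fields that are only weakly differentiable. Three facts
  are needed.

  Weak gradients are unique almost everywhere, so that they are linear, compatible with restriction
  to a simplex, and given by the classical gradient for polynomials. This follows from the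
  fundamental lemma of the calculus of variations with tensor products of bump functions
  (\<open>fundamental_lemma_of_variations\<close>) and integration by parts (\<open>is_weak_grad_smooth\<close>).

  A field that is approximated in \<open>H\<^sup>1\<close> by smooth fields has a unique trace on each facet of a simplex.
  Existence and uniqueness follow from the trace inequality for smooth fields
  (\<open>trace_inequality_facet\<close>) and the completeness of \<open>L\<^sup>2\<close>. To prove the inequality, the facet is covered by pieces from which one can enter the simplex along segments parallel to an edge; on each
  segment one has a one-dimensional trace inequality, and Fubini's theorem in the slab around the facet
  turns the integrals over these segments into a volume integral (\<open>nn_integral_slab_segments_le\<close>). The
  displacement \<open>u\<close> is approximated by one sequence of smooth fields on the whole domain, because it has
  a trace on the Dirichlet boundary; that sequence determines the trace of \<open>u\<close> from both sides of a face.

  Each interior face is shared with a second simplex (\<open>mesh_neighbour\<close>), so the jump over it is a difference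
  of two actual traces.\<close>

section \<open>Square-integrable fields\<close>

lemma L2D:
  assumes "square_integrable M v"
  shows "v \<in> borel_measurable M" "integrable M (\<lambda>x. (norm (v x))\<^sup>2)"
  using assms by (auto simp: square_integrable_def)

lemma L2_dominated:
  fixes v :: "'a \<Rightarrow> 'b::euclidean_space"
  assumes "v \<in> borel_measurable M" "integrable M g" "AE x in M. (norm (v x))\<^sup>2 \<le> g x"
  shows "square_integrable M v"
proof -
  have "integrable M (\<lambda>x. (norm (v x))\<^sup>2)"
    using assms by (intro Bochner_Integration.integrable_bound[OF assms(2)]) auto
  then show ?thesis using assms by (simp add: square_integrable_def)
qed

lemma norm_add_squared_le: "(norm (a + b :: 'b::real_inner))\<^sup>2 \<le> 2 * (norm a)\<^sup>2 + 2 * (norm b)\<^sup>2"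
  using zero_le_power2[of "norm (a - b)"]
  unfolding power2_norm_eq_inner by (simp add: inner_simps inner_commute)

lemma norm_diff_squared_le: "(norm (a - b :: 'b::real_inner))\<^sup>2 \<le> 2 * (norm a)\<^sup>2 + 2 * (norm b)\<^sup>2"
  using norm_add_squared_le[of a "-b"] by simp

lemma L2_diff:
  fixes v w :: "'a \<Rightarrow> 'b::euclidean_space"
  assumes "square_integrable M v" "square_integrable M w"
  shows "square_integrable M (\<lambda>x. v x - w x)"
  using assms unfolding square_integrable_def
  by (intro L2_dominated[unfolded square_integrable_def,
        where g = "\<lambda>x. 2 * (norm (v x))\<^sup>2 + 2 * (norm (w x))\<^sup>2"]) (auto intro: norm_diff_squared_le)

lemma L2_zero: "square_integrable M (\<lambda>x. 0 :: 'b::euclidean_space)"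
  by (simp add: square_integrable_def)

lemma L2_linear:
  fixes v :: "'a \<Rightarrow> 'b::euclidean_space" and f :: "'b \<Rightarrow> 'c::euclidean_space"
  assumes f: "bounded_linear f" and v: "square_integrable M v"
  shows "square_integrable M (\<lambda>x. f (v x))"
proof -
  interpret bounded_linear f by fact
  obtain B where B: "\<And>x. norm (f x) \<le> norm x * B" using bounded by blast
  show ?thesis
  proof (rule L2_dominated[where g = "\<lambda>x. B\<^sup>2 * (norm (v x))\<^sup>2"])
    show "(\<lambda>x. f (v x)) \<in> borel_measurable M"
      using measurable_compose[OF L2D(1)[OF v]
          borel_measurable_continuous_onI[OF linear_continuous_on[OF f]]] .
    show "integrable M (\<lambda>x. B\<^sup>2 * (norm (v x))\<^sup>2)" using v by (simp add: square_integrable_def)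
    have "(norm (f y))\<^sup>2 \<le> B\<^sup>2 * (norm y)\<^sup>2" for y
      using power_mono[OF B[of y], of 2] by (simp add: power_mult_distrib mult.commute)
    then show "AE x in M. (norm (f (v x)))\<^sup>2 \<le> B\<^sup>2 * (norm (v x))\<^sup>2" by simp
  qed
qed

lemma L2_integrable_inner:
  fixes v w :: "'a \<Rightarrow> 'b::euclidean_space"
  assumes "square_integrable M v" "square_integrable M w"
  shows "integrable M (\<lambda>x. v x \<bullet> w x)"
proof (rule Bochner_Integration.integrable_bound)
  show "integrable M (\<lambda>x. (norm (v x))\<^sup>2 + (norm (w x))\<^sup>2)"
    using assms by (simp add: square_integrable_def)
  show "(\<lambda>x. v x \<bullet> w x) \<in> borel_measurable M"
    using assms by (auto simp: square_integrable_def intro!: borel_measurable_inner)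
  have "\<bar>a \<bullet> b\<bar> \<le> (norm a)\<^sup>2 + (norm b)\<^sup>2" for a b :: 'b
  proof -
    have "\<bar>a \<bullet> b\<bar> \<le> norm a * norm b" by (rule Cauchy_Schwarz_ineq2)
    also have "\<dots> \<le> (norm a)\<^sup>2 + (norm b)\<^sup>2"
      using sum_squares_bound[of "norm a" "norm b"] mult_nonneg_nonneg[OF norm_ge_zero norm_ge_zero, of a b]
      by linarith
    finally show ?thesis .
  qed
  then show "AE x in M. norm (v x \<bullet> w x) \<le> norm ((norm (v x))\<^sup>2 + (norm (w x))\<^sup>2)" by auto
qed

lemma L2_imp_integrable:
  fixes v :: "'a \<Rightarrow> 'b::euclidean_space"
  assumes "finite_measure M" "square_integrable M v"
  shows "integrable M v"
proof (rule Bochner_Integration.integrable_bound)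
  interpret finite_measure M by fact
  show "integrable M (\<lambda>x. 1 + (norm (v x))\<^sup>2)" using assms by (simp add: square_integrable_def)
  show "v \<in> borel_measurable M" using assms by (simp add: square_integrable_def)
  have "t \<le> 1 + t\<^sup>2" for t :: real using sum_squares_bound[of 1 t] zero_le_power2[of t] by (simp; linarith)
  then show "AE x in M. norm (v x) \<le> norm (1 + (norm (v x))\<^sup>2)" by auto
qed

lemma L2_norm_squared: "(L2_norm M v)\<^sup>2 = (LINT x|M. (norm (v x))\<^sup>2)"
  by (simp add: L2_norm_def L2_inner_def power2_norm_eq_inner)

lemma L2_norm_nonneg [simp]: "0 \<le> L2_norm M v"
  by (simp add: L2_norm_def L2_inner_def)

lemma L2_norm_squared_nn_integral:
  fixes v :: "'a \<Rightarrow> 'b::euclidean_space"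
  assumes "square_integrable M v"
  shows "ennreal ((L2_norm M v)\<^sup>2) = (\<integral>\<^sup>+x. ennreal ((norm (v x))\<^sup>2) \<partial>M)"
  unfolding L2_norm_squared
  by (rule nn_integral_eq_integral[symmetric]) (use L2D[OF assms] in auto)

lemma L2_norm_cong_AE:
  assumes "v \<in> borel_measurable M" "w \<in> borel_measurable M" "AE x in M. norm (v x) = norm (w x)"
  shows "L2_norm M v = L2_norm M w"
proof -
  have "(L2_norm M v)\<^sup>2 = (L2_norm M w)\<^sup>2"
    unfolding L2_norm_squared using assms by (intro integral_cong_AE) auto
  then show ?thesis by simp
qed

lemma L2_norm_squared_mono:
  fixes v w :: "'a \<Rightarrow> 'b::euclidean_space"
  assumes "square_integrable M v" "square_integrable M w" "AE x in M. norm (v x) \<le> norm (w x)"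
  shows "(L2_norm M v)\<^sup>2 \<le> (L2_norm M w)\<^sup>2"
proof -
  have "AE x in M. (norm (v x))\<^sup>2 \<le> (norm (w x))\<^sup>2"
    using assms(3) by eventually_elim (simp add: power_mono)
  then show ?thesis
    unfolding L2_norm_squared using assms by (intro integral_mono_AE) (auto simp: square_integrable_def)
qed

lemma L2_norm_diff_squared_le:
  fixes v w :: "'a \<Rightarrow> 'b::euclidean_space"
  assumes "square_integrable M v" "square_integrable M w"
  shows "(L2_norm M (\<lambda>x. v x - w x))\<^sup>2 \<le> 2 * (L2_norm M v)\<^sup>2 + 2 * (L2_norm M w)\<^sup>2"
proof -
  have "(L2_norm M (\<lambda>x. v x - w x))\<^sup>2 \<le> (LINT x|M. 2 * (norm (v x))\<^sup>2 + 2 * (norm (w x))\<^sup>2)"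
    unfolding L2_norm_squared
    using assms L2D(2)[OF L2_diff[OF assms]]
    by (intro integral_mono) (auto simp: square_integrable_def norm_diff_squared_le)
  also have "\<dots> = 2 * (L2_norm M v)\<^sup>2 + 2 * (L2_norm M w)\<^sup>2"
    using assms unfolding L2_norm_squared by (simp add: square_integrable_def)
  finally show ?thesis .
qed

lemma L2_norm_eq_0_imp_AE:
  fixes v :: "'a \<Rightarrow> 'b::euclidean_space"
  assumes "square_integrable M v" "L2_norm M v = 0"
  shows "AE x in M. v x = 0"
proof -
  have "(LINT x|M. (norm (v x))\<^sup>2) = 0" using assms(2) L2_norm_squared[of M v] by simp
  then show ?thesis using integral_nonneg_eq_0_iff_AE[OF L2D(2)[OF assms(1)]] by simp
qed

lemma L2_limit_unique:
  fixes v w :: "'a \<Rightarrow> 'b::euclidean_space"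
  assumes "square_integrable M v" "square_integrable M w" "\<And>n. square_integrable M (\<phi> n)"
    and "(\<lambda>n. L2_norm M (\<lambda>x. \<phi> n x - v x)) \<longlonglongrightarrow> 0" "(\<lambda>n. L2_norm M (\<lambda>x. \<phi> n x - w x)) \<longlonglongrightarrow> 0"
  shows "AE x in M. v x = w x"
proof -
  have "(L2_norm M (\<lambda>x. w x - v x))\<^sup>2
      \<le> 2 * (L2_norm M (\<lambda>x. \<phi> n x - v x))\<^sup>2 + 2 * (L2_norm M (\<lambda>x. \<phi> n x - w x))\<^sup>2" for n
    using L2_norm_diff_squared_le[OF L2_diff[OF assms(3,1)]
        L2_diff[OF assms(3,2)], of n n] by simp
  moreover have "(\<lambda>n. 2 * (L2_norm M (\<lambda>x. \<phi> n x - v x))\<^sup>2 + 2 * (L2_norm M (\<lambda>x. \<phi> n x - w x))\<^sup>2)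
      \<longlonglongrightarrow> 2 * 0\<^sup>2 + 2 * 0\<^sup>2"
    by (intro tendsto_intros assms)
  ultimately have "(L2_norm M (\<lambda>x. w x - v x))\<^sup>2 \<le> 2 * 0\<^sup>2 + 2 * 0\<^sup>2"
    by (intro tendsto_lowerbound[of _ _ sequentially]) auto
  then have "L2_norm M (\<lambda>x. w x - v x) = 0" by simp
  from L2_norm_eq_0_imp_AE[OF L2_diff[OF assms(2,1)] this]
  show ?thesis by eventually_elim simp
qed

lemma L2_tendsto_diff:
  fixes v w :: "'a \<Rightarrow> 'b::euclidean_space"
  assumes "square_integrable M v" "square_integrable M w"
    "\<And>n. square_integrable M (\<phi> n)" "\<And>n. square_integrable M (\<psi> n)"
    and v: "(\<lambda>n. L2_norm M (\<lambda>x. \<phi> n x - v x)) \<longlonglongrightarrow> 0"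
    and w: "(\<lambda>n. L2_norm M (\<lambda>x. \<psi> n x - w x)) \<longlonglongrightarrow> 0"
  shows "(\<lambda>n. L2_norm M (\<lambda>x. (\<phi> n x - \<psi> n x) - (v x - w x))) \<longlonglongrightarrow> 0"
proof -
  have eq: "(\<lambda>x. (\<phi> n x - \<psi> n x) - (v x - w x)) = (\<lambda>x. (\<phi> n x - v x) - (\<psi> n x - w x))" for n
    by (auto simp: fun_eq_iff)
  have "(L2_norm M (\<lambda>x. (\<phi> n x - \<psi> n x) - (v x - w x)))\<^sup>2
      \<le> 2 * (L2_norm M (\<lambda>x. \<phi> n x - v x))\<^sup>2 + 2 * (L2_norm M (\<lambda>x. \<psi> n x - w x))\<^sup>2" for n
    unfolding eq
    by (rule L2_norm_diff_squared_le[OF L2_diff[OF assms(3,1)]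
        L2_diff[OF assms(4,2)], of n n])
  moreover have "(\<lambda>n. 2 * (L2_norm M (\<lambda>x. \<phi> n x - v x))\<^sup>2 + 2 * (L2_norm M (\<lambda>x. \<psi> n x - w x))\<^sup>2)
      \<longlonglongrightarrow> 2 * 0\<^sup>2 + 2 * 0\<^sup>2"
    by (intro tendsto_intros v w)
  ultimately have "(\<lambda>n. (L2_norm M (\<lambda>x. (\<phi> n x - \<psi> n x) - (v x - w x)))\<^sup>2) \<longlonglongrightarrow> 0"
    by - (rule tendsto_sandwich[OF _ _ tendsto_const], auto)
  then show ?thesis by simp
qed

text \<open>The usual argument for the completeness of \<open>L\<^sup>2\<close>. On a finite measure space a subsequence whose
  consecutive differences have squared norms at most \<open>(1/4) ^ k\<close> also has summable
  \<open>L\<^sup>1\<close>-norms of these differences, so that it converges almost everywhere. Fatou's lemma shows that the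
  whole sequence converges to this pointwise limit in \<open>L\<^sup>2\<close>.\<close>

lemma L2_complete:
  fixes \<phi> :: "nat \<Rightarrow> 'a \<Rightarrow> 'b::euclidean_space"
  assumes fin: "finite_measure M" and sq: "\<And>n. square_integrable M (\<phi> n)"
    and cauchy: "\<And>e. e > 0 \<Longrightarrow> \<exists>N. \<forall>m\<ge>N. \<forall>n\<ge>N. (L2_norm M (\<lambda>x. \<phi> m x - \<phi> n x))\<^sup>2 \<le> e"
  obtains g where "square_integrable M g" "(\<lambda>n. L2_norm M (\<lambda>x. \<phi> n x - g x)) \<longlonglongrightarrow> 0"
proof -
  interpret finite_measure M by fact
  have meas [measurable]: "\<phi> n \<in> borel_measurable M" for n using sq by (rule L2D)
  have "\<forall>k. \<exists>N. \<forall>m\<ge>N. \<forall>n\<ge>N. (L2_norm M (\<lambda>x. \<phi> m x - \<phi> n x))\<^sup>2 \<le> (1/4) ^ k"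
    using cauchy by simp
  then obtain N where N: "\<And>k m n. m \<ge> N k \<Longrightarrow> n \<ge> N k \<Longrightarrow> (L2_norm M (\<lambda>x. \<phi> m x - \<phi> n x))\<^sup>2 \<le> (1/4) ^ k"
    by metis
  \<comment> \<open>Partial sums make the sequence of indices strictly increasing.\<close>
  define r where "r k = (\<Sum>i\<le>k. N i) + k" for k
  have rN: "N k \<le> r k" for k
    unfolding r_def by (rule trans_le_add1, rule member_le_sum) auto
  have rSuc: "r k < r (Suc k)" for k by (simp add: r_def)
  have rk: "k \<le> r k" for k by (simp add: r_def)
  define D where "D k x = \<phi> (r (Suc k)) x - \<phi> (r k) x" for k x
  have [measurable]: "D k \<in> borel_measurable M" for k unfolding D_def by measurable
  have Dsq: "square_integrable M (D k)" for k
    unfolding D_def by (intro L2_diff sq)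
  have Dle: "(L2_norm M (D k))\<^sup>2 \<le> (1/4) ^ k" for k
    unfolding D_def using N[of k "r (Suc k)" "r k"] rN[of k] rSuc[of k] by simp
  have Dint: "(\<integral>\<^sup>+x. ennreal (norm (D k x)) \<partial>M) \<le> ennreal ((measure M (space M) + 1) * (1/2) ^ k)" for k
  proof -
    \<comment> \<open>A weighted arithmetic-geometric mean bound turns the \<open>L\<^sup>2\<close>-bound into an \<open>L\<^sup>1\<close>-bound.\<close>
    have pt: "t \<le> (1/2) ^ k + 2 ^ k * t\<^sup>2" for t :: real
    proof -
      define a :: real where "a = 2 ^ k"
      have a: "a > 0" "(1/2) ^ k = 1 / a" by (auto simp: a_def power_one_over)
      have "t * a \<le> 1 + (t * a)\<^sup>2"
        using sum_squares_bound[of 1 "t * a"] zero_le_power2[of "t * a"] by (simp; linarith)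
      then have "(t * a) / a \<le> (1 + (t * a)\<^sup>2) / a" using a by (intro divide_right_mono) auto
      then show ?thesis using a by (simp add: power2_eq_square add_divide_distrib mult_ac flip: a_def)
    qed
    have "(\<integral>\<^sup>+x. ennreal (norm (D k x)) \<partial>M) = ennreal (LINT x|M. norm (D k x))"
      using L2_imp_integrable[OF fin Dsq[of k]]
      by (intro nn_integral_eq_integral) auto
    also have "(LINT x|M. norm (D k x)) \<le> (LINT x|M. (1/2) ^ k + 2 ^ k * (norm (D k x))\<^sup>2)"
      using L2_imp_integrable[OF fin Dsq[of k]] L2D(2)[OF Dsq[of k]]
      by (intro integral_mono pt) auto
    also have "\<dots> = measure M (space M) * (1/2) ^ k + 2 ^ k * (L2_norm M (D k))\<^sup>2"
      using L2D(2)[OF Dsq[of k]] by (simp add: L2_norm_squared)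
    also have "\<dots> \<le> measure M (space M) * (1/2) ^ k + 2 ^ k * (1/4) ^ k"
      using Dle[of k] by simp
    also have "\<dots> = (measure M (space M) + 1) * (1/2) ^ k"
    proof -
      have "(2::real) ^ k * (1/4) ^ k = (2 * (1/4)) ^ k" by (rule power_mult_distrib[symmetric])
      then show ?thesis by (simp add: distrib_right)
    qed
    finally show ?thesis by (simp add: ennreal_leI)
  qed
  have "(\<integral>\<^sup>+x. (\<Sum>k. ennreal (norm (D k x))) \<partial>M) = (\<Sum>k. \<integral>\<^sup>+x. ennreal (norm (D k x)) \<partial>M)"
    by (rule nn_integral_suminf) measurable
  also have "\<dots> \<le> (\<Sum>k. ennreal ((measure M (space M) + 1) * (1/2) ^ k))"
    by (intro suminf_le Dint) auto
  also have "\<dots> = ennreal (\<Sum>k. (measure M (space M) + 1) * (1/2) ^ k)"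
    by (intro suminf_ennreal2) (auto intro!: summable_mult summable_geometric)
  also have "\<dots> < \<infinity>" by simp
  finally have "AE x in M. (\<Sum>k. ennreal (norm (D k x))) \<noteq> \<infinity>"
    by (intro nn_integral_PInf_AE) auto
  then have conv: "AE x in M. convergent (\<lambda>k. \<phi> (r k) x)"
  proof eventually_elim
    case (elim x)
    then have "summable (\<lambda>k. norm (D k x))"
      by (intro summable_suminf_not_top) (auto simp: top_ennreal_def)
    then have "summable (\<lambda>k. D k x)" by (rule summable_norm_cancel)
    then have "convergent (\<lambda>n. \<phi> (r 0) x + (\<Sum>k<n. D k x))"
      unfolding summable_iff_convergent by (intro convergent_add convergent_const)
    moreover have "\<phi> (r 0) x + (\<Sum>k<n. D k x) = \<phi> (r n) x" for n
      using sum_lessThan_telescope[of "\<lambda>k. \<phi> (r k) x" n] unfolding D_def by simp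
    ultimately show ?case by simp
  qed
  define g where "g x = lim (\<lambda>k. \<phi> (r k) x)" for x
  have [measurable]: "g \<in> borel_measurable M"
    unfolding g_def by (rule borel_measurable_lim_metric) measurable
  have lim: "AE x in M. (\<lambda>k. \<phi> (r k) x) \<longlonglongrightarrow> g x"
    using conv by eventually_elim (simp add: g_def convergent_LIMSEQ_iff)
  have est: "(\<integral>\<^sup>+x. ennreal ((norm (\<phi> n x - g x))\<^sup>2) \<partial>M) \<le> ennreal e"
    if n: "\<And>m. m \<ge> K \<Longrightarrow> (L2_norm M (\<lambda>x. \<phi> n x - \<phi> m x))\<^sup>2 \<le> e" for n K e
  proof -
    have "(\<integral>\<^sup>+x. ennreal ((norm (\<phi> n x - g x))\<^sup>2) \<partial>M)
        = (\<integral>\<^sup>+x. liminf (\<lambda>k. ennreal ((norm (\<phi> n x - \<phi> (r k) x))\<^sup>2)) \<partial>M)"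
    proof (rule nn_integral_cong_AE, use lim in eventually_elim)
      case (elim x)
      then have "(\<lambda>k. ennreal ((norm (\<phi> n x - \<phi> (r k) x))\<^sup>2)) \<longlonglongrightarrow> ennreal ((norm (\<phi> n x - g x))\<^sup>2)"
        by (intro tendsto_intros)
      then show ?case by (intro lim_imp_Liminf[symmetric]) auto
    qed
    also have "\<dots> \<le> liminf (\<lambda>k. \<integral>\<^sup>+x. ennreal ((norm (\<phi> n x - \<phi> (r k) x))\<^sup>2) \<partial>M)"
      by (rule nn_integral_liminf) measurable
    also have "\<dots> = liminf (\<lambda>k. ennreal ((L2_norm M (\<lambda>x. \<phi> n x - \<phi> (r k) x))\<^sup>2))"
      by (simp add: L2_norm_squared_nn_integral L2_diff sq)
    also have "\<dots> \<le> liminf (\<lambda>k. ennreal e)"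
    proof (rule Liminf_mono, rule eventually_sequentiallyI[of K])
      fix k assume "K \<le> k"
      then show "ennreal ((L2_norm M (\<lambda>x. \<phi> n x - \<phi> (r k) x))\<^sup>2) \<le> ennreal e"
        using n[of "r k"] rk[of k] by (intro ennreal_leI) auto
    qed
    finally show ?thesis by (simp add: Liminf_const)
  qed
  have gsq: "square_integrable M (\<lambda>x. \<phi> n x - g x) \<and> (L2_norm M (\<lambda>x. \<phi> n x - g x))\<^sup>2 \<le> e"
    if n: "\<And>m. m \<ge> K \<Longrightarrow> (L2_norm M (\<lambda>x. \<phi> n x - \<phi> m x))\<^sup>2 \<le> e" for n K e
  proof
    have e: "0 \<le> e" using n[of K] order_trans[OF zero_le_power2] by blast
    show *: "square_integrable M (\<lambda>x. \<phi> n x - g x)"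
      unfolding square_integrable_def
      using le_less_trans[OF est[OF n] ennreal_less_top]
      by (auto intro!: integrableI_bounded)
    show "(L2_norm M (\<lambda>x. \<phi> n x - g x))\<^sup>2 \<le> e"
      using est[OF n] e by (simp flip: L2_norm_squared_nn_integral[OF *])
  qed
  show thesis
  proof
    obtain K where "\<And>m. m \<ge> K \<Longrightarrow> (L2_norm M (\<lambda>x. \<phi> K x - \<phi> m x))\<^sup>2 \<le> 1"
      using cauchy[of 1] by auto
    from L2_diff[OF sq[of K] conjunct1[OF gsq[OF this]]]
    show "square_integrable M g" by simp
    have "(\<lambda>n. (L2_norm M (\<lambda>x. \<phi> n x - g x))\<^sup>2) \<longlonglongrightarrow> 0"
    proof (rule LIMSEQ_I)
      fix e :: real assume "0 < e"
      then obtain K where K: "\<And>m n. m \<ge> K \<Longrightarrow> n \<ge> K \<Longrightarrow> (L2_norm M (\<lambda>x. \<phi> n x - \<phi> m x))\<^sup>2 \<le> e/2"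
        using cauchy[of "e/2"] by auto
      show "\<exists>no. \<forall>n\<ge>no. norm ((L2_norm M (\<lambda>x. \<phi> n x - g x))\<^sup>2 - 0) < e"
      proof (intro exI allI impI)
        fix n assume "K \<le> n"
        then have "(L2_norm M (\<lambda>x. \<phi> n x - g x))\<^sup>2 \<le> e/2" using gsq[of K n "e/2"] K by blast
        then show "norm ((L2_norm M (\<lambda>x. \<phi> n x - g x))\<^sup>2 - 0) < e" using \<open>0 < e\<close> by simp
      qed
    qed
    then show "(\<lambda>n. L2_norm M (\<lambda>x. \<phi> n x - g x)) \<longlonglongrightarrow> 0" by simp
  qed
qed


section \<open>Smooth functions\<close>

lemma smooth_differentiable: "smooth f \<Longrightarrow> f differentiable at x"
  by (auto elim: smooth.cases)

lemma smooth_partial: "smooth f \<Longrightarrow> b \<in> Basis \<Longrightarrow> smooth (\<lambda>x. frechet_derivative f (at x) b)"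
  by (auto elim: smooth.cases)

lemma smooth_has_derivative: "smooth f \<Longrightarrow> (f has_derivative frechet_derivative f (at x)) (at x)"
  using smooth_differentiable frechet_derivative_works by blast

lemma smooth_continuous_on: "smooth f \<Longrightarrow> continuous_on S f"
  by (meson continuous_at_imp_continuous_on differentiable_imp_continuous_within smooth_differentiable)

lemma smooth_const: "smooth (\<lambda>x::'a::euclidean_space. c :: 'b::real_normed_vector)"
proof -
  have "\<exists>c. f = (\<lambda>x::'a. c) \<Longrightarrow> smooth f" for f :: "'a \<Rightarrow> 'b"
    by (coinduction arbitrary: f) (auto simp: frechet_derivative_const)
  then show ?thesis by blast
qed

lemma smooth_diff:
  fixes f g :: "'a::euclidean_space \<Rightarrow> 'b::real_normed_vector"
  assumes "smooth f" "smooth g"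
  shows "smooth (\<lambda>x. f x - g x)"
proof -
  have "\<exists>f g. smooth f \<and> smooth g \<and> h = (\<lambda>x. f x - g x) \<Longrightarrow> smooth h" for h :: "'a \<Rightarrow> 'b"
  proof (coinduction arbitrary: h)
    case smooth
    then obtain f g where fg: "smooth f" "smooth g" "h = (\<lambda>x. f x - g x)" by blast
    have "(h has_derivative (\<lambda>b. frechet_derivative f (at x) b - frechet_derivative g (at x) b)) (at x)" for x
      unfolding fg by (intro has_derivative_diff smooth_has_derivative fg)
    then have d: "h differentiable at x"
      "frechet_derivative h (at x) = (\<lambda>b. frechet_derivative f (at x) b - frechet_derivative g (at x) b)" for x
      using differentiableI frechet_derivative_at by metis+
    show ?case
      by (rule exI[of _ h]) (use d fg in \<open>auto intro!: smooth_partial\<close>)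
  qed
  with assms show ?thesis by blast
qed

lemma smooth_vec_lambda:
  fixes f :: "'a::euclidean_space \<Rightarrow> real^'d"
  assumes "\<And>i. smooth (\<lambda>x. f x $ i)"
  shows "smooth f"
proof -
  have "\<forall>i. smooth (\<lambda>x. f x $ i) \<Longrightarrow> smooth f" for f :: "'a \<Rightarrow> real^'d"
  proof (coinduction arbitrary: f)
    case smooth
    have d: "f differentiable at x" for x
      by (subst differentiable_componentwise_within)
         (use smooth in \<open>auto simp: Basis_vec_def inner_axis intro: smooth_differentiable\<close>)
    have "((\<lambda>x. f x $ i) has_derivative (\<lambda>b. frechet_derivative f (at x) b $ i)) (at x)" for x i
      by (rule bounded_linear.has_derivative[OF bounded_linear_vec_nth
            frechet_derivative_works[THEN iffD1, OF d]])
    then have "frechet_derivative (\<lambda>x. f x $ i) (at x) = (\<lambda>b. frechet_derivative f (at x) b $ i)" for x i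
      using frechet_derivative_at by metis
    then have "smooth (\<lambda>x. frechet_derivative f (at x) b $ i)" if "b \<in> Basis" for b i
      using smooth_partial[OF smooth[rule_format, of i] that] by simp
    with d show ?case by auto
  qed
  with assms show ?thesis by blast
qed

lemma smooth_ident: "smooth (\<lambda>x::real. x)"
  by (rule smooth.intros) (auto simp: frechet_derivative_ident intro: smooth_const)

text \<open>The smallest class of functions on \<open>\<real>\<^sup>d\<close> that contains the smooth functions of one coordinate
  and is closed under sums and products. Being closed under partial derivatives as well, it consists
  of smooth functions; it contains the polynomials and the tensor products of bump functions.\<close>

inductive coord_algebra :: "(real^'d \<Rightarrow> real) \<Rightarrow> bool" where
  const: "coord_algebra (\<lambda>x. c)"
| coord: "smooth f \<Longrightarrow> coord_algebra (\<lambda>x. f (x $ i))"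
| add: "coord_algebra f \<Longrightarrow> coord_algebra g \<Longrightarrow> coord_algebra (\<lambda>x. f x + g x)"
| mult: "coord_algebra f \<Longrightarrow> coord_algebra g \<Longrightarrow> coord_algebra (\<lambda>x. f x * g x)"

lemma coord_algebra_derivative:
  fixes f :: "real^'d \<Rightarrow> real"
  assumes "coord_algebra f"
  shows "\<exists>f'. (\<forall>x. (f has_derivative f' x) (at x)) \<and> (\<forall>b. coord_algebra (\<lambda>x. f' x b))"
  using assms
proof induction
  case (const c)
  show ?case by (rule exI[of _ "\<lambda>x b. 0"]) (auto intro: coord_algebra.const)
next
  case (coord f i)
  have der: "((\<lambda>x. f (x $ i)) has_derivative (\<lambda>b. b $ i * frechet_derivative f (at (x $ i)) 1)) (at x)" for x :: "real^'d"
  proof -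
    have "((\<lambda>x. f (x $ i)) has_derivative (\<lambda>b. frechet_derivative f (at (x $ i)) (b $ i))) (at x)"
      by (rule has_derivative_compose[OF bounded_linear_imp_has_derivative[OF bounded_linear_vec_nth]
          smooth_has_derivative[OF coord]])
    also have "(\<lambda>b. frechet_derivative f (at (x $ i)) (b $ i)) = (\<lambda>b. b $ i * frechet_derivative f (at (x $ i)) 1)"
    proof
      fix b :: "real^'d"
      show "frechet_derivative f (at (x $ i)) (b $ i) = b $ i * frechet_derivative f (at (x $ i)) 1"
        using linear_scale[OF linear_frechet_derivative[OF smooth_differentiable[OF coord]], of "x $ i" "b $ i" 1]
        by simp
    qed
    finally show ?thesis .
  qed
  have "coord_algebra (\<lambda>x. b $ i * frechet_derivative f (at (x $ i)) 1)" for b :: "real^'d"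
    by (rule coord_algebra.mult[OF coord_algebra.const
          coord_algebra.coord[OF smooth_partial[OF coord]]]) simp
  then show ?case by (intro exI[of _ "\<lambda>x b. b $ i * frechet_derivative f (at (x $ i)) 1"] conjI allI der)
next
  case (add f g)
  from add.IH obtain f' g' where "\<forall>x. (f has_derivative f' x) (at x)" "\<forall>b. coord_algebra (\<lambda>x. f' x b)"
    "\<forall>x. (g has_derivative g' x) (at x)" "\<forall>b. coord_algebra (\<lambda>x. g' x b)"
    by (elim exE conjE) (rule that)
  note * = this[rule_format]
  show ?case
  proof (intro exI conjI allI)
    show "((\<lambda>x. f x + g x) has_derivative (\<lambda>b. f' x b + g' x b)) (at x)" for x
      by (rule has_derivative_add[OF *(1,3)])
    show "coord_algebra (\<lambda>x. f' x b + g' x b)" for b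
      by (rule coord_algebra.add[OF *(2,4)])
  qed
next
  case (mult f g)
  from mult.IH obtain f' g' where "\<forall>x. (f has_derivative f' x) (at x)" "\<forall>b. coord_algebra (\<lambda>x. f' x b)"
    "\<forall>x. (g has_derivative g' x) (at x)" "\<forall>b. coord_algebra (\<lambda>x. g' x b)"
    by (elim exE conjE) (rule that)
  note * = this[rule_format]
  show ?case
  proof (intro exI conjI allI)
    show "((\<lambda>x. f x * g x) has_derivative (\<lambda>b. f x * g' x b + f' x b * g x)) (at x)" for x
      by (rule has_derivative_mult[OF *(1,3)])
    show "coord_algebra (\<lambda>x. f x * g' x b + f' x b * g x)" for b
      by (rule coord_algebra.add[OF coord_algebra.mult[OF mult(1) *(4)]
            coord_algebra.mult[OF *(2) mult(2)]])
  qed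
qed

lemma coord_algebra_smooth:
  assumes "coord_algebra f" shows "smooth f"
  using assms
proof (coinduction arbitrary: f)
  case smooth
  then have "coord_algebra f" .
  from coord_algebra_derivative[OF this] obtain f' where
    "\<forall>x. (f has_derivative f' x) (at x)" "\<forall>b. coord_algebra (\<lambda>x. f' x b)"
    by (elim exE conjE) (rule that)
  note * = this[rule_format]
  have "frechet_derivative f (at x) = f' x" for x
    using frechet_derivative_at[OF *(1)[of x]] by simp
  then have "coord_algebra (\<lambda>x. frechet_derivative f (at x) b)" for b
    using *(2)[of b] by simp
  moreover have "f differentiable at x" for x
    using *(1) by (rule differentiableI)
  ultimately show ?case by blast
qed

lemma coord_algebra_sum:
  "finite A \<Longrightarrow> (\<And>a. a \<in> A \<Longrightarrow> coord_algebra (f a)) \<Longrightarrow> coord_algebra (\<lambda>x. \<Sum>a\<in>A. f a x)"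
proof (induction A rule: finite_induct)
  case (insert a A)
  have "coord_algebra (\<lambda>x. \<Sum>a\<in>A. f a x)" by (rule insert) (simp add: insert.prems)
  from coord_algebra.add[OF insert.prems[of a] this] insert.hyps show ?case by simp
qed (simp add: coord_algebra.const)

lemma coord_algebra_prod:
  "finite A \<Longrightarrow> (\<And>a. a \<in> A \<Longrightarrow> coord_algebra (f a)) \<Longrightarrow> coord_algebra (\<lambda>x. \<Prod>a\<in>A. f a x)"
proof (induction A rule: finite_induct)
  case (insert a A)
  have "coord_algebra (\<lambda>x. \<Prod>a\<in>A. f a x)" by (rule insert) (simp add: insert.prems)
  from coord_algebra.mult[OF insert.prems[of a] this] insert.hyps show ?case by simp
qed (simp add: coord_algebra.const)

lemma poly_deg_le_smooth:
  fixes p :: "real^'d \<Rightarrow> real"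
  assumes "poly_deg_le m p" shows "smooth p"
proof (rule coord_algebra_smooth)
  obtain c :: "('d \<Rightarrow> nat) \<Rightarrow> real"
    where c: "p = (\<lambda>x. \<Sum>\<alpha> | sum \<alpha> UNIV \<le> m. c \<alpha> * (\<Prod>i\<in>UNIV. x $ i ^ \<alpha> i))"
    using assms unfolding poly_deg_le_def by blast
  have "{\<alpha> :: 'd \<Rightarrow> nat. sum \<alpha> UNIV \<le> m} \<subseteq> PiE UNIV (\<lambda>i. {..m})"
  proof (clarsimp simp: PiE_def)
    fix \<alpha> :: "'d \<Rightarrow> nat" and i assume "sum \<alpha> UNIV \<le> m"
    then show "\<alpha> i \<le> m" using member_le_sum[of i UNIV \<alpha>] by simp
  qed
  then have fin: "finite {\<alpha> :: 'd \<Rightarrow> nat. sum \<alpha> UNIV \<le> m}"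
    by (rule finite_subset) (auto intro: finite_PiE)
  have "coord_algebra (\<lambda>x. x $ i ^ k)" for i :: 'd and k
  proof (induction k)
    case (Suc k)
    from coord_algebra.mult[OF coord_algebra.coord[OF smooth_ident] this]
    show ?case by simp
  qed (simp add: coord_algebra.const)
  then have "coord_algebra (\<lambda>x. c \<alpha> * (\<Prod>i\<in>UNIV. x $ i ^ \<alpha> i))" for \<alpha>
    by (intro coord_algebra.mult[OF coord_algebra.const coord_algebra_prod]) auto
  then show "coord_algebra p"
    unfolding c by (rule coord_algebra_sum[OF fin])
qed

lemma vec_poly_smooth: "vec_poly m p \<Longrightarrow> smooth p"
  unfolding vec_poly_def by (intro smooth_vec_lambda poly_deg_le_smooth) auto

lemma continuous_on_partial:
  fixes f :: "real^'d \<Rightarrow> real"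
  assumes "smooth f" shows "continuous_on S (partial j f)"
  unfolding partial_def
  by (rule smooth_continuous_on, rule smooth_partial[OF assms]) (auto simp: Basis_vec_def)

lemma jacobian_nth: "jacobian f (at x) $ i $ j = frechet_derivative f (at x) (axis j 1) $ i"
  by (simp add: jacobian_def matrix_def)

lemma continuous_on_jacobian:
  fixes f :: "real^'d \<Rightarrow> real^'d"
  assumes "smooth f" shows "continuous_on S (\<lambda>x. jacobian f (at x))"
proof -
  have "continuous_on S (\<lambda>x. frechet_derivative f (at x) (axis j 1) $ i)" for i j
    by (intro continuous_on_component smooth_continuous_on smooth_partial[OF assms]) (auto simp: Basis_vec_def)
  then have "continuous_on S (\<lambda>x. \<chi> i j. jacobian f (at x) $ i $ j)"
    unfolding jacobian_nth by (intro continuous_on_vec_lambda)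
  then show ?thesis by simp
qed

lemma jacobian_diff:
  fixes f g :: "real^'d \<Rightarrow> real^'d"
  assumes "smooth f" "smooth g"
  shows "jacobian (\<lambda>x. f x - g x) (at x) = jacobian f (at x) - jacobian g (at x)"
proof -
  have "((\<lambda>x. f x - g x) has_derivative (\<lambda>b. frechet_derivative f (at x) b - frechet_derivative g (at x) b)) (at x)"
    by (intro has_derivative_diff smooth_has_derivative assms)
  from fun_cong[OF frechet_derivative_at[OF this], symmetric] show ?thesis
    by (simp add: vec_eq_iff jacobian_nth)
qed

lemma frechet_derivative_jacobian:
  fixes f :: "real^'d \<Rightarrow> real^'d"
  assumes "smooth f" shows "frechet_derivative f (at x) b = jacobian f (at x) *v b"
  using linear_frechet_derivative[OF smooth_differentiable[OF assms], of x]
  by (simp add: jacobian_def matrix_works)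

section \<open>Bump functions\<close>

text \<open>The derivatives of \<open>exp (- 1 / x)\<close>, continued by 0, are polynomials in \<open>1 / x\<close> times
  \<open>exp (- 1 / x)\<close>. The family with arbitrary polynomials is thus closed under differentiation.\<close>

definition flat_exp :: "real poly \<Rightarrow> real \<Rightarrow> real" where
  "flat_exp p x = (if x > 0 then poly p (1 / x) * exp (- (1 / x)) else 0)"

lemma poly_mult_exp_minus_tendsto_0: "((\<lambda>y. poly p y * exp (- y)) \<longlongrightarrow> (0::real)) at_top"
proof -
  have "((\<lambda>y. \<Sum>i\<le>degree p. coeff p i * (y ^ i / exp y)) \<longlongrightarrow> (\<Sum>i\<le>degree p. coeff p i * 0)) at_top"
    by (intro tendsto_intros tendsto_power_div_exp_0)
  then show ?thesis
    by (simp add: poly_altdef sum_distrib_right exp_minus divide_inverse mult.assoc)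
qed

lemma flat_exp_has_derivative:
  "(flat_exp p has_real_derivative flat_exp ([:0, 0, 1:] * (p - pderiv p)) x) (at x)"
proof -
  consider "x < 0" | "x > 0" | "x = 0" by linarith
  then show ?thesis
  proof cases
    assume "x < 0"
    have "((\<lambda>x. 0) has_real_derivative 0) (at x)" by simp
    then have "(flat_exp p has_real_derivative 0) (at x)"
      by (rule has_field_derivative_transform_within_open[of _ _ _ "{..<0}"])
         (use \<open>x < 0\<close> in \<open>auto simp: flat_exp_def\<close>)
    then show ?thesis using \<open>x < 0\<close> by (simp add: flat_exp_def)
  next
    assume "x > 0"
    have "((\<lambda>x. poly p (1 / x) * exp (- (1 / x))) has_real_derivative
        flat_exp ([:0, 0, 1:] * (p - pderiv p)) x) (at x)"
      using \<open>x > 0\<close> by (auto intro!: derivative_eq_intros simp: flat_exp_def field_simps power2_eq_square)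
    then show ?thesis
      by (rule has_field_derivative_transform_within_open[of _ _ _ "{0<..}"])
         (use \<open>x > 0\<close> in \<open>auto simp: flat_exp_def\<close>)
  next
    assume x: "x = 0"
    have "((\<lambda>h. (flat_exp p (0 + h) - flat_exp p 0) / h) \<longlongrightarrow> 0) (at 0)"
    proof (rule filterlim_split_at)
      show "((\<lambda>h. (flat_exp p (0 + h) - flat_exp p 0) / h) \<longlongrightarrow> 0) (at_left 0)"
        by (rule tendsto_eventually, rule eventually_at_leftI[of "-1"]) (auto simp: flat_exp_def)
      have "\<forall>\<^sub>F y in at_top. poly (pCons 0 p) y * exp (- y)
          = (flat_exp p (0 + inverse y) - flat_exp p 0) / inverse y"
        by (rule eventually_mono[OF eventually_gt_at_top[of 0]]) (auto simp: flat_exp_def field_simps)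
      from Lim_transform_eventually[OF poly_mult_exp_minus_tendsto_0 this]
      show "((\<lambda>h. (flat_exp p (0 + h) - flat_exp p 0) / h) \<longlongrightarrow> 0) (at_right 0)"
        unfolding filterlim_at_right_to_top .
    qed
    then show ?thesis unfolding DERIV_def x by (simp add: flat_exp_def)
  qed
qed

lemma smooth_flat_exp: "smooth (\<lambda>x::real. flat_exp p (s * x + t))"
proof -
  have "\<exists>p. f = (\<lambda>x. flat_exp p (s * x + t)) \<Longrightarrow> smooth f" for f
  proof (coinduction arbitrary: f)
    case smooth
    then obtain p where f: "f = (\<lambda>x. flat_exp p (s * x + t))" by blast
    let ?q = "smult s ([:0, 0, 1:] * (p - pderiv p))"
    have "(f has_real_derivative flat_exp ?q (s * x + t)) (at x)" for x
    proof -
      have "(f has_real_derivative flat_exp ([:0, 0, 1:] * (p - pderiv p)) (s * x + t) * s) (at x)"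
        unfolding f by (rule DERIV_chain2[OF flat_exp_has_derivative]) (auto intro!: derivative_eq_intros)
      then show ?thesis by (simp add: flat_exp_def mult_ac split: if_splits)
    qed
    then have d: "(f has_derivative (*) (flat_exp ?q (s * x + t))) (at x)" for x
      by (simp add: has_field_derivative_def)
    have "frechet_derivative f (at x) 1 = flat_exp ?q (s * x + t)" for x
      using fun_cong[OF frechet_derivative_at[OF d], of x 1] by simp
    then have "(\<lambda>x. frechet_derivative f (at x) 1) = (\<lambda>x. flat_exp ?q (s * x + t))" ..
    moreover have "f differentiable at x" for x using d by (rule differentiableI)
    ultimately show ?case by auto
  qed
  then show ?thesis by blast
qed

lemma flat_exp_1: "flat_exp 1 x = (if x > 0 then exp (- (1 / x)) else 0)"
  by (simp add: flat_exp_def)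

definition box_bump :: "nat \<Rightarrow> real^'d \<Rightarrow> real^'d \<Rightarrow> real^'d \<Rightarrow> real" where
  "box_bump n a b x = (\<Prod>i\<in>UNIV.
     flat_exp 1 (real (Suc n) * (x $ i - a $ i)) * flat_exp 1 (real (Suc n) * (b $ i - x $ i)))"

lemma mem_box_vec: "x \<in> box a b \<longleftrightarrow> (\<forall>i. a $ i < x $ i \<and> x $ i < b $ i)" for x :: "real^'d"
  by (auto simp: mem_box_cart)

lemma smooth_box_bump: "smooth (box_bump n a b)"
proof -
  have eq: "flat_exp 1 (real (Suc n) * (x $ i - a $ i)) = flat_exp 1 (real (Suc n) * x $ i + (- real (Suc n) * a $ i))"
    "flat_exp 1 (real (Suc n) * (b $ i - x $ i)) = flat_exp 1 (- real (Suc n) * x $ i + real (Suc n) * b $ i)" for x i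
    by (rule arg_cong[where f = "flat_exp 1"], simp add: algebra_simps)+
  show ?thesis
    unfolding box_bump_def[abs_def] eq
    by (rule coord_algebra_smooth, rule coord_algebra_prod, simp,
        rule coord_algebra.mult[OF coord_algebra.coord[OF smooth_flat_exp]
          coord_algebra.coord[OF smooth_flat_exp]])
qed

lemma flat_exp_1_le: "0 \<le> flat_exp 1 x" "flat_exp 1 x \<le> 1"
  by (auto simp: flat_exp_1)

lemma box_bump_le: "0 \<le> box_bump n a b x" "box_bump n a b x \<le> 1"
  unfolding box_bump_def
  by (auto intro!: prod_nonneg prod_le_1 mult_nonneg_nonneg mult_le_one flat_exp_1_le)

lemma box_bump_nonzero_iff: "box_bump n a b x \<noteq> 0 \<longleftrightarrow> x \<in> box a b"
proof -
  have "flat_exp 1 t \<noteq> 0 \<longleftrightarrow> t > 0" for t by (simp add: flat_exp_1)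
  then show ?thesis
    unfolding box_bump_def mem_box_vec by (auto simp: zero_less_mult_iff)
qed

lemma box_bump_tendsto:
  fixes a b x :: "real^'d"
  shows "(\<lambda>n. box_bump n a b x) \<longlonglongrightarrow> indicator (box a b) x"
proof (cases "x \<in> box a b")
  case True
  have lim: "(\<lambda>n. flat_exp 1 (real (Suc n) * t)) \<longlonglongrightarrow> 1" if "t > 0" for t
  proof -
    have "(\<lambda>n. exp (- (inverse t * inverse (real (Suc n))))) \<longlonglongrightarrow> exp (- (inverse t * 0))"
      by (intro tendsto_intros LIMSEQ_inverse_real_of_nat)
    moreover have "flat_exp 1 (real (Suc n) * t) = exp (- (inverse t * inverse (real (Suc n))))" for n
      using that by (simp add: flat_exp_1 divide_inverse mult.commute)
    ultimately show ?thesis by simp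
  qed
  have "(\<lambda>n. box_bump n a b x) \<longlonglongrightarrow> (\<Prod>i\<in>(UNIV :: 'd set). 1 * 1)"
    unfolding box_bump_def using True by (intro tendsto_intros lim) (auto simp: mem_box_vec)
  then show ?thesis using True by simp
next
  case False
  then show ?thesis using box_bump_nonzero_iff[of _ a b x] by simp
qed

lemma test_function_box_bump:
  assumes "cbox a b \<subseteq> U" shows "test_function U (box_bump n a b)"
proof -
  have "closure {x. box_bump n a b x \<noteq> 0} \<subseteq> cbox a b"
    unfolding box_bump_nonzero_iff by (simp add: closure_minimal box_subset_cbox closed_cbox)
  moreover from this have "compact (closure {x. box_bump n a b x \<noteq> 0})"
    by (meson bounded_cbox bounded_subset closed_closure compact_eq_bounded_closed)
  ultimately show ?thesis using assms smooth_box_bump by (auto simp: test_function_def)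
qed

section \<open>The fundamental lemma of the calculus of variations\<close>

text \<open>Open boxes are closed under intersection and generate the Borel sets. Hence the integrals of \<open>f\<close>
  over all Borel subsets of a box in \<open>U\<close> vanish.\<close>

lemma null_integrals_over_boxes_imp_AE_0:
  fixes f :: "'a::euclidean_space \<Rightarrow> real"
  assumes f: "integrable lborel f"
    and box: "\<And>a b. cbox a b \<subseteq> U \<Longrightarrow> (LINT x:box a b|lborel. f x) = 0"
    and cd: "cbox c d \<subseteq> U"
  shows "AE x in lborel. x \<in> box c d \<longrightarrow> f x = 0"
proof -
  define h where "h x = indicator (box c d) x * f x" for x
  have h: "integrable lborel h"
    unfolding h_def using integrable_mult_indicator[OF _ f, of "box c d"] by simp
  have set_h: "set_integrable lborel A h" if "A \<in> sets borel" for A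
    unfolding set_integrable_def using that by (intro integrable_mult_indicator h) auto
  have box0: "(LINT x:box a b|lborel. h x) = 0" for a b
  proof -
    obtain a' b' where eq: "box a b \<inter> box c d = box a' b'" using box_Int_box[of a b c d] by blast
    have "(LINT x:box a b|lborel. h x) = (LINT x:box a' b'|lborel. f x)"
      unfolding set_lebesgue_integral_def h_def
      by (intro Bochner_Integration.integral_cong) (auto simp: indicator_def eq[symmetric])
    also have "\<dots> = 0"
    proof (cases "box a' b' = {}")
      case False
      have "box a' b' \<subseteq> cbox c d" using eq box_subset_cbox[of c d] by blast
      then have "cbox a' b' \<subseteq> cbox c d"
        using False by (metis closure_box closure_mono closure_cbox)
      then show ?thesis using box cd by blast
    qed (simp add: set_lebesgue_integral_def)
    finally show ?thesis .
  qed
  have "(LINT x|lborel. h x) = 0"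
  proof -
    have "(LINT x|lborel. h x) = (LINT x:box c d|lborel. h x)"
      unfolding set_lebesgue_integral_def h_def
      by (intro Bochner_Integration.integral_cong) (auto simp: indicator_def)
    then show ?thesis using box0 by simp
  qed
  note h0 = this
  have "(LINT x:A|lborel. h x) = 0" if "A \<in> sets borel" for A
  proof -
    have "A \<in> sigma_sets UNIV (range (\<lambda>(a, b). box a b :: 'a set))"
      using that unfolding borel_eq_box by simp
    note A = this
    have "Int_stable (range (\<lambda>(a, b). box a b :: 'a set))"
    proof (clarsimp simp: Int_stable_def)
      fix a b a' b' :: 'a
      show "box a b \<inter> box a' b' \<in> range (\<lambda>(a, b). box a b)"
        unfolding box_Int_box by auto
    qed
    moreover have "range (\<lambda>(a, b). box a b) \<subseteq> Pow (UNIV :: 'a set)" by simp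
    ultimately show ?thesis using A
    proof (induction rule: sigma_sets_induct_disjoint)
      case (basic A) then show ?case using box0 by auto
    next
      case empty show ?case by (simp add: set_lebesgue_integral_def)
    next
      case (compl A)
      then have A: "A \<in> sets borel" unfolding borel_eq_box by simp
      have "(LINT x:UNIV - A|lborel. h x) = (LINT x|lborel. h x - indicator A x *\<^sub>R h x)"
        unfolding set_lebesgue_integral_def
        by (intro Bochner_Integration.integral_cong) (auto simp: indicator_def)
      also have "\<dots> = (LINT x|lborel. h x) - (LINT x:A|lborel. h x)"
        using h set_h[OF A] unfolding set_lebesgue_integral_def set_integrable_def
        by (intro Bochner_Integration.integral_diff) auto
      finally show ?case using compl h0 by simp
    next
      case (union A)
      then have A: "A i \<in> sets borel" for i unfolding borel_eq_box by auto
      have "(LINT x:(\<Union>i. A i)|lborel. h x) = (\<Sum>i. (LINT x:(A i)|lborel. h x))"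
        using A union(1) by (intro lebesgue_integral_countable_add set_h sets.countable_UN)
          (auto simp: disjoint_family_on_def)
      then show ?case using union by simp
    qed
  qed
  then have "AE x in lborel. h x = 0"
    using h by (intro density_unique_real) (auto simp: set_lebesgue_integral_def)
  then show ?thesis by eventually_elim (auto simp: h_def)
qed

lemma AE_lebesgue_iff_lborel: "(AE x in lebesgue. P x) \<longleftrightarrow> (AE x in lborel. P x)"
  by (rule AE_completion_iff)

text \<open>The bump functions of a box converge boundedly to its indicator function. By dominated convergence,
  vanishing integrals against test functions thus give vanishing integrals over boxes.\<close>

lemma fundamental_lemma_of_variations:
  fixes g :: "real^'d \<Rightarrow> real"
  assumes U: "open U" and g: "integrable (lebesgue_on U) g"
    and null: "\<And>\<phi>. test_function U \<phi> \<Longrightarrow> (LINT x|lebesgue_on U. g x * \<phi> x) = 0"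
  shows "AE x in lebesgue_on U. g x = 0"
proof -
  have Um: "U \<inter> space lebesgue \<in> sets lebesgue" using U by simp
  define F where "F x = indicator U x *\<^sub>R g x" for x
  have F: "integrable lebesgue F"
    using g unfolding F_def by (subst (asm) integrable_restrict_space[OF Um]) simp
  obtain f where f [measurable]: "f \<in> borel_measurable lborel" and Ff: "AE x in lborel. F x = f x"
    using completion_ex_borel_measurable_real[OF borel_measurable_integrable[OF F]] by blast
  have [measurable]: "F \<in> borel_measurable lebesgue" using F by blast
  have fl [measurable]: "f \<in> borel_measurable lebesgue" using f by (simp add: measurable_completion)
  have Ff': "AE x in lebesgue. F x = f x" using Ff by (simp add: AE_lebesgue_iff_lborel)
  have fint: "integrable lborel f"
    using integrable_cong_AE[THEN iffD1, OF _ fl Ff' F] integrable_completion[OF f] by simp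
  have box0: "(LINT x:box a b|lborel. f x) = 0" if ab: "cbox a b \<subseteq> U" for a b
  proof -
    have cont: "continuous_on UNIV (box_bump n a b)" for n
      by (rule smooth_continuous_on[OF smooth_box_bump])
    have bm [measurable]: "box_bump n a b \<in> borel_measurable lebesgue" for n
      using borel_measurable_continuous_onI[OF cont[of n]] measurable_completion[of _ lborel] by simp
    have bmU: "(\<lambda>x. g x * box_bump n a b x) \<in> borel_measurable (lebesgue_on U)" for n
      using measurable_restrict_space1[OF bm] g by (intro borel_measurable_times) auto
    have "(LINT x:box a b|lborel. f x) = (LINT x|lebesgue. indicator (box a b) x *\<^sub>R f x)"
      unfolding set_lebesgue_integral_def by (rule integral_completion[symmetric]) simp
    also have "\<dots> = (LINT x|lebesgue. F x * indicator (box a b) x)"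
    proof (rule integral_cong_AE)
      have [measurable]: "indicat_real (box a b) \<in> borel_measurable lebesgue"
        by (intro borel_measurable_indicator) simp
      show "(\<lambda>x. indicator (box a b) x *\<^sub>R f x) \<in> borel_measurable lebesgue"
        "(\<lambda>x. F x * indicator (box a b) x) \<in> borel_measurable lebesgue" by measurable
      show "AE x in lebesgue. indicator (box a b) x *\<^sub>R f x = F x * indicator (box a b) x"
        using Ff' by eventually_elim simp
    qed
    finally have eq: "(LINT x:box a b|lborel. f x) = (LINT x|lebesgue. F x * indicator (box a b) x)" .
    have zero: "(LINT x|lebesgue. F x * box_bump n a b x) = 0" for n
    proof -
      have "(LINT x|lebesgue. F x * box_bump n a b x) = (LINT x|lebesgue. indicator U x *\<^sub>R (g x * box_bump n a b x))"
        by (simp add: F_def mult.assoc)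
      also have "\<dots> = (LINT x|lebesgue_on U. g x * box_bump n a b x)"
        by (rule integral_restrict_space[OF Um, symmetric])
      finally show ?thesis using null[OF test_function_box_bump[OF ab]] by simp
    qed
    have "(\<lambda>n. LINT x|lebesgue. F x * box_bump n a b x)
        \<longlonglongrightarrow> (LINT x|lebesgue. F x * indicator (box a b) x)"
    proof (rule integral_dominated_convergence[where w = "\<lambda>x. norm (F x)"])
      show "integrable lebesgue (\<lambda>x. norm (F x))" using F by simp
      show "AE x in lebesgue. (\<lambda>n. F x * box_bump n a b x) \<longlonglongrightarrow> F x * indicator (box a b) x"
        by (intro AE_I2 tendsto_intros box_bump_tendsto)
      show "AE x in lebesgue. norm (F x * box_bump n a b x) \<le> norm (F x)" for n
        using box_bump_le[of n a b] by (intro AE_I2) (simp add: abs_mult mult_left_le)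
      show "(\<lambda>x. F x * box_bump n a b x) \<in> borel_measurable lebesgue" for n by measurable
      show "(\<lambda>x. F x * indicator (box a b) x) \<in> borel_measurable lebesgue"
        using F by (intro borel_measurable_times borel_measurable_indicator) auto
    qed
    then show ?thesis unfolding zero eq by (simp add: LIMSEQ_const_iff)
  qed
  obtain \<D> where D: "countable \<D>" "\<D> \<subseteq> Pow U" "\<And>X. X \<in> \<D> \<Longrightarrow> \<exists>a b. X = cbox a b" "\<Union>\<D> = U"
    using open_countable_Union_open_cbox[OF U] by blast
  have "AE x in lborel. x \<in> X \<longrightarrow> f x = 0" if XD: "X \<in> \<D>" for X
  proof -
    obtain a b where X: "X = cbox a b" using D(3)[OF XD] by blast
    have "AE x in lborel. x \<in> box a b \<longrightarrow> f x = 0"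
      using null_integrals_over_boxes_imp_AE_0[OF fint box0, of U] D(2) XD X by blast
    moreover have "AE x in lborel. x \<notin> cbox a b - box a b"
      by (rule AE_not_in) (simp add: null_sets_def emeasure_lborel_cbox_eq emeasure_lborel_box_eq emeasure_Diff box_subset_cbox)
    ultimately show ?thesis unfolding X by eventually_elim auto
  qed
  then have "AE x in lborel. \<forall>X\<in>\<D>. x \<in> X \<longrightarrow> f x = 0"
    by (subst AE_ball_countable[OF D(1)]) blast
  with Ff have "AE x in lborel. x \<in> U \<longrightarrow> g x = 0"
  proof eventually_elim
    case (elim x)
    show ?case
    proof
      assume "x \<in> U"
      then obtain X where "X \<in> \<D>" "x \<in> X" using D(4) by blast
      then show "g x = 0" using elim \<open>x \<in> U\<close> by (simp add: F_def)
    qed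
  qed
  then show ?thesis
    by (simp add: AE_restrict_space_iff[OF Um] AE_lebesgue_iff_lborel)
qed

section \<open>Weak gradients\<close>

lemma finite_measure_lebesgue_on_bounded:
  fixes U :: "'a::euclidean_space set"
  assumes "bounded U" "U \<in> sets lebesgue"
  shows "finite_measure (lebesgue_on U)"
  using assms bounded_set_imp_lmeasurable finite_measure_lebesgue_on by blast

lemma continuous_measurable_lebesgue_on:
  fixes f :: "'a::euclidean_space \<Rightarrow> 'b::euclidean_space"
  assumes "continuous_on UNIV f" shows "f \<in> borel_measurable (lebesgue_on U)"
proof -
  have "f \<in> borel_measurable lborel" using borel_measurable_continuous_onI[OF assms] by simp
  then show ?thesis by (rule measurable_restrict_space1[OF measurable_completion])
qed

lemma continuous_bounded_on:
  fixes f :: "'a::euclidean_space \<Rightarrow> 'b::euclidean_space"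
  assumes "continuous_on UNIV f" "bounded U"
  obtains B where "\<And>x. x \<in> U \<Longrightarrow> norm (f x) \<le> B"
proof -
  have "compact (f ` closure U)"
    by (rule compact_continuous_image[OF continuous_on_subset[OF assms(1)]])
       (use assms(2) in \<open>auto simp: compact_eq_bounded_closed\<close>)
  then obtain B where "\<forall>y\<in>f ` closure U. norm y \<le> B"
    using compact_imp_bounded bounded_iff by blast
  then show ?thesis using closure_subset[of U] that by blast
qed

lemma L2_bounded:
  fixes f :: "'a \<Rightarrow> 'b::euclidean_space"
  assumes "finite_measure M" "f \<in> borel_measurable M" "\<And>x. x \<in> space M \<Longrightarrow> norm (f x) \<le> B"
  shows "square_integrable M f"
proof (rule L2_dominated[where g = "\<lambda>x. B\<^sup>2"])
  interpret finite_measure M by fact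
  show "integrable M (\<lambda>x. B\<^sup>2)" by simp
  show "AE x in M. (norm (f x))\<^sup>2 \<le> B\<^sup>2" using assms(3) by (intro AE_I2 power_mono) auto
qed fact

lemma L2_continuous:
  fixes f :: "'a::euclidean_space \<Rightarrow> 'b::euclidean_space"
  assumes "continuous_on UNIV f" "bounded U" "U \<in> sets lebesgue"
  shows "square_integrable (lebesgue_on U) f"
proof -
  obtain B where "\<And>x. x \<in> U \<Longrightarrow> norm (f x) \<le> B" using continuous_bounded_on assms by blast
  then show ?thesis
    using assms by (intro L2_bounded[where B = B] finite_measure_lebesgue_on_bounded
        continuous_measurable_lebesgue_on) auto
qed

lemma AE_lebesgue_on_subset:
  assumes "V \<subseteq> U" "V \<in> sets lebesgue" "U \<in> sets lebesgue" "AE x in lebesgue_on U. P x"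
  shows "AE x in lebesgue_on V. P x"
proof -
  have "AE x in lebesgue. x \<in> U \<longrightarrow> P x" using assms by (simp add: AE_restrict_space_iff)
  then have "AE x in lebesgue. x \<in> V \<longrightarrow> P x" by eventually_elim (use assms(1) in blast)
  then show ?thesis using assms by (simp add: AE_restrict_space_iff)
qed

lemma integral_lebesgue_on_subset:
  fixes f :: "'a::euclidean_space \<Rightarrow> 'b::euclidean_space"
  assumes "V \<subseteq> U" "V \<in> sets lebesgue" "U \<in> sets lebesgue" "\<And>x. x \<in> U - V \<Longrightarrow> f x = 0"
  shows "(LINT x|lebesgue_on V. f x) = (LINT x|lebesgue_on U. f x)"
proof -
  have "(LINT x|lebesgue. indicator V x *\<^sub>R f x) = (LINT x|lebesgue. indicator U x *\<^sub>R f x)"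
  proof (rule Bochner_Integration.integral_cong[OF refl])
    show "indicator V x *\<^sub>R f x = indicator U x *\<^sub>R f x" for x
      using assms(1,4) by (cases "x \<in> V"; cases "x \<in> U") auto
  qed
  then show ?thesis using assms(2,3) by (simp add: integral_restrict_space)
qed

lemma L2_subset:
  fixes f :: "'a::euclidean_space \<Rightarrow> 'b::euclidean_space"
  assumes "V \<subseteq> U" "V \<in> sets lebesgue" "U \<in> sets lebesgue" "square_integrable (lebesgue_on U) f"
  shows "square_integrable (lebesgue_on V) f"
proof -
  have eq: "lebesgue_on V = restrict_space (lebesgue_on U) V"
    using assms by (simp add: restrict_restrict_space Int_absorb1)
  have V: "V \<inter> space (lebesgue_on U) \<in> sets (lebesgue_on U)"
    using assms by (simp add: sets_restrict_space_iff Int_absorb2)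
  have "integrable (lebesgue_on U) (\<lambda>x. indicator V x *\<^sub>R (norm (f x))\<^sup>2)"
    using assms V by (intro integrable_mult_indicator) (auto simp: square_integrable_def Int_absorb2)
  then show ?thesis
    using assms(4) unfolding square_integrable_def eq
    by (simp add: integrable_restrict_space[OF V] measurable_restrict_space1)
qed

lemma test_functionD:
  assumes "test_function U \<phi>"
  shows "smooth \<phi>" "continuous_on UNIV \<phi>" "compact (closure {x. \<phi> x \<noteq> 0})" "closure {x. \<phi> x \<noteq> 0} \<subseteq> U"
    "x \<notin> U \<Longrightarrow> \<phi> x = 0"
  using assms closure_subset[of "{x. \<phi> x \<noteq> 0}"] by (auto simp: test_function_def intro: smooth_continuous_on)

lemma test_function_partial_outside:
  fixes \<phi> :: "real^'d \<Rightarrow> real"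
  assumes "x \<notin> closure {x. \<phi> x \<noteq> 0}" shows "partial j \<phi> x = 0"
proof -
  have "((\<lambda>x. 0) has_derivative (\<lambda>b. 0)) (at x)" by simp
  then have "(\<phi> has_derivative (\<lambda>b. 0)) (at x)"
    by (rule has_derivative_transform_within_open[of _ _ _ _ "- closure {x. \<phi> x \<noteq> 0}"])
       (use assms closure_subset[of "{x. \<phi> x \<noteq> 0}"] in auto)
  from fun_cong[OF frechet_derivative_at[OF this]] show ?thesis by (simp add: partial_def)
qed

lemma integrable_mult_continuous:
  fixes g f :: "'a::euclidean_space \<Rightarrow> real"
  assumes "continuous_on UNIV f" "bounded U" "U \<in> sets lebesgue" "integrable (lebesgue_on U) g"
  shows "integrable (lebesgue_on U) (\<lambda>x. g x * f x)"
proof -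
  obtain B where B: "\<And>x. x \<in> U \<Longrightarrow> norm (f x) \<le> B" using continuous_bounded_on assms by blast
  show ?thesis
  proof (rule Bochner_Integration.integrable_bound)
    show "integrable (lebesgue_on U) (\<lambda>x. B * g x)" using assms(4) by simp
    show "(\<lambda>x. g x * f x) \<in> borel_measurable (lebesgue_on U)"
      using assms(4) continuous_measurable_lebesgue_on[OF assms(1)] by (intro borel_measurable_times) auto
    have "norm (g x * f x) \<le> norm (B * g x)" if "x \<in> U" for x
    proof -
      have "\<bar>f x\<bar> \<le> \<bar>B\<bar>" using B[OF that] by simp
      then show ?thesis by (simp add: abs_mult mult.commute mult_right_mono)
    qed
    then show "AE x in lebesgue_on U. norm (g x * f x) \<le> norm (B * g x)" by (intro AE_I2) simp
  qed
qed

lemma L2_imp_integrable_nth: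
  fixes v :: "real^'d \<Rightarrow> real^'e"
  assumes "bounded U" "U \<in> sets lebesgue" "square_integrable (lebesgue_on U) v"
  shows "integrable (lebesgue_on U) (\<lambda>x. v x $ i)"
  using integrable_bounded_linear[OF bounded_linear_vec_nth
      L2_imp_integrable[OF finite_measure_lebesgue_on_bounded[OF assms(1,2)] assms(3)]] .

lemma L2_imp_integrable_nth_nth:
  fixes G :: "real^'d \<Rightarrow> real^'e^'f"
  assumes "bounded U" "U \<in> sets lebesgue" "square_integrable (lebesgue_on U) G"
  shows "integrable (lebesgue_on U) (\<lambda>x. G x $ i $ j)"
  using integrable_bounded_linear[OF bounded_linear_vec_nth integrable_bounded_linear[OF bounded_linear_vec_nth
      L2_imp_integrable[OF finite_measure_lebesgue_on_bounded[OF assms(1,2)] assms(3)]]] .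

lemma is_weak_grad_diff:
  fixes v w :: "real^'d \<Rightarrow> real^'d"
  assumes U: "open U" "bounded U"
    and v: "square_integrable (lebesgue_on U) v" "is_weak_grad U v G"
    and w: "square_integrable (lebesgue_on U) w" "is_weak_grad U w H"
  shows "is_weak_grad U (\<lambda>x. v x - w x) (\<lambda>x. G x - H x)"
proof -
  have Um: "U \<in> sets lebesgue" using U by simp
  have int: "integrable (lebesgue_on U) (\<lambda>x. v x $ i * partial j \<phi> x)"
    "integrable (lebesgue_on U) (\<lambda>x. G x $ i $ j * \<phi> x)"
    if "square_integrable (lebesgue_on U) v" "square_integrable (lebesgue_on U) G" "test_function U \<phi>"
    for v :: "real^'d \<Rightarrow> real^'d" and G :: "real^'d \<Rightarrow> real^'d^'d" and \<phi> i j
    by (rule integrable_mult_continuous[OF continuous_on_partial[OF test_functionD(1)[OF that(3)]] U(2) Um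
          L2_imp_integrable_nth[OF U(2) Um that(1)]])
       (rule integrable_mult_continuous[OF test_functionD(2)[OF that(3)] U(2) Um
          L2_imp_integrable_nth_nth[OF U(2) Um that(2)]])
  have GH: "square_integrable (lebesgue_on U) G" "square_integrable (lebesgue_on U) H"
    using v w by (auto simp: is_weak_grad_def)
  show ?thesis
    unfolding is_weak_grad_def
  proof (intro conjI allI impI)
    show "square_integrable (lebesgue_on U) (\<lambda>x. G x - H x)" using GH by (rule L2_diff)
    fix \<phi> i j assume \<phi>: "test_function U \<phi>"
    have "(LINT x|lebesgue_on U. (v x - w x) $ i * partial j \<phi> x)
        = (LINT x|lebesgue_on U. v x $ i * partial j \<phi> x - w x $ i * partial j \<phi> x)"
      by (simp add: algebra_simps)
    also have "\<dots> = (LINT x|lebesgue_on U. v x $ i * partial j \<phi> x) - (LINT x|lebesgue_on U. w x $ i * partial j \<phi> x)"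
      by (intro Bochner_Integration.integral_diff int(1)[OF v(1) GH(1) \<phi>] int(1)[OF w(1) GH(2) \<phi>])
    also have "\<dots> = - ((LINT x|lebesgue_on U. G x $ i $ j * \<phi> x) - (LINT x|lebesgue_on U. H x $ i $ j * \<phi> x))"
      using v(2) w(2) \<phi> by (simp add: is_weak_grad_def)
    also have "(LINT x|lebesgue_on U. G x $ i $ j * \<phi> x) - (LINT x|lebesgue_on U. H x $ i $ j * \<phi> x)
        = (LINT x|lebesgue_on U. G x $ i $ j * \<phi> x - H x $ i $ j * \<phi> x)"
      by (rule Bochner_Integration.integral_diff[OF int(2)[OF v(1) GH(1) \<phi>] int(2)[OF w(1) GH(2) \<phi>], symmetric])
    also have "\<dots> = (LINT x|lebesgue_on U. (G x - H x) $ i $ j * \<phi> x)"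
      by (simp add: algebra_simps)
    finally show "(LINT x|lebesgue_on U. (v x - w x) $ i * partial j \<phi> x)
        = - (LINT x|lebesgue_on U. (G x - H x) $ i $ j * \<phi> x)" .
  qed
qed

lemma is_weak_grad_unique:
  fixes v :: "real^'d \<Rightarrow> real^'d"
  assumes U: "open U" "bounded U" and v: "square_integrable (lebesgue_on U) v"
    and G: "is_weak_grad U v G" and H: "is_weak_grad U v H"
  shows "AE x in lebesgue_on U. G x = H x"
proof -
  have "is_weak_grad U (\<lambda>x. v x - v x) (\<lambda>x. G x - H x)"
    by (rule is_weak_grad_diff[OF U v G v H])
  then have 0: "(LINT x|lebesgue_on U. (G x - H x) $ i $ j * \<phi> x) = 0" if "test_function U \<phi>" for i j \<phi>
    using that by (simp add: is_weak_grad_def)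
  have sq: "square_integrable (lebesgue_on U) (\<lambda>x. G x - H x)"
    using G H by (auto simp: is_weak_grad_def intro: L2_diff)
  have "AE x in lebesgue_on U. (G x - H x) $ i $ j = 0" for i j
    by (rule fundamental_lemma_of_variations[OF U(1) L2_imp_integrable_nth_nth[OF U(2) _ sq] 0]) (use U in auto)
  then have "AE x in lebesgue_on U. \<forall>i\<in>UNIV. \<forall>j\<in>UNIV. (G x - H x) $ i $ j = 0"
    by (intro AE_finite_allI) auto
  then show ?thesis by eventually_elim (simp add: vec_eq_iff)
qed

lemma is_weak_grad_subset:
  fixes v :: "real^'d \<Rightarrow> real^'d"
  assumes "open U" "open V" "V \<subseteq> U" "is_weak_grad U v G"
  shows "is_weak_grad V v G"
  unfolding is_weak_grad_def
proof (intro conjI allI impI)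
  show "square_integrable (lebesgue_on V) G"
    by (rule L2_subset[OF assms(3)])
       (use assms(1,2) assms(4)[unfolded is_weak_grad_def] in simp_all)
  fix \<phi> i j assume \<phi>: "test_function V \<phi>"
  then have "test_function U \<phi>" using assms(3) unfolding test_function_def by blast
  then have U: "(LINT x|lebesgue_on U. v x $ i * partial j \<phi> x) = - (LINT x|lebesgue_on U. G x $ i $ j * \<phi> x)"
    using assms(4) unfolding is_weak_grad_def by blast
  have out: "partial j \<phi> x = 0" "\<phi> x = 0" if "x \<in> U - V" for x
    using that test_functionD(4)[OF \<phi>] test_functionD(5)[OF \<phi>, of x] test_function_partial_outside[of x \<phi> j]
    by auto
  have m: "V \<in> sets lebesgue" "U \<in> sets lebesgue" using assms(1,2) by auto
  have "(LINT x|lebesgue_on V. v x $ i * partial j \<phi> x) = (LINT x|lebesgue_on U. v x $ i * partial j \<phi> x)"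
    by (rule integral_lebesgue_on_subset[OF assms(3) m]) (simp add: out)
  moreover have "(LINT x|lebesgue_on V. G x $ i $ j * \<phi> x) = (LINT x|lebesgue_on U. G x $ i $ j * \<phi> x)"
    by (rule integral_lebesgue_on_subset[OF assms(3) m]) (simp add: out)
  ultimately show "(LINT x|lebesgue_on V. v x $ i * partial j \<phi> x) = - (LINT x|lebesgue_on V. G x $ i $ j * \<phi> x)"
    using U by simp
qed

lemma borel_measurable_nth:
  fixes v :: "'a \<Rightarrow> real^'d"
  assumes "v \<in> borel_measurable M" shows "(\<lambda>x. v x $ i) \<in> borel_measurable M"
  by (rule measurable_compose[OF assms
        borel_measurable_continuous_onI[OF linear_continuous_on[OF bounded_linear_vec_nth]]])

lemma is_weak_grad_cong_AE:
  fixes v w :: "real^'d \<Rightarrow> real^'d"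
  assumes "is_weak_grad U v G" "v \<in> borel_measurable (lebesgue_on U)" "w \<in> borel_measurable (lebesgue_on U)"
    "AE x in lebesgue_on U. v x = w x"
  shows "is_weak_grad U w G"
proof -
  have "(LINT x|lebesgue_on U. w x $ i * partial j \<phi> x) = (LINT x|lebesgue_on U. v x $ i * partial j \<phi> x)"
    if "test_function U \<phi>" for \<phi> i j
  proof (rule integral_cong_AE)
    have "partial j \<phi> \<in> borel_measurable (lebesgue_on U)"
      by (intro continuous_measurable_lebesgue_on continuous_on_partial test_functionD[OF that])
    with borel_measurable_nth[OF assms(2)] borel_measurable_nth[OF assms(3)]
    show "(\<lambda>x. w x $ i * partial j \<phi> x) \<in> borel_measurable (lebesgue_on U)"
      "(\<lambda>x. v x $ i * partial j \<phi> x) \<in> borel_measurable (lebesgue_on U)"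
      by (intro borel_measurable_times; simp)+
    show "AE x in lebesgue_on U. w x $ i * partial j \<phi> x = v x $ i * partial j \<phi> x"
      using assms(4) by eventually_elim simp
  qed
  then show ?thesis using assms(1) by (simp add: is_weak_grad_def)
qed

text \<open>By translation invariance the difference quotients have integral 0. They are bounded by the
  mean value theorem and vanish outside a fixed ball, so that the limit can be taken under the integral.\<close>

lemma integral_derivative_compact_support:
  fixes f :: "'a::euclidean_space \<Rightarrow> real"
  assumes der: "\<And>x. (f has_derivative f' x) (at x)" and cont: "continuous_on UNIV (\<lambda>x. f' x b)"
    and supp: "bounded S" "\<And>x. x \<notin> S \<Longrightarrow> f x = 0"
  shows "(LINT x|lborel. f' x b) = 0"
proof -
  obtain R where R: "\<And>x. x \<in> S \<Longrightarrow> norm x \<le> R" using supp(1) bounded_iff by blast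
  define T where "T = cball (0::'a) (R + norm b)"
  have fc: "continuous_on UNIV f"
    by (rule continuous_at_imp_continuous_on) (use has_derivative_continuous[OF der] in simp)
  have [measurable]: "f \<in> borel_measurable borel" "(\<lambda>x. f' x b) \<in> borel_measurable borel"
    using fc cont by (auto intro: borel_measurable_continuous_onI)
  have zero: "f' x b = 0" if "x \<notin> cball 0 R" for x
  proof -
    have "((\<lambda>x. 0) has_derivative (\<lambda>b. 0)) (at x)" by simp
    then have "(f has_derivative (\<lambda>b. 0)) (at x)"
    proof (rule has_derivative_transform_within_open[of _ _ _ _ "- cball 0 R"])
      show "0 = f y" if "y \<in> - cball 0 R" for y
        using that R[of y] supp(2)[of y] by (cases "y \<in> S") auto
    qed (use that in auto)
    then show ?thesis using has_derivative_unique[OF der[of x]] by (simp add: fun_eq_iff)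
  qed
  obtain B where B: "\<And>x. x \<in> cball 0 R \<Longrightarrow> norm (f' x b) \<le> B"
    using continuous_bounded_on[OF cont bounded_cball] by blast
  define B' where "B' = max B 0"
  have B': "norm (f' x b) \<le> B'" for x
    using B[of x] zero[of x] by (cases "x \<in> cball 0 R") (auto simp: B'_def)
  define t where "t n = inverse (real (Suc n))" for n
  have t: "0 < t n" "t n \<le> 1" for n by (auto simp: t_def inverse_le_1_iff)
  define q where "q n x = (f (x + t n *\<^sub>R b) - f x) / t n" for n x
  have line: "((\<lambda>s. f (x + s *\<^sub>R b)) has_real_derivative f' (x + s *\<^sub>R b) b) (at s)" for x s
  proof -
    have "((\<lambda>s. x + s *\<^sub>R b) has_derivative (\<lambda>s. s *\<^sub>R b)) (at s)"
      by (auto intro!: derivative_eq_intros)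
    then have "((\<lambda>s. f (x + s *\<^sub>R b)) has_derivative (\<lambda>r. f' (x + s *\<^sub>R b) (r *\<^sub>R b))) (at s)"
      by (rule has_derivative_compose[OF _ der])
    moreover have "f' (x + s *\<^sub>R b) (r *\<^sub>R b) = f' (x + s *\<^sub>R b) b * r" for r
      using linear_scale[OF has_derivative_linear[OF der]] by simp
    ultimately show ?thesis by (simp add: has_field_derivative_def)
  qed
  have qB: "norm (q n x) \<le> B'" for n x
  proof -
    obtain z where "f (x + t n *\<^sub>R b) - f (x + 0 *\<^sub>R b) = (t n - 0) * f' (x + z *\<^sub>R b) b"
      using MVT2[of 0 "t n" "\<lambda>s. f (x + s *\<^sub>R b)" "\<lambda>s. f' (x + s *\<^sub>R b) b"] t line by blast
    then have "q n x = f' (x + z *\<^sub>R b) b" using t(1)[of n] by (simp add: q_def)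
    then show ?thesis using B' by simp
  qed
  have q0: "q n x = 0" if "x \<notin> T" for n x
  proof -
    have nx: "norm x > R + norm b" using that by (simp add: T_def)
    have "norm (t n *\<^sub>R b) \<le> norm b" using t[of n] by (simp add: mult_left_le_one_le)
    then have "norm (x + t n *\<^sub>R b) > R" using nx norm_diff_ineq[of x "t n *\<^sub>R b"] by linarith
    moreover have "norm x > R" using nx norm_ge_zero[of b] by linarith
    ultimately have "x \<notin> S" "x + t n *\<^sub>R b \<notin> S" using R by fastforce+
    then show ?thesis by (simp add: q_def supp)
  qed
  have [measurable]: "q n \<in> borel_measurable borel" for n unfolding q_def by measurable
  have ball: "integrable lborel (indicat_real (cball (0::'a) r))" for r
    using emeasure_bounded_finite[OF bounded_cball, of 0 r] by (intro integrable_real_indicator) auto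
  have fint: "integrable lborel f"
  proof -
    obtain C where C: "\<And>x. x \<in> S \<Longrightarrow> norm (f x) \<le> C"
      using continuous_bounded_on[OF fc supp(1)] by blast
    have "norm (f x) \<le> norm (\<bar>C\<bar> * indicator (cball 0 R) x)" for x
      using C[of x] supp(2)[of x] R[of x] by (cases "x \<in> S") (auto simp: indicator_def)
    then have "AE x in lborel. norm (f x) \<le> norm (\<bar>C\<bar> * indicator (cball 0 R) x)" by simp
    moreover have "integrable lborel (\<lambda>x. \<bar>C\<bar> * indicator (cball (0::'a) R) x)"
      by (rule integrable_mult_right) (rule ball)
    ultimately show ?thesis by (rule Bochner_Integration.integrable_bound[rotated 2]) simp
  qed
  have intq: "(LINT x|lborel. q n x) = 0" for n
  proof -
    define c where "c = t n *\<^sub>R b"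
    have [measurable]: "(+) c \<in> borel_measurable lborel" by simp
    have "(LINT x|lborel. f (c + x)) = (LINT x|distr lborel borel ((+) c). f x)"
      by (rule integral_distr[symmetric]) auto
    then have eq: "(LINT x|lborel. f (c + x)) = (LINT x|lborel. f x)"
      unfolding lborel_distr_plus .
    have "integrable (distr lborel borel ((+) c)) f" unfolding lborel_distr_plus by (rule fint)
    then have "integrable lborel (\<lambda>x. f (c + x))" by (rule integrable_distr[rotated]) simp
    from Bochner_Integration.integral_diff[OF this fint] eq
    have "(LINT x|lborel. f (c + x) - f x) = 0" by simp
    then show ?thesis unfolding q_def c_def by (simp add: add.commute)
  qed
  have "(\<lambda>n. LINT x|lborel. q n x) \<longlonglongrightarrow> (LINT x|lborel. f' x b)"
  proof (rule integral_dominated_convergence[where w = "\<lambda>x. B' * indicator T x"])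
    show "integrable lborel (\<lambda>x. B' * indicator T x)"
      unfolding T_def by (rule integrable_mult_right) (rule ball)
    show "AE x in lborel. norm (q n x) \<le> B' * indicator T x" for n
      using qB q0 by (intro AE_I2) (auto simp: indicator_def)
    have "(\<lambda>n. q n x) \<longlonglongrightarrow> f' x b" for x
    proof -
      have "((\<lambda>s. (f (x + s *\<^sub>R b) - f x) / s) \<longlongrightarrow> f' x b) (at 0)"
        using line[of x 0] by (simp add: DERIV_def)
      moreover have "filterlim t (at 0) sequentially"
        unfolding filterlim_at t_def using LIMSEQ_inverse_real_of_nat by auto
      ultimately show ?thesis unfolding q_def by (rule filterlim_compose)
    qed
    then show "AE x in lborel. (\<lambda>n. q n x) \<longlonglongrightarrow> f' x b" by simp
  qed auto
  then show ?thesis using intq by (simp add: LIMSEQ_const_iff)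
qed

text \<open>Integration by parts against a test function \<open>\<phi>\<close>: the derivative of \<open>p\<^sub>i \<phi>\<close>, which has compact
  support, integrates to 0.\<close>

lemma is_weak_grad_smooth:
  fixes p :: "real^'d \<Rightarrow> real^'d"
  assumes U: "open U" "bounded U" and p: "smooth p"
  shows "is_weak_grad U p (\<lambda>x. jacobian p (at x))"
  unfolding is_weak_grad_def
proof (intro conjI allI impI)
  have Um: "U \<in> sets lebesgue" using U by simp
  show "square_integrable (lebesgue_on U) (\<lambda>x. jacobian p (at x))"
    by (rule L2_continuous[OF continuous_on_jacobian[OF p] U(2) Um])
  fix \<phi> i j assume \<phi>: "test_function U \<phi>"
  let ?J = "\<lambda>x. jacobian p (at x) $ i $ j"
  have pc: "continuous_on UNIV (\<lambda>x. p x $ i)"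
    by (intro continuous_on_component smooth_continuous_on p)
  have Jc: "continuous_on UNIV ?J"
    by (intro continuous_on_component continuous_on_jacobian p)
  have \<phi>c: "continuous_on UNIV \<phi>" "continuous_on UNIV (partial j \<phi>)"
    using test_functionD[OF \<phi>] continuous_on_partial by blast+
  have der: "((\<lambda>x. p x $ i * \<phi> x) has_derivative
      (\<lambda>b. p x $ i * frechet_derivative \<phi> (at x) b + frechet_derivative p (at x) b $ i * \<phi> x)) (at x)" for x
    by (intro has_derivative_mult smooth_has_derivative test_functionD(1)[OF \<phi>]
        bounded_linear.has_derivative[OF bounded_linear_vec_nth smooth_has_derivative[OF p]])
  have "(LINT x|lborel. p x $ i * frechet_derivative \<phi> (at x) (axis j 1) + frechet_derivative p (at x) (axis j 1) $ i * \<phi> x) = 0"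
  proof (rule integral_derivative_compact_support[OF der _ U(2)])
    show "continuous_on UNIV (\<lambda>x. p x $ i * frechet_derivative \<phi> (at x) (axis j 1) + frechet_derivative p (at x) (axis j 1) $ i * \<phi> x)"
      using continuous_on_add[OF continuous_on_mult[OF pc \<phi>c(2)] continuous_on_mult[OF Jc \<phi>c(1)]]
      by (simp add: partial_def jacobian_nth)
    show "p x $ i * \<phi> x = 0" if "x \<notin> U" for x using test_functionD(5)[OF \<phi> that] by simp
  qed
  then have 0: "(LINT x|lborel. p x $ i * partial j \<phi> x + ?J x * \<phi> x) = 0"
    by (simp add: partial_def jacobian_nth)
  have out: "p x $ i * partial j \<phi> x + ?J x * \<phi> x = 0" if "x \<notin> U" for x
    using that test_functionD(4,5)[OF \<phi>] test_function_partial_outside[of x \<phi> j] by auto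
  have int: "integrable (lebesgue_on U) (\<lambda>x. f x * g x)"
    if "continuous_on UNIV f" "continuous_on UNIV g" for f g :: "real^'d \<Rightarrow> real"
    by (rule integrable_mult_continuous[OF that(2) U(2) Um L2_imp_integrable[OF
          finite_measure_lebesgue_on_bounded[OF U(2) Um] L2_continuous[OF that(1) U(2) Um]]])
  have "(LINT x|lebesgue_on U. p x $ i * partial j \<phi> x) + (LINT x|lebesgue_on U. ?J x * \<phi> x)
      = (LINT x|lebesgue_on U. p x $ i * partial j \<phi> x + ?J x * \<phi> x)"
    by (rule Bochner_Integration.integral_add[OF int[OF pc \<phi>c(2)] int[OF Jc \<phi>c(1)], symmetric])
  also have "\<dots> = (LINT x|lebesgue_on UNIV. p x $ i * partial j \<phi> x + ?J x * \<phi> x)"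
    by (rule integral_lebesgue_on_subset) (use out Um in auto)
  also have "\<dots> = (LINT x|lborel. p x $ i * partial j \<phi> x + ?J x * \<phi> x)"
  proof -
    have "continuous_on UNIV (\<lambda>x. p x $ i * partial j \<phi> x + ?J x * \<phi> x)"
      by (intro continuous_on_add continuous_on_mult pc Jc \<phi>c)
    then have "(\<lambda>x. p x $ i * partial j \<phi> x + ?J x * \<phi> x) \<in> borel_measurable lborel"
      using borel_measurable_continuous_onI by simp
    from integral_completion[OF this] show ?thesis by (simp add: lebesgue_on_UNIV_eq)
  qed
  finally show "(LINT x|lebesgue_on U. p x $ i * partial j \<phi> x) = - (LINT x|lebesgue_on U. ?J x * \<phi> x)"
    using 0 by simp
qed

lemma is_weak_grad_weak_grad:
  "v \<in> H1 U \<Longrightarrow> is_weak_grad U v (weak_grad U v)"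
  unfolding H1_def weak_grad_def using someI_ex[of "is_weak_grad U v"] by blast

lemma weak_grad_unique:
  fixes v :: "real^'d \<Rightarrow> real^'d"
  assumes "open U" "bounded U" "square_integrable (lebesgue_on U) v" "is_weak_grad U v G"
  shows "v \<in> H1 U" "AE x in lebesgue_on U. weak_grad U v x = G x"
proof -
  show "v \<in> H1 U" using assms by (auto simp: H1_def)
  from is_weak_grad_unique[OF assms(1-3) is_weak_grad_weak_grad[OF this] assms(4)]
  show "AE x in lebesgue_on U. weak_grad U v x = G x" .
qed

section \<open>Surface measure\<close>

lemma hyperplane_normal_form:
  fixes P :: "'a::euclidean_space set"
  assumes "is_hyperplane P"
  obtains n c where "norm n = 1" "P = {x. n \<bullet> x = c}"
proof -
  have hull: "affine hull P = P" using assms by (simp add: is_hyperplane_def hull_same)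
  have "\<exists>a b. a \<noteq> 0 \<and> affine hull P = {x. a \<bullet> x = b}"
    using assms aff_dim_eq_hyperplane[of P] by (simp add: is_hyperplane_def)
  then obtain a b where a: "a \<noteq> 0" "P = {x. a \<bullet> x = b}"
    unfolding hull by (elim exE conjE) (rule that)
  show thesis
  proof (rule that)
    show "norm (a /\<^sub>R norm a) = 1" using a by simp
    show "P = {x. (a /\<^sub>R norm a) \<bullet> x = b / norm a}"
      using a by (simp add: divide_inverse mult.commute[of b])
  qed
qed

text \<open>The projection onto the hyperplane \<open>{x. n \<bullet> x = c}\<close> with unit normal \<open>n\<close>.\<close>

definition plane_proj :: "'a::euclidean_space \<Rightarrow> real \<Rightarrow> 'a \<Rightarrow> 'a" where
  "plane_proj n c x = x - (n \<bullet> x - c) *\<^sub>R n"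

lemma plane_proj_mem: "norm n = 1 \<Longrightarrow> n \<bullet> plane_proj n c x = c"
  by (simp add: plane_proj_def inner_diff_right norm_eq_1)

lemma plane_proj_id: "n \<bullet> x = c \<Longrightarrow> plane_proj n c x = x"
  by (simp add: plane_proj_def)

lemma continuous_on_plane_proj: "continuous_on S (plane_proj n c)"
  unfolding plane_proj_def by (intro continuous_intros)

lemma measurable_plane_proj [measurable]: "plane_proj n c \<in> borel_measurable borel"
  by (rule borel_measurable_continuous_onI[OF continuous_on_plane_proj])

lemma dist_hyperplane_ge:
  assumes "norm n = 1" "n \<bullet> z = c" shows "\<bar>n \<bullet> x - c\<bar> \<le> dist x z"
proof -
  have "\<bar>n \<bullet> x - c\<bar> = \<bar>n \<bullet> (x - z)\<bar>" using assms by (simp add: inner_diff_right)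
  also have "\<dots> \<le> norm n * norm (x - z)" by (rule Cauchy_Schwarz_ineq2)
  finally show ?thesis using assms by (simp add: dist_norm)
qed

lemma dist_plane_proj: "norm n = 1 \<Longrightarrow> dist x (plane_proj n c x) = \<bar>n \<bullet> x - c\<bar>"
  by (simp add: plane_proj_def dist_norm)

lemma closest_point_hyperplane:
  assumes "norm n = 1" shows "closest_point {x. n \<bullet> x = c} = plane_proj n c"
proof
  fix x
  show "closest_point {x. n \<bullet> x = c} x = plane_proj n c x"
    by (rule closest_point_unique[symmetric])
       (use assms in \<open>auto simp: convex_hyperplane closed_hyperplane plane_proj_mem
          dist_plane_proj intro: dist_hyperplane_ge\<close>)
qed

lemma infdist_hyperplane:
  fixes n :: "'a::euclidean_space"
  assumes "norm n = 1" shows "infdist x {x. n \<bullet> x = c} = \<bar>n \<bullet> x - c\<bar>"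
proof (rule antisym)
  have p: "plane_proj n c x \<in> {x. n \<bullet> x = c}" using plane_proj_mem[OF assms] by simp
  show "infdist x {x. n \<bullet> x = c} \<le> \<bar>n \<bullet> x - c\<bar>"
    using infdist_le[OF p, of x] dist_plane_proj[OF assms, of x c] by simp
  have "{x. n \<bullet> x = c} \<noteq> {}" using p by blast
  then show "\<bar>n \<bullet> x - c\<bar> \<le> infdist x {x. n \<bullet> x = c}"
    unfolding infdist_notempty[OF \<open>{x. n \<bullet> x = c} \<noteq> {}\<close>]
    by (rule cINF_greatest) (use dist_hyperplane_ge[OF assms] in simp)
qed

definition slab :: "'a::euclidean_space \<Rightarrow> real \<Rightarrow> 'a set" where
  "slab n c = {x. \<bar>n \<bullet> x - c\<bar> \<le> 1/2}"

lemma slab_borel [measurable]: "slab n c \<in> sets borel"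
proof -
  have "closed (slab n c)"
    unfolding slab_def by (intro closed_Collect_le continuous_intros)
  then show ?thesis by (rule borel_closed)
qed

lemma hyperplane_measure_eq:
  assumes "norm n = 1"
  shows "hyperplane_measure {x. n \<bullet> x = c} = distr (restrict_space lborel (slab n c)) borel (plane_proj n c)"
  unfolding hyperplane_measure_def infdist_hyperplane[OF assms] closest_point_hyperplane[OF assms] slab_def ..

lemma measurable_proj_slab:
  "plane_proj n c \<in> measurable (restrict_space lborel (slab n c)) borel"
  by (rule measurable_restrict_space1) simp

lemma sets_hyperplane_measure [simp, measurable_cong]: "sets (hyperplane_measure P) = sets borel"
  by (simp add: hyperplane_measure_def)

lemma space_hyperplane_measure [simp]: "space (hyperplane_measure P) = UNIV"
  by (simp add: hyperplane_measure_def)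

lemma nn_integral_hyperplane_measure:
  assumes "norm n = 1" "f \<in> borel_measurable borel"
  shows "(\<integral>\<^sup>+x. f x \<partial>hyperplane_measure {x. n \<bullet> x = c})
    = (\<integral>\<^sup>+x. f (plane_proj n c x) * indicator (slab n c) x \<partial>lborel)"
  unfolding hyperplane_measure_eq[OF assms(1)]
  using assms(2) by (simp add: nn_integral_distr measurable_proj_slab nn_integral_restrict_space)

lemma emeasure_hyperplane_measure:
  assumes "norm n = 1" "A \<in> sets borel"
  shows "emeasure (hyperplane_measure {x. n \<bullet> x = c}) A
    = emeasure lborel (plane_proj n c -` A \<inter> slab n c)"
  unfolding hyperplane_measure_eq[OF assms(1)] using assms(2)
  by (simp add: emeasure_distr measurable_proj_slab space_restrict_space emeasure_restrict_space)

lemma affine_closed_borel: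
  fixes A :: "'a::euclidean_space set"
  assumes "affine A" shows "A \<in> sets borel"
  using borel_closed[OF closed_affine_hull[of A]] hull_same[of affine A, OF assms] by simp

text \<open>The preimage of an affine set under the projection is affine, and it is not the whole space
  unless the set contains the hyperplane.\<close>

lemma hyperplane_measure_affine_null:
  fixes A P :: "'a::euclidean_space set"
  assumes P: "is_hyperplane P" and A: "affine A" "\<not> P \<subseteq> A"
  shows "emeasure (hyperplane_measure P) A = 0"
proof -
  obtain n c where n: "norm n = 1" and Pn: "P = {x. n \<bullet> x = c}" using hyperplane_normal_form[OF P] .
  let ?B = "plane_proj n c -` A"
  have Ab: "A \<in> sets borel" using affine_closed_borel[OF A(1)] .
  have aff: "affine ?B"
    unfolding affine_alt
  proof (clarsimp)
    fix x y u assume xy: "plane_proj n c x \<in> A" "plane_proj n c y \<in> A"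
    have "plane_proj n c ((1 - u) *\<^sub>R x + u *\<^sub>R y)
        = (1 - u) *\<^sub>R plane_proj n c x + u *\<^sub>R plane_proj n c y"
      by (simp add: plane_proj_def algebra_simps inner_simps)
    then show "plane_proj n c ((1 - u) *\<^sub>R x + u *\<^sub>R y) \<in> A"
      using A(1) xy unfolding affine_alt by simp
  qed
  obtain p where "p \<in> P" "p \<notin> A" using A(2) by blast
  then have "p \<notin> ?B" using plane_proj_id[of n p c] Pn by simp
  then have "interior ?B = {}"
    using affine_hull_nonempty_interior[of ?B] hull_same[of affine, OF aff] by blast
  then have "negligible ?B"
    using negligible_convex_interior[OF affine_imp_convex[OF aff]] by simp
  moreover have Bb: "?B \<in> sets borel"
    using measurable_sets[OF measurable_plane_proj Ab] by simp
  ultimately have "emeasure lborel ?B = 0"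
    by (simp add: negligible_iff_null_sets null_sets_completion_iff null_sets_def)
  then have "emeasure lborel (?B \<inter> slab n c) = 0"
    using emeasure_mono[of "?B \<inter> slab n c" ?B lborel] Bb by simp
  then show ?thesis unfolding Pn emeasure_hyperplane_measure[OF n Ab] .
qed

lemma hyperplane_eqI:
  assumes "is_hyperplane P" "is_hyperplane H" "P \<subseteq> H" shows "P = H"
proof (rule affine_dim_equal)
  obtain n c where n: "norm n = 1" and P: "P = {x. n \<bullet> x = c}" using hyperplane_normal_form[OF assms(1)] .
  have "plane_proj n c 0 \<in> P" unfolding P using plane_proj_mem[OF n] by simp
  then show "P \<noteq> {}" by blast
qed (use assms in \<open>auto simp: is_hyperplane_def\<close>)

lemma hyperplane_measure_bounded_finite:
  assumes P: "is_hyperplane P" and A: "bounded A" "A \<in> sets borel"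
  shows "emeasure (hyperplane_measure P) A < \<infinity>"
proof -
  obtain n c where n: "norm n = 1" and Pn: "P = {x. n \<bullet> x = c}" using hyperplane_normal_form[OF P] .
  obtain r where r: "\<And>x. x \<in> A \<Longrightarrow> norm x \<le> r" using A(1) bounded_iff by blast
  have "norm x \<le> r + 1/2" if "plane_proj n c x \<in> A" "x \<in> slab n c" for x
  proof -
    have "norm x \<le> norm (plane_proj n c x) + dist x (plane_proj n c x)"
      using norm_triangle_ineq[of "plane_proj n c x" "x - plane_proj n c x"] by (simp add: dist_norm)
    then show ?thesis
      using r[OF that(1)] that(2) by (simp add: slab_def dist_plane_proj[OF n])
  qed
  then have "bounded (plane_proj n c -` A \<inter> slab n c)" unfolding bounded_iff by blast
  then show ?thesis unfolding Pn emeasure_hyperplane_measure[OF n A(2)] by (rule emeasure_bounded_finite)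
qed

abbreviation charged_hyperplanes :: "'a::euclidean_space set \<Rightarrow> 'a set set" where
  "charged_hyperplanes S \<equiv> {P. is_hyperplane P \<and> 0 < emeasure (hyperplane_measure P) S}"

lemma sets_surface_measure [simp, measurable_cong]: "sets (surface_measure S) = sets borel"
  unfolding surface_measure_def by (simp add: sets.sigma_sets_eq[of borel, simplified])

lemma space_surface_measure [simp]: "space (surface_measure S) = UNIV"
  unfolding surface_measure_def by (simp add: space_measure_of_conv)

lemma emeasure_surface_measure:
  assumes S: "S \<in> sets borel" and A: "A \<in> sets borel"
  shows "emeasure (surface_measure S) A
    = (\<Sum>P\<in>charged_hyperplanes S. emeasure (hyperplane_measure P) (A \<inter> S))"
proof (rule emeasure_measure_of[OF surface_measure_def])
  show "sets borel \<subseteq> Pow UNIV" by simp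
  show "A \<in> sets (surface_measure S)" using A by simp
  show "positive (sets (surface_measure S)) (\<lambda>A. \<Sum>P\<in>charged_hyperplanes S. emeasure (hyperplane_measure P) (A \<inter> S))"
    by (simp add: positive_def)
  show "countably_additive (sets (surface_measure S)) (\<lambda>A. \<Sum>P\<in>charged_hyperplanes S. emeasure (hyperplane_measure P) (A \<inter> S))"
  proof (rule countably_additiveI)
    fix B :: "nat \<Rightarrow> 'a set"
    assume B: "range B \<subseteq> sets (surface_measure S)" "disjoint_family B" "(\<Union>i. B i) \<in> sets (surface_measure S)"
    have "(\<Sum>i. emeasure (hyperplane_measure P) (B i \<inter> S)) = emeasure (hyperplane_measure P) ((\<Union>i. B i) \<inter> S)" for P
    proof -
      have "(\<Sum>i. emeasure (hyperplane_measure P) (B i \<inter> S)) = emeasure (hyperplane_measure P) (\<Union>i. B i \<inter> S)"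
        using B S by (intro suminf_emeasure) (auto simp: disjoint_family_on_def)
      then show ?thesis by simp
    qed
    then show "(\<Sum>i. \<Sum>P\<in>charged_hyperplanes S. emeasure (hyperplane_measure P) (B i \<inter> S))
        = (\<Sum>P\<in>charged_hyperplanes S. emeasure (hyperplane_measure P) ((\<Union>i. B i) \<inter> S))"
      by (subst suminf_sum) auto
  qed
qed

text \<open>A sum over an infinite index set is 0 by convention. So the assumption that the Dirichlet boundary
  has positive measure already implies that only finitely many hyperplanes contribute.\<close>

lemma finite_charged_hyperplanes:
  assumes "S \<in> sets borel" "A \<in> sets borel" "0 < emeasure (surface_measure S) A"
  shows "finite (charged_hyperplanes S)"
  using assms(3) unfolding emeasure_surface_measure[OF assms(1,2)]
  by (rule contrapos_pp) simp

lemma charged_hyperplanes_mono: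
  "S \<subseteq> T \<Longrightarrow> T \<in> sets borel \<Longrightarrow> charged_hyperplanes S \<subseteq> charged_hyperplanes T"
proof clarify
  fix P :: "'a set" assume "S \<subseteq> T" "T \<in> sets borel" "0 < emeasure (hyperplane_measure P) S"
  then show "0 < emeasure (hyperplane_measure P) T"
    using emeasure_mono[of S T "hyperplane_measure P"] by simp
qed

lemma finite_measure_surface_measure:
  assumes "finite (charged_hyperplanes S)" "bounded S" "S \<in> sets borel"
  shows "finite_measure (surface_measure S)"
proof (rule finite_measureI)
  have "emeasure (hyperplane_measure P) S < \<infinity>" if "P \<in> charged_hyperplanes S" for P
    using hyperplane_measure_bounded_finite[OF _ assms(2,3)] that by blast
  then have "(\<Sum>P\<in>charged_hyperplanes S. emeasure (hyperplane_measure P) (UNIV \<inter> S)) < top"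
    using assms(1) by (simp add: ennreal_sum_less_top)
  then show "emeasure (surface_measure S) (space (surface_measure S)) \<noteq> \<infinity>"
    by (simp add: emeasure_surface_measure[OF assms(3)])
qed

text \<open>Any other hyperplane meets \<open>H\<close> in an affine set that does not contain it, hence in a null set
  for its own measure.\<close>

lemma charged_hyperplanes_flat:
  assumes H: "is_hyperplane H" "E \<subseteq> H"
  shows "charged_hyperplanes E \<subseteq> {H}"
proof (rule subsetI, rule ccontr)
  have Hb: "H \<in> sets borel" using H(1) affine_closed_borel unfolding is_hyperplane_def by blast
  fix P assume P: "P \<in> charged_hyperplanes E" "P \<notin> {H}"
  then have "\<not> P \<subseteq> H" using hyperplane_eqI[OF _ H(1)] by blast
  then have "emeasure (hyperplane_measure P) H = 0"
    using hyperplane_measure_affine_null P H(1) unfolding is_hyperplane_def by blast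
  then have "emeasure (hyperplane_measure P) E = 0"
    using emeasure_mono[OF H(2), of "hyperplane_measure P"] Hb by simp
  then show False using P by simp
qed

lemma emeasure_surface_measure_flat:
  assumes H: "is_hyperplane H" "E \<subseteq> H" and E: "E \<in> sets borel" and A: "A \<in> sets borel"
  shows "emeasure (surface_measure E) A = emeasure (hyperplane_measure H) (A \<inter> E)"
proof -
  have "charged_hyperplanes E \<subseteq> {H}" by (rule charged_hyperplanes_flat[OF H])
  then consider "charged_hyperplanes E = {H}" | "charged_hyperplanes E = {}" by blast
  then show ?thesis
  proof cases
    case 1
    then show ?thesis unfolding emeasure_surface_measure[OF E A] 1 by simp
  next
    case 2
    then have "emeasure (hyperplane_measure H) E = 0" using H(1) by (auto simp: not_gr_zero)
    then have "emeasure (hyperplane_measure H) (A \<inter> E) = 0"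
      using emeasure_mono[of "A \<inter> E" E "hyperplane_measure H"] E by simp
    then show ?thesis unfolding emeasure_surface_measure[OF E A] 2 by simp
  qed
qed

lemma nn_integral_surface_measure_flat:
  assumes H: "is_hyperplane H" "E \<subseteq> H" and E: "E \<in> sets borel" and f: "f \<in> borel_measurable borel"
  shows "(\<integral>\<^sup>+x. f x \<partial>surface_measure E) = (\<integral>\<^sup>+x. f x * indicator E x \<partial>hyperplane_measure H)"
proof -
  have "surface_measure E = density (hyperplane_measure H) (indicator E)"
  proof (rule measure_eqI)
    fix A assume "A \<in> sets (surface_measure E)"
    then have A: "A \<in> sets borel" by simp
    have "emeasure (density (hyperplane_measure H) (indicator E)) A
        = (\<integral>\<^sup>+x. indicator E x * indicator A x \<partial>hyperplane_measure H)"
      using A E by (intro emeasure_density) auto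
    also have "\<dots> = (\<integral>\<^sup>+x. indicator (A \<inter> E) x \<partial>hyperplane_measure H)"
      by (intro nn_integral_cong) (auto simp: indicator_def)
    also have "\<dots> = emeasure (hyperplane_measure H) (A \<inter> E)" using A E by simp
    finally show "emeasure (surface_measure E) A = emeasure (density (hyperplane_measure H) (indicator E)) A"
      unfolding emeasure_surface_measure_flat[OF H E A] by simp
  qed simp
  then have "(\<integral>\<^sup>+x. f x \<partial>surface_measure E) = (\<integral>\<^sup>+x. indicator E x * f x \<partial>hyperplane_measure H)"
    using E f by (simp add: nn_integral_density)
  then show ?thesis by (simp add: mult.commute)
qed

lemma hyperplane_measure_rel_frontier_null:
  assumes H: "is_hyperplane H" and E: "polytope E" "aff_dim E \<le> aff_dim H"
  shows "emeasure (hyperplane_measure H) (rel_frontier E) = 0"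
proof -
  have "emeasure (hyperplane_measure H) F = 0" if F: "F facet_of E" for F
  proof -
    have "aff_dim (affine hull F) < aff_dim H" using F E(2) by (simp add: facet_of_def)
    then have "\<not> H \<subseteq> affine hull F" using aff_dim_subset[of H "affine hull F"] by force
    then have "emeasure (hyperplane_measure H) (affine hull F) = 0"
      using hyperplane_measure_affine_null[OF H affine_affine_hull] by blast
    then show ?thesis
      using emeasure_mono[OF hull_subset[of F affine], of "hyperplane_measure H"]
        borel_closed[OF closed_affine_hull[of F]] by simp
  qed
  moreover have "F \<in> sets borel" if "F facet_of E" for F
    using that E(1) by (meson borel_compact face_of_polytope_polytope facet_of_imp_face_of polytope_imp_compact)
  ultimately have "F \<in> null_sets (hyperplane_measure H)" if "F \<in> {F. F facet_of E}" for F
    using that by (auto intro: null_setsI)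
  then have "\<Union>{F. F facet_of E} \<in> null_sets (hyperplane_measure H)"
    using finite_polytope_facets[OF E(1)] null_sets_UN'[of "{F. F facet_of E}" "\<lambda>F. F"]
    by (simp add: countable_finite)
  then show ?thesis
    using rel_frontier_of_polyhedron[OF polytope_imp_polyhedron[OF E(1)]] by (simp add: null_sets_def)
qed

text \<open>The relative boundary of a facet is a null set, so that it does not matter whether it belongs
  to the part of the boundary under consideration.\<close>

lemma surface_measure_mono_rel_interior:
  assumes H: "is_hyperplane H" "E \<subseteq> H" "polytope E"
    and S: "rel_interior E \<subseteq> S" "S \<in> sets borel" "finite (charged_hyperplanes S)"
  shows "surface_measure E \<le> surface_measure S"
proof -
  have Eb: "E \<in> sets borel" by (rule borel_compact[OF polytope_imp_compact[OF H(3)]])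
  have "emeasure (surface_measure E) A \<le> emeasure (surface_measure S) A" if A: "A \<in> sets borel" for A
  proof -
    have fr: "rel_frontier E \<in> null_sets (hyperplane_measure H)"
      by (rule null_setsI[OF hyperplane_measure_rel_frontier_null[OF H(1,3) aff_dim_subset[OF H(2)]]])
         (simp add: borel_closed[OF closed_rel_frontier])
    have "A \<inter> E \<subseteq> (A \<inter> S) \<union> rel_frontier E"
      using S(1) closure_closed[of E] polytope_imp_closed[OF H(3)] by (auto simp: rel_frontier_def)
    then have "emeasure (hyperplane_measure H) (A \<inter> E) \<le> emeasure (hyperplane_measure H) ((A \<inter> S) \<union> rel_frontier E)"
      using A S(2) fr by (intro emeasure_mono) (auto dest: null_setsD2)
    also have "\<dots> = emeasure (hyperplane_measure H) (A \<inter> S)"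
      using A S(2) fr by (intro emeasure_Un_null_set) auto
    also have "\<dots> \<le> (\<Sum>P\<in>charged_hyperplanes S. emeasure (hyperplane_measure P) (A \<inter> S))"
    proof (cases "H \<in> charged_hyperplanes S")
      case True
      then show ?thesis
        using S(3) by (intro member_le_sum[where f = "\<lambda>P. emeasure (hyperplane_measure P) (A \<inter> S)"]) auto
    next
      case False
      then have "emeasure (hyperplane_measure H) S = 0" using H(1) by (auto simp: not_gr_zero)
      then show ?thesis
        using emeasure_mono[of "A \<inter> S" S "hyperplane_measure H"] S(2) by simp
    qed
    finally show ?thesis
      unfolding emeasure_surface_measure_flat[OF H(1,2) Eb A] emeasure_surface_measure[OF S(2) A] .
  qed
  then show ?thesis by (subst le_measure) auto
qed

section \<open>The trace inequality on a simplex\<close>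

text \<open>The fundamental theorem of calculus for \<open>(1 - t / \<delta>) |f t|\<^sup>2\<close>, which is \<open>|f 0|\<^sup>2\<close> at 0 and
  vanishes at \<open>\<delta>\<close>.\<close>

lemma trace_inequality_interval:
  fixes f f' :: "real \<Rightarrow> 'b::euclidean_space"
  assumes der: "\<And>t. (f has_vector_derivative f' t) (at t)" and cont: "continuous_on UNIV f'" and \<delta>: "0 < \<delta>"
  shows "ennreal ((norm (f 0))\<^sup>2)
    \<le> (\<integral>\<^sup>+t. ennreal ((1/\<delta> + 1) * (norm (f t))\<^sup>2 + (norm (f' t))\<^sup>2) * indicator {0..\<delta>} t \<partial>lborel)"
proof -
  have fc: "continuous_on UNIV f"
    by (rule continuous_at_imp_continuous_on) (use has_vector_derivative_continuous[OF der] in simp)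
  have [continuous_intros]: "continuous_on {0..\<delta>} f" "continuous_on {0..\<delta>} f'"
    using continuous_on_subset[OF fc] continuous_on_subset[OF cont] by auto
  define g where "g t = (1 - t/\<delta>) * (f t \<bullet> f t)" for t
  define g' where "g' t = (1 - t/\<delta>) * (f t \<bullet> f' t + f' t \<bullet> f t) + (- (1/\<delta>)) * (f t \<bullet> f t)" for t
  define h where "h t = (1/\<delta> + 1) * (norm (f t))\<^sup>2 + (norm (f' t))\<^sup>2" for t
  have dg: "(g has_real_derivative g' t) (at t)" for t
  proof -
    have "((\<lambda>t. f t \<bullet> f t) has_real_derivative (f t \<bullet> f' t + f' t \<bullet> f t)) (at t)"
    proof -
      have "((\<lambda>t. f t \<bullet> f t) has_derivative (\<lambda>h. f t \<bullet> (h *\<^sub>R f' t) + (h *\<^sub>R f' t) \<bullet> f t)) (at t)"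
        by (rule has_derivative_inner[OF der[of t, unfolded has_vector_derivative_def] der[of t, unfolded has_vector_derivative_def]])
      moreover have "(\<lambda>h. f t \<bullet> (h *\<^sub>R f' t) + (h *\<^sub>R f' t) \<bullet> f t) = (*) (f t \<bullet> f' t + f' t \<bullet> f t)"
        by (simp add: fun_eq_iff algebra_simps)
      ultimately show ?thesis by (simp add: has_field_derivative_def)
    qed
    moreover have "((\<lambda>t. 1 - t/\<delta>) has_real_derivative (- (1/\<delta>))) (at t)"
      using \<delta> by (auto intro!: derivative_eq_intros)
    ultimately show ?thesis
      unfolding g_def g'_def using DERIV_mult' by blast
  qed
  have g'c: "continuous_on {0..\<delta>} g'" unfolding g'_def using \<delta> by (intro continuous_intros) auto
  have hc: "continuous_on {0..\<delta>} h" unfolding h_def using \<delta> by (intro continuous_intros) auto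
  have le: "- g' t \<le> h t" if t: "t \<in> {0..\<delta>}" for t
  proof -
    define \<theta> where "\<theta> = 1 - t/\<delta>"
    have \<theta>: "0 \<le> \<theta>" "\<theta> \<le> 1" using t \<delta> by (auto simp: \<theta>_def)
    have "- (2 * (f t \<bullet> f' t)) \<le> (norm (f t))\<^sup>2 + (norm (f' t))\<^sup>2"
      using zero_le_power2[of "norm (f t + f' t)"]
      unfolding power2_norm_eq_inner by (simp add: inner_simps inner_commute)
    then have "\<theta> * - (2 * (f t \<bullet> f' t)) \<le> \<theta> * ((norm (f t))\<^sup>2 + (norm (f' t))\<^sup>2)"
      using \<theta> by (rule_tac mult_left_mono) auto
    also have "\<dots> \<le> (norm (f t))\<^sup>2 + (norm (f' t))\<^sup>2"
      using \<theta> by (intro mult_left_le_one_le) auto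
    finally show ?thesis
      unfolding g'_def h_def \<theta>_def[symmetric] power2_norm_eq_inner
      by (simp add: inner_commute algebra_simps)
  qed
  have gi: "set_integrable lborel {0..\<delta>} g'" by (rule borel_integrable_atLeastAtMost'[OF g'c])
  have hi: "set_integrable lborel {0..\<delta>} h" by (rule borel_integrable_atLeastAtMost'[OF hc])
  have "(LINT t:{0..\<delta>}|lborel. g' t) = g \<delta> - g 0"
    unfolding set_lebesgue_integral_def
  proof (rule integral_FTC_Icc)
    show "(g has_vector_derivative g' t) (at t within {0..\<delta>})" for t
      using dg[of t] has_field_derivative_at_within has_real_derivative_iff_has_vector_derivative by blast
  qed (use \<delta> g'c in auto)
  then have "(norm (f 0))\<^sup>2 = - (LINT t:{0..\<delta>}|lborel. g' t)"
    using \<delta> by (simp add: g_def power2_norm_eq_inner)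
  also have "\<dots> = (LINT t:{0..\<delta>}|lborel. - g' t)"
    unfolding set_lebesgue_integral_def by simp
  also have "\<dots> \<le> (LINT t:{0..\<delta>}|lborel. h t)"
  proof (rule set_integral_mono[OF _ hi le])
    show "set_integrable lborel {0..\<delta>} (\<lambda>t. - g' t)"
      using gi unfolding set_integrable_def by simp
  qed
  finally have "ennreal ((norm (f 0))\<^sup>2) \<le> ennreal (LINT t|lborel. indicator {0..\<delta>} t *\<^sub>R h t)"
    unfolding set_lebesgue_integral_def by (rule ennreal_leI)
  also have "\<dots> = (\<integral>\<^sup>+t. ennreal (indicator {0..\<delta>} t *\<^sub>R h t) \<partial>lborel)"
    using hi \<delta> unfolding set_integrable_def
    by (intro nn_integral_eq_integral[symmetric]) (auto simp: h_def indicator_def)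
  also have "\<dots> = (\<integral>\<^sup>+t. ennreal (h t) * indicator {0..\<delta>} t \<partial>lborel)"
    by (rule nn_integral_cong) (auto simp: indicator_def)
  finally show ?thesis unfolding h_def .
qed

lemma nn_integral_lborel_translate:
  fixes f :: "'a::euclidean_space \<Rightarrow> ennreal"
  assumes "f \<in> borel_measurable borel"
  shows "(\<integral>\<^sup>+x. f (a + x) \<partial>lborel) = (\<integral>\<^sup>+x. f x \<partial>lborel)"
proof -
  have "(\<integral>\<^sup>+x. f x \<partial>distr lborel borel ((+) a)) = (\<integral>\<^sup>+x. f (a + x) \<partial>lborel)"
    by (rule nn_integral_distr) (use assms in auto)
  then show ?thesis unfolding lborel_distr_plus by simp
qed

text \<open>Fubini in slab coordinates for the segments \<open>y + t b\<close> over the points \<open>y\<close> of a hyperplane.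
  Translating by \<open>- t b\<close> for fixed \<open>t\<close> replaces the direction \<open>b\<close> by its normal component
  \<open>(n \<bullet> b) n\<close>; then \<open>t = (n \<bullet> x - c + s) / (n \<bullet> b)\<close> turns the argument of \<open>F\<close> into the translate
  \<open>x + s n\<close>, and \<open>s\<close> ranges over an interval of length 1.\<close>

lemma nn_integral_slab_segments_le:
  fixes F :: "'a::euclidean_space \<Rightarrow> ennreal"
  assumes n: "norm n = 1" and b: "n \<bullet> b \<noteq> 0" and F [measurable]: "F \<in> borel_measurable borel"
  shows "(\<integral>\<^sup>+x. indicator (slab n c) x * (\<integral>\<^sup>+t. indicator {0..\<delta>} t * F (plane_proj n c x + t *\<^sub>R b) \<partial>lborel) \<partial>lborel)
    \<le> ennreal (1 / \<bar>n \<bullet> b\<bar>) * (\<integral>\<^sup>+x. F x \<partial>lborel)"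
proof -
  let ?\<beta> = "n \<bullet> b"
  have nn: "n \<bullet> n = 1" using n by (simp add: norm_eq_1)
  define G :: "'a \<Rightarrow> real \<Rightarrow> ennreal" where
    "G x t = indicator {0..\<delta>} t * indicator (slab n c) x * F (plane_proj n c x + t *\<^sub>R b)" for x t
  define G2 :: "'a \<Rightarrow> real \<Rightarrow> ennreal" where
    "G2 x t = indicator (slab n c) (- t *\<^sub>R b + x) * F (plane_proj n c x + (t * ?\<beta>) *\<^sub>R n)" for x t
  have Gm: "case_prod G \<in> borel_measurable (lborel \<Otimes>\<^sub>M lborel)"
    unfolding G_def by measurable
  have G2m: "case_prod G2 \<in> borel_measurable (lborel \<Otimes>\<^sub>M lborel)"
    unfolding G2_def by measurable
  have "(\<integral>\<^sup>+x. indicator (slab n c) x * (\<integral>\<^sup>+t. indicator {0..\<delta>} t * F (plane_proj n c x + t *\<^sub>R b) \<partial>lborel) \<partial>lborel)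
      = (\<integral>\<^sup>+x. \<integral>\<^sup>+t. G x t \<partial>lborel \<partial>lborel)"
    unfolding G_def by (subst nn_integral_cmult[symmetric]) (auto simp: mult_ac)
  also have "\<dots> = (\<integral>\<^sup>+t. \<integral>\<^sup>+x. G x t \<partial>lborel \<partial>lborel)"
    by (rule lborel_pair.Fubini'[OF Gm, symmetric])
  also have "\<dots> \<le> (\<integral>\<^sup>+t. \<integral>\<^sup>+x. G2 x t \<partial>lborel \<partial>lborel)"
  proof (rule nn_integral_mono)
    fix t :: real
    have "(\<integral>\<^sup>+x. G x t \<partial>lborel) = (\<integral>\<^sup>+x. G (- t *\<^sub>R b + x) t \<partial>lborel)"
      unfolding G_def by (rule nn_integral_lborel_translate[symmetric]) measurable
    also have "\<dots> \<le> (\<integral>\<^sup>+x. G2 x t \<partial>lborel)"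
    proof (rule nn_integral_mono)
      fix x
      have "plane_proj n c (- t *\<^sub>R b + x) + t *\<^sub>R b = plane_proj n c x + (t * ?\<beta>) *\<^sub>R n"
        by (simp add: plane_proj_def inner_simps algebra_simps)
      then have "G (- t *\<^sub>R b + x) t = indicator {0..\<delta>} t * G2 x t"
        by (simp add: G_def G2_def mult.assoc)
      then show "G (- t *\<^sub>R b + x) t \<le> G2 x t" by (simp add: indicator_def)
    qed
    finally show "(\<integral>\<^sup>+x. G x t \<partial>lborel) \<le> (\<integral>\<^sup>+x. G2 x t \<partial>lborel)" .
  qed
  also have "\<dots> = (\<integral>\<^sup>+x. \<integral>\<^sup>+t. G2 x t \<partial>lborel \<partial>lborel)"
    by (rule lborel_pair.Fubini'[OF G2m])
  also have "\<dots> = (\<integral>\<^sup>+x. ennreal (1 / \<bar>?\<beta>\<bar>) * (\<integral>\<^sup>+s. indicator {-1/2..1/2} s * F (s *\<^sub>R n + x) \<partial>lborel) \<partial>lborel)"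
  proof (rule nn_integral_cong)
    fix x
    have "(\<integral>\<^sup>+t. G2 x t \<partial>lborel) = ennreal \<bar>1 / ?\<beta>\<bar> * (\<integral>\<^sup>+s. G2 x ((n \<bullet> x - c) / ?\<beta> + (1 / ?\<beta>) * s) \<partial>lborel)"
      unfolding G2_def by (rule nn_integral_real_affine) (use b in auto)
    also have "(\<integral>\<^sup>+s. G2 x ((n \<bullet> x - c) / ?\<beta> + (1 / ?\<beta>) * s) \<partial>lborel)
        = (\<integral>\<^sup>+s. indicator {-1/2..1/2} s * F (s *\<^sub>R n + x) \<partial>lborel)"
    proof (rule nn_integral_cong)
      fix s
      define t where "t = (n \<bullet> x - c) / ?\<beta> + (1 / ?\<beta>) * s"
      have t: "t * ?\<beta> = n \<bullet> x - c + s" using b by (simp add: t_def field_simps)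
      have "plane_proj n c x + (t * ?\<beta>) *\<^sub>R n = s *\<^sub>R n + x"
        unfolding t by (simp add: plane_proj_def algebra_simps)
      moreover have "- t *\<^sub>R b + x \<in> slab n c \<longleftrightarrow> s \<in> {-1/2..1/2}"
      proof -
        have "n \<bullet> (- t *\<^sub>R b + x) - c = - s" using t by (simp add: inner_simps)
        then show ?thesis unfolding slab_def by (auto simp: abs_le_iff)
      qed
      ultimately show "G2 x ((n \<bullet> x - c) / ?\<beta> + (1 / ?\<beta>) * s) = indicator {-1/2..1/2} s * F (s *\<^sub>R n + x)"
        unfolding t_def[symmetric] G2_def by (simp add: indicator_def)
    qed
    finally show "(\<integral>\<^sup>+t. G2 x t \<partial>lborel)
        = ennreal (1 / \<bar>?\<beta>\<bar>) * (\<integral>\<^sup>+s. indicator {-1/2..1/2} s * F (s *\<^sub>R n + x) \<partial>lborel)"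
      by simp
  qed
  also have "\<dots> = ennreal (1 / \<bar>?\<beta>\<bar>) * (\<integral>\<^sup>+x. \<integral>\<^sup>+s. indicator {-1/2..1/2::real} s * F (s *\<^sub>R n + x) \<partial>lborel \<partial>lborel)"
    by (rule nn_integral_cmult) measurable
  also have "(\<integral>\<^sup>+x. \<integral>\<^sup>+s. indicator {-1/2..1/2::real} s * F (s *\<^sub>R n + x) \<partial>lborel \<partial>lborel)
      = (\<integral>\<^sup>+s. \<integral>\<^sup>+x. indicator {-1/2..1/2::real} s * F (s *\<^sub>R n + x) \<partial>lborel \<partial>lborel)"
    by (rule lborel_pair.Fubini'[symmetric]) measurable
  also have "\<dots> = (\<integral>\<^sup>+s. indicator {-1/2..1/2::real} s * (\<integral>\<^sup>+x. F x \<partial>lborel) \<partial>lborel)"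
  proof (rule nn_integral_cong)
    fix s :: real
    have "(\<integral>\<^sup>+x. indicator {-1/2..1/2} s * F (s *\<^sub>R n + x) \<partial>lborel)
        = indicator {-1/2..1/2} s * (\<integral>\<^sup>+x. F (s *\<^sub>R n + x) \<partial>lborel)"
      by (rule nn_integral_cmult) measurable
    then show "(\<integral>\<^sup>+x. indicator {-1/2..1/2} s * F (s *\<^sub>R n + x) \<partial>lborel)
        = indicator {-1/2..1/2} s * (\<integral>\<^sup>+x. F x \<partial>lborel)"
      unfolding nn_integral_lborel_translate[OF F] .
  qed
  also have "\<dots> = (\<integral>\<^sup>+s. indicator {-1/2..1/2::real} s \<partial>lborel) * (\<integral>\<^sup>+x. F x \<partial>lborel)"
    by (rule nn_integral_multc) simp
  also have "\<dots> = (\<integral>\<^sup>+x. F x \<partial>lborel)" by simp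
  finally show ?thesis .
qed

lemma norm_matrix_vector_mult_le:
  fixes A :: "real^'n^'m"
  shows "norm (A *v b) \<le> norm A * norm b"
proof -
  have "(norm (A *v b))\<^sup>2 = (\<Sum>i\<in>UNIV. (A $ i \<bullet> b)\<^sup>2)"
    by (simp add: norm_vec_def L2_set_def sum_nonneg matrix_vector_mult_def inner_vec_def)
  also have "\<dots> \<le> (\<Sum>i\<in>UNIV. (norm (A $ i))\<^sup>2 * (norm b)\<^sup>2)"
  proof (rule sum_mono)
    fix i
    show "(A $ i \<bullet> b)\<^sup>2 \<le> (norm (A $ i))\<^sup>2 * (norm b)\<^sup>2"
      using power_mono[OF Cauchy_Schwarz_ineq2[of "A $ i" b] abs_ge_zero, of 2]
      by (simp add: power_mult_distrib)
  qed
  also have "\<dots> = (norm A)\<^sup>2 * (norm b)\<^sup>2"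
    by (simp add: sum_distrib_right norm_vec_def[of A] L2_set_def sum_nonneg)
  finally have "(norm (A *v b))\<^sup>2 \<le> (norm A * norm b)\<^sup>2" by (simp add: power_mult_distrib)
  then show ?thesis by (rule power2_le_imp_le) simp
qed

text \<open>The one-dimensional inequality on the segment in direction \<open>b\<close> from each point of \<open>E\<close>, integrated
  over the slab that defines the measure of the hyperplane.\<close>

lemma trace_inequality_segments:
  fixes \<phi> :: "real^'d \<Rightarrow> real^'d"
  assumes \<phi>: "smooth \<phi>" and n: "norm n = 1" and b: "n \<bullet> b \<noteq> 0" and \<delta>: "0 < \<delta>"
    and E [measurable]: "E \<in> sets borel" and K [measurable]: "K \<in> sets borel"
    and seg: "\<And>y t. y \<in> E \<Longrightarrow> t \<in> {0..\<delta>} \<Longrightarrow> y + t *\<^sub>R b \<in> K"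
  shows "(\<integral>\<^sup>+y. ennreal ((norm (\<phi> y))\<^sup>2) * indicator E y \<partial>hyperplane_measure {x. n \<bullet> x = c})
    \<le> ennreal ((1/\<delta> + 1 + (norm b)\<^sup>2) / \<bar>n \<bullet> b\<bar>)
      * (\<integral>\<^sup>+x. ennreal ((norm (\<phi> x))\<^sup>2 + (norm (jacobian \<phi> (at x)))\<^sup>2) * indicator K x \<partial>lborel)"
proof -
  let ?M = "1/\<delta> + 1 + (norm b)\<^sup>2"
  have [measurable]: "\<phi> \<in> borel_measurable borel" "(\<lambda>x. jacobian \<phi> (at x)) \<in> borel_measurable borel"
    using borel_measurable_continuous_onI[OF smooth_continuous_on[OF \<phi>]]
      borel_measurable_continuous_onI[OF continuous_on_jacobian[OF \<phi>]] by simp_all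
  define Q where "Q x = ennreal ((norm (\<phi> x))\<^sup>2 + (norm (jacobian \<phi> (at x)))\<^sup>2) * indicator K x" for x
  have [measurable]: "Q \<in> borel_measurable borel" unfolding Q_def by measurable
  have pt: "ennreal ((norm (\<phi> y))\<^sup>2) \<le> (\<integral>\<^sup>+t. indicator {0..\<delta>} t * (ennreal ?M * Q (y + t *\<^sub>R b)) \<partial>lborel)"
    if y: "y \<in> E" for y
  proof -
    have "((\<lambda>t. \<phi> (y + t *\<^sub>R b)) has_vector_derivative (jacobian \<phi> (at (y + t *\<^sub>R b)) *v b)) (at t)" for t
    proof -
      have "((\<lambda>s. y + s *\<^sub>R b) has_derivative (\<lambda>s. s *\<^sub>R b)) (at t)"
        by (auto intro!: derivative_eq_intros)
      from has_derivative_compose[OF this smooth_has_derivative[OF \<phi>]]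
      show ?thesis
        unfolding has_vector_derivative_def frechet_derivative_jacobian[OF \<phi>]
        by (simp add: matrix_vector_mult_scaleR)
    qed
    moreover have "continuous_on UNIV (\<lambda>t. jacobian \<phi> (at (y + t *\<^sub>R b)) *v b)"
    proof -
      have "continuous_on UNIV (\<lambda>t. jacobian \<phi> (at (y + t *\<^sub>R b)))"
        by (rule continuous_on_compose2[OF continuous_on_jacobian[OF \<phi>, of UNIV]])
           (auto intro!: continuous_intros)
      then show ?thesis
        unfolding matrix_vector_mult_def
        by (intro continuous_on_vec_lambda continuous_on_sum continuous_on_mult continuous_on_component continuous_on_const)
    qed
    ultimately have "ennreal ((norm (\<phi> (y + 0 *\<^sub>R b)))\<^sup>2)
      \<le> (\<integral>\<^sup>+t. ennreal ((1/\<delta> + 1) * (norm (\<phi> (y + t *\<^sub>R b)))\<^sup>2 + (norm (jacobian \<phi> (at (y + t *\<^sub>R b)) *v b))\<^sup>2) * indicator {0..\<delta>} t \<partial>lborel)"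
      using trace_inequality_interval[of "\<lambda>t. \<phi> (y + t *\<^sub>R b)" "\<lambda>t. jacobian \<phi> (at (y + t *\<^sub>R b)) *v b" \<delta>] \<delta> by blast
    also have "\<dots> \<le> (\<integral>\<^sup>+t. indicator {0..\<delta>} t * (ennreal ?M * Q (y + t *\<^sub>R b)) \<partial>lborel)"
    proof (rule nn_integral_mono)
      fix t
      let ?x = "y + t *\<^sub>R b"
      have "(norm (jacobian \<phi> (at ?x) *v b))\<^sup>2 \<le> (norm b)\<^sup>2 * (norm (jacobian \<phi> (at ?x)))\<^sup>2"
        using power_mono[OF norm_matrix_vector_mult_le, of "jacobian \<phi> (at ?x)" b 2]
        by (simp add: power_mult_distrib mult.commute)
      moreover have "0 \<le> (norm b)\<^sup>2 * (norm (\<phi> ?x))\<^sup>2" "0 \<le> (1/\<delta> + 1) * (norm (jacobian \<phi> (at ?x)))\<^sup>2"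
        using \<delta> by auto
      ultimately have "(1/\<delta> + 1) * (norm (\<phi> ?x))\<^sup>2 + (norm (jacobian \<phi> (at ?x) *v b))\<^sup>2
          \<le> ?M * ((norm (\<phi> ?x))\<^sup>2 + (norm (jacobian \<phi> (at ?x)))\<^sup>2)"
        unfolding distrib_left distrib_right by linarith
      then have "ennreal ((1/\<delta> + 1) * (norm (\<phi> ?x))\<^sup>2 + (norm (jacobian \<phi> (at ?x) *v b))\<^sup>2)
          \<le> ennreal (?M * ((norm (\<phi> ?x))\<^sup>2 + (norm (jacobian \<phi> (at ?x)))\<^sup>2))"
        by (rule ennreal_leI)
      also have "\<dots> = ennreal ?M * ennreal ((norm (\<phi> ?x))\<^sup>2 + (norm (jacobian \<phi> (at ?x)))\<^sup>2)"
        by (rule ennreal_mult) (use \<delta> in auto)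
      finally have "ennreal ((1/\<delta> + 1) * (norm (\<phi> ?x))\<^sup>2 + (norm (jacobian \<phi> (at ?x) *v b))\<^sup>2)
          \<le> ennreal ?M * ennreal ((norm (\<phi> ?x))\<^sup>2 + (norm (jacobian \<phi> (at ?x)))\<^sup>2)" .
      then show "ennreal ((1/\<delta> + 1) * (norm (\<phi> ?x))\<^sup>2 + (norm (jacobian \<phi> (at ?x) *v b))\<^sup>2) * indicator {0..\<delta>} t
          \<le> indicator {0..\<delta>} t * (ennreal ?M * Q ?x)"
        using seg[OF y, of t] unfolding Q_def by (cases "t \<in> {0..\<delta>}") auto
    qed
    finally show ?thesis by simp
  qed
  have "(\<integral>\<^sup>+y. ennreal ((norm (\<phi> y))\<^sup>2) * indicator E y \<partial>hyperplane_measure {x. n \<bullet> x = c})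
      = (\<integral>\<^sup>+x. (ennreal ((norm (\<phi> (plane_proj n c x)))\<^sup>2) * indicator E (plane_proj n c x)) * indicator (slab n c) x \<partial>lborel)"
    by (rule nn_integral_hyperplane_measure[OF n]) measurable
  also have "\<dots> \<le> (\<integral>\<^sup>+x. indicator (slab n c) x * (\<integral>\<^sup>+t. indicator {0..\<delta>} t * (ennreal ?M * Q (plane_proj n c x + t *\<^sub>R b)) \<partial>lborel) \<partial>lborel)"
  proof (rule nn_integral_mono)
    fix x
    show "(ennreal ((norm (\<phi> (plane_proj n c x)))\<^sup>2) * indicator E (plane_proj n c x)) * indicator (slab n c) x
      \<le> indicator (slab n c) x * (\<integral>\<^sup>+t. indicator {0..\<delta>} t * (ennreal ?M * Q (plane_proj n c x + t *\<^sub>R b)) \<partial>lborel)"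
      using pt[of "plane_proj n c x"]
      by (cases "plane_proj n c x \<in> E"; cases "x \<in> slab n c") auto
  qed
  also have "\<dots> \<le> ennreal (1 / \<bar>n \<bullet> b\<bar>) * (\<integral>\<^sup>+x. ennreal ?M * Q x \<partial>lborel)"
    by (rule nn_integral_slab_segments_le[OF n b]) measurable
  also have "(\<integral>\<^sup>+x. ennreal ?M * Q x \<partial>lborel) = ennreal ?M * (\<integral>\<^sup>+x. Q x \<partial>lborel)"
    by (rule nn_integral_cmult) simp
  also have "ennreal (1 / \<bar>n \<bullet> b\<bar>) * (ennreal ?M * (\<integral>\<^sup>+x. Q x \<partial>lborel)) = ennreal (?M / \<bar>n \<bullet> b\<bar>) * (\<integral>\<^sup>+x. Q x \<partial>lborel)"
  proof -
    have "ennreal (1 / \<bar>n \<bullet> b\<bar>) * ennreal ?M = ennreal (1 / \<bar>n \<bullet> b\<bar> * ?M)"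
      by (rule ennreal_mult[symmetric]) (use \<delta> in auto)
    then show ?thesis by (simp only: mult.assoc[symmetric]) simp
  qed
  finally show ?thesis unfolding Q_def .
qed


lemma simplex_facet_cases:
  fixes K :: "(real^'d) set"
  assumes "int CARD('d) simplex K" "E facet_of K"
  obtains C a where "finite C" "\<not> affine_dependent C" "card C = CARD('d) + 1" "K = convex hull C"
    "a \<in> C" "E = convex hull (C - {a})"
proof -
  obtain C where C: "\<not> affine_dependent C" "int (card C) = int CARD('d) + 1" "K = convex hull C"
    using assms(1) unfolding simplex_def by blast
  then obtain a where "a \<in> C" "E = convex hull (C - {a})"
    using facet_of_convex_hull_affine_independent[OF C(1), of E] assms(2) by blast
  then show thesis using that[of C a] C aff_independent_finite[OF C(1)] by simp
qed

lemma facet_hyperplane: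
  fixes K :: "(real^'d) set"
  assumes "int CARD('d) simplex K" "E facet_of K"
  shows "is_hyperplane (affine hull E)"
  using assms aff_dim_simplex[OF assms(1)] by (simp add: is_hyperplane_def facet_of_def)

lemma facet_polytope:
  assumes "n simplex K" "E facet_of K" shows "polytope E"
  using assms simplex_imp_polytope face_of_polytope_polytope facet_of_imp_face_of by blast

text \<open>Some barycentric coordinate of a point of the facet opposite to \<open>a\<close> is at least \<open>1 / d\<close>. Moving
  parallel to the edge from that vertex to \<open>a\<close>, one can stay in the simplex for a time \<open>1 / d\<close>.\<close>

lemma simplex_facet_segment:
  fixes C :: "(real^'d) set"
  assumes C: "finite C" "card C = CARD('d) + 1" "a \<in> C" and y: "y \<in> convex hull (C - {a})"
  obtains v where "v \<in> C - {a}"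
    "\<And>t. t \<in> {0..1 / real CARD('d)} \<Longrightarrow> y + t *\<^sub>R (a - v) \<in> convex hull C"
proof -
  let ?D = "C - {a}"
  have D: "finite ?D" "card ?D = CARD('d)" using C by auto
  obtain u where u: "\<And>x. x \<in> ?D \<Longrightarrow> 0 \<le> u x" "sum u ?D = 1" "(\<Sum>x\<in>?D. u x *\<^sub>R x) = y"
    using y unfolding convex_hull_finite[OF D(1)] by blast
  have "\<exists>v\<in>?D. 1 / real CARD('d) \<le> u v"
  proof (rule ccontr)
    assume "\<not> ?thesis"
    then have lt: "u x < 1 / real CARD('d)" if "x \<in> ?D" for x
      using that by (simp add: not_le)
    have "?D \<noteq> {}"
    proof
      assume "?D = {}"
      then have "card ?D = 0" by (simp only: card.empty)
      then show False using D(2) by simp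
    qed
    with D(1) have "sum u ?D < (\<Sum>x\<in>?D. 1 / real CARD('d))" using lt by (rule sum_strict_mono)
    then show False using u(2) D by simp
  qed
  then obtain v where v: "v \<in> ?D" "1 / real CARD('d) \<le> u v" by blast
  have "y + t *\<^sub>R (a - v) \<in> convex hull C" if t: "t \<in> {0..1 / real CARD('d)}" for t
  proof -
    \<comment> \<open>The weight \<open>t\<close> is transferred from \<open>v\<close> to \<open>a\<close>.\<close>
    define w where "w x = (if x = a then t else u x - (if x = v then t else 0))" for x
    have sumD: "(\<Sum>x\<in>?D. w x) = (\<Sum>x\<in>?D. u x - (if x = v then t else 0))"
      "(\<Sum>x\<in>?D. w x *\<^sub>R x) = (\<Sum>x\<in>?D. u x *\<^sub>R x - (if x = v then t *\<^sub>R x else 0))"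
      by (rule sum.cong[OF refl]; simp add: w_def algebra_simps)+
    have "w x \<ge> 0" if "x \<in> C" for x
      using that t v u(1)[of x] by (auto simp: w_def)
    moreover have "sum w C = 1"
      using v u(2) D unfolding sum.remove[OF C(1,3)] sumD by (simp add: sum_subtractf w_def)
    moreover have "(\<Sum>x\<in>C. w x *\<^sub>R x) = y + t *\<^sub>R (a - v)"
      using v u(3) D unfolding sum.remove[OF C(1,3)] sumD
      by (simp add: sum_subtractf w_def algebra_simps)
    ultimately show ?thesis unfolding convex_hull_finite[OF C(1)] by blast
  qed
  with v(1) show thesis by (rule that)
qed

text \<open>The facet is covered by finitely many closed pieces \<open>Ev v\<close>, one for each of its vertices \<open>v\<close>, such
  that the segments in the fixed direction \<open>a - v\<close> from the points of \<open>Ev v\<close> stay in \<open>K\<close>.\<close>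

lemma trace_inequality_facet:
  fixes K :: "(real^'d) set"
  assumes K: "int CARD('d) simplex K" and E: "E facet_of K"
  shows "\<exists>M\<ge>0. \<forall>\<phi> :: real^'d \<Rightarrow> real^'d. smooth \<phi> \<longrightarrow>
    (\<integral>\<^sup>+y. ennreal ((norm (\<phi> y))\<^sup>2) \<partial>surface_measure E)
      \<le> ennreal M * (\<integral>\<^sup>+x. ennreal ((norm (\<phi> x))\<^sup>2 + (norm (jacobian \<phi> (at x)))\<^sup>2) * indicator K x \<partial>lborel)"
proof -
  obtain C a where C: "finite C" "\<not> affine_dependent C" "card C = CARD('d) + 1" "K = convex hull C"
    "a \<in> C" "E = convex hull (C - {a})"
    using simplex_facet_cases[OF K E] .
  let ?D = "C - {a}" and ?\<delta> = "1 / real CARD('d)"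
  have H: "is_hyperplane (affine hull E)" by (rule facet_hyperplane[OF K E])
  have EH: "E \<subseteq> affine hull E" by (rule hull_subset)
  obtain n c where n: "norm n = 1" and Hn: "affine hull E = {x. n \<bullet> x = c}" using hyperplane_normal_form[OF H] .
  have cE: "compact E" unfolding C(6) by (rule finite_imp_compact_convex_hull) (use C in auto)
  have cK: "compact K" unfolding C(4) by (rule finite_imp_compact_convex_hull[OF C(1)])
  have Eb: "E \<in> sets borel" and Kb: "K \<in> sets borel" using borel_compact cE cK by blast+
  have "a \<notin> affine hull ?D" using C(2,5) unfolding affine_dependent_def by blast
  then have na: "n \<bullet> a \<noteq> c" using Hn unfolding C(6) affine_hull_convex_hull by blast
  have nv: "n \<bullet> (a - v) \<noteq> 0" if "v \<in> ?D" for v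
  proof -
    have "v \<in> affine hull E" unfolding C(6) affine_hull_convex_hull using that by (rule hull_inc)
    then have "n \<bullet> v = c" unfolding Hn by simp
    then show ?thesis using na by (simp add: inner_diff_right)
  qed
  define Ev where "Ev v = E \<inter> (\<Inter>t\<in>{0..?\<delta>}. (\<lambda>y. y + t *\<^sub>R (a - v)) -` K)" for v
  have Evb: "Ev v \<in> sets borel" for v
  proof -
    have "closed ((\<lambda>y. y + t *\<^sub>R (a - v)) -` K)" for t
      by (rule continuous_closed_vimage[OF compact_imp_closed[OF cK]]) (intro continuous_intros)
    then have "closed (Ev v)" unfolding Ev_def using compact_imp_closed[OF cE] by (intro closed_Int closed_INT) auto
    then show ?thesis by (rule borel_closed)
  qed
  have cover: "\<exists>v\<in>?D. y \<in> Ev v" if "y \<in> E" for y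
  proof -
    obtain v where "v \<in> ?D" "\<And>t. t \<in> {0..?\<delta>} \<Longrightarrow> y + t *\<^sub>R (a - v) \<in> convex hull C"
      using simplex_facet_segment[OF C(1,3,5), of y] \<open>y \<in> E\<close> C(6) by blast
    then show ?thesis using \<open>y \<in> E\<close> C(4) unfolding Ev_def by blast
  qed
  define m where "m v = (1/?\<delta> + 1 + (norm (a - v))\<^sup>2) / \<bar>n \<bullet> (a - v)\<bar>" for v
  have m0: "0 \<le> m v" for v unfolding m_def by simp
  show ?thesis
  proof (intro exI[of _ "sum m ?D"] conjI allI impI)
    show "0 \<le> sum m ?D" using m0 by (rule sum_nonneg)
    fix \<phi> :: "real^'d \<Rightarrow> real^'d" assume \<phi>: "smooth \<phi>"
    have [measurable]: "\<phi> \<in> borel_measurable borel"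
      using borel_measurable_continuous_onI[OF smooth_continuous_on[OF \<phi>]] .
    note Evb [measurable]
    let ?I = "\<integral>\<^sup>+x. ennreal ((norm (\<phi> x))\<^sup>2 + (norm (jacobian \<phi> (at x)))\<^sup>2) * indicator K x \<partial>lborel"
    have "(\<integral>\<^sup>+y. ennreal ((norm (\<phi> y))\<^sup>2) \<partial>surface_measure E)
        = (\<integral>\<^sup>+y. ennreal ((norm (\<phi> y))\<^sup>2) * indicator E y \<partial>hyperplane_measure (affine hull E))"
      by (rule nn_integral_surface_measure_flat[OF H EH Eb]) measurable
    also have "\<dots> \<le> (\<integral>\<^sup>+y. (\<Sum>v\<in>?D. ennreal ((norm (\<phi> y))\<^sup>2) * indicator (Ev v) y) \<partial>hyperplane_measure (affine hull E))"
    proof (rule nn_integral_mono)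
      fix y
      show "ennreal ((norm (\<phi> y))\<^sup>2) * indicator E y \<le> (\<Sum>v\<in>?D. ennreal ((norm (\<phi> y))\<^sup>2) * indicator (Ev v) y)"
      proof (cases "y \<in> E")
        case True
        then obtain v where v: "v \<in> ?D" "y \<in> Ev v" using cover by blast
        have "ennreal ((norm (\<phi> y))\<^sup>2) * indicator (Ev v) y \<le> (\<Sum>v\<in>?D. ennreal ((norm (\<phi> y))\<^sup>2) * indicator (Ev v) y)"
          by (rule member_le_sum[OF v(1)]) (use C(1) in auto)
        then show ?thesis using v(2) True by simp
      qed simp
    qed
    also have "\<dots> = (\<Sum>v\<in>?D. \<integral>\<^sup>+y. ennreal ((norm (\<phi> y))\<^sup>2) * indicator (Ev v) y \<partial>hyperplane_measure (affine hull E))"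
      by (rule nn_integral_sum) measurable
    also have "\<dots> \<le> (\<Sum>v\<in>?D. ennreal (m v) * ?I)"
    proof (rule sum_mono)
      fix v assume v: "v \<in> ?D"
      show "(\<integral>\<^sup>+y. ennreal ((norm (\<phi> y))\<^sup>2) * indicator (Ev v) y \<partial>hyperplane_measure (affine hull E)) \<le> ennreal (m v) * ?I"
        unfolding Hn m_def
      proof (rule trace_inequality_segments[OF \<phi> n nv[OF v] _ Evb Kb])
        show "y + t *\<^sub>R (a - v) \<in> K" if "y \<in> Ev v" "t \<in> {0..?\<delta>}" for y t
          using that unfolding Ev_def by blast
      qed simp
    qed
    also have "\<dots> = (\<Sum>v\<in>?D. ennreal (m v)) * ?I" by (rule sum_distrib_right[symmetric])
    also have "(\<Sum>v\<in>?D. ennreal (m v)) = ennreal (sum m ?D)" by (rule sum_ennreal) (rule m0)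
    finally show "(\<integral>\<^sup>+y. ennreal ((norm (\<phi> y))\<^sup>2) \<partial>surface_measure E) \<le> ennreal (sum m ?D) * ?I" .
  qed
qed

lemma simplex_facts:
  fixes K :: "(real^'d) set"
  assumes "int CARD('d) simplex K"
  shows "compact K" "convex K" "K \<in> sets borel" "interior K \<in> sets lebesgue" "bounded (interior K)"
proof -
  show c: "compact K" using assms simplex_imp_polytope polytope_imp_compact by blast
  show "convex K" using assms simplex_imp_polytope polytope_imp_convex by blast
  show "K \<in> sets borel" using c by (rule borel_compact)
  show "interior K \<in> sets lebesgue" by simp
  show "bounded (interior K)" using compact_imp_bounded[OF c] interior_subset by (rule bounded_subset)
qed

lemma nn_integral_interior_convex:
  fixes K :: "'a::euclidean_space set"
  assumes K: "convex K" and f: "f \<in> borel_measurable borel"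
  shows "(\<integral>\<^sup>+x. f x * indicator K x \<partial>lborel) = (\<integral>\<^sup>+x. f x \<partial>lebesgue_on (interior K))"
proof -
  have "AE x in lebesgue. x \<notin> frontier K"
    using negligible_convex_frontier[OF K] by (intro AE_not_in) (simp add: negligible_iff_null_sets)
  then have "AE x in lborel. x \<notin> frontier K" by (simp add: AE_lebesgue_iff_lborel)
  then have "AE x in lborel. f x * indicator K x = f x * indicator (interior K) x"
  proof eventually_elim
    case (elim x)
    then show ?case
      using interior_subset[of K] closure_subset[of K] by (auto simp: frontier_def indicator_def)
  qed
  then have "(\<integral>\<^sup>+x. f x * indicator K x \<partial>lborel) = (\<integral>\<^sup>+x. f x * indicator (interior K) x \<partial>lborel)"
    by (rule nn_integral_cong_AE)
  also have "\<dots> = (\<integral>\<^sup>+x. f x * indicator (interior K) x \<partial>lebesgue)"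
    by (rule nn_integral_completion[symmetric])
  also have "\<dots> = (\<integral>\<^sup>+x. f x \<partial>lebesgue_on (interior K))"
    by (rule nn_integral_restrict_space[symmetric]) simp
  finally show ?thesis .
qed

lemma L2_norm_squared_subset:
  fixes f :: "'a::euclidean_space \<Rightarrow> 'b::euclidean_space"
  assumes "V \<subseteq> U" "V \<in> sets lebesgue" "U \<in> sets lebesgue" and f: "square_integrable (lebesgue_on U) f"
  shows "(L2_norm (lebesgue_on V) f)\<^sup>2 \<le> (L2_norm (lebesgue_on U) f)\<^sup>2"
proof -
  have "ennreal ((L2_norm (lebesgue_on V) f)\<^sup>2) = (\<integral>\<^sup>+x. ennreal ((norm (f x))\<^sup>2) * indicator V x \<partial>lebesgue)"
    unfolding L2_norm_squared_nn_integral[OF L2_subset[OF assms]]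
    by (rule nn_integral_restrict_space) (use assms(2) in simp)
  also have "\<dots> \<le> (\<integral>\<^sup>+x. ennreal ((norm (f x))\<^sup>2) * indicator U x \<partial>lebesgue)"
    by (rule nn_integral_mono, rule mult_left_mono) (use assms(1) in \<open>auto simp: indicator_def\<close>)
  also have "\<dots> = ennreal ((L2_norm (lebesgue_on U) f)\<^sup>2)"
    unfolding L2_norm_squared_nn_integral[OF f]
    by (rule nn_integral_restrict_space[symmetric]) (use assms(3) in simp)
  finally show ?thesis by simp
qed

lemma trace_inequality:
  fixes K :: "(real^'d) set"
  assumes K: "int CARD('d) simplex K" and E: "E facet_of K"
  obtains M where "0 \<le> M"
    "\<And>\<phi> :: real^'d \<Rightarrow> real^'d. smooth \<phi> \<Longrightarrow> square_integrable (surface_measure E) \<phi> \<Longrightarrow>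
      (L2_norm (surface_measure E) \<phi>)\<^sup>2
        \<le> M * ((L2_norm (lebesgue_on (interior K)) \<phi>)\<^sup>2
                + (L2_norm (lebesgue_on (interior K)) (\<lambda>x. jacobian \<phi> (at x)))\<^sup>2)"
proof -
  note Kf = simplex_facts[OF K]
  obtain M where M: "0 \<le> M" "\<And>\<phi> :: real^'d \<Rightarrow> real^'d. smooth \<phi> \<Longrightarrow>
    (\<integral>\<^sup>+y. ennreal ((norm (\<phi> y))\<^sup>2) \<partial>surface_measure E)
      \<le> ennreal M * (\<integral>\<^sup>+x. ennreal ((norm (\<phi> x))\<^sup>2 + (norm (jacobian \<phi> (at x)))\<^sup>2) * indicator K x \<partial>lborel)"
    using trace_inequality_facet[OF K E] by blast
  show thesis
  proof (rule that[OF M(1)])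
    fix \<phi> :: "real^'d \<Rightarrow> real^'d" assume \<phi>: "smooth \<phi>" and sq: "square_integrable (surface_measure E) \<phi>"
    let ?N = "lebesgue_on (interior K)"
    have c: "continuous_on UNIV \<phi>" "continuous_on UNIV (\<lambda>x. jacobian \<phi> (at x))"
      by (rule smooth_continuous_on[OF \<phi>]) (rule continuous_on_jacobian[OF \<phi>])
    have s: "square_integrable ?N \<phi>" "square_integrable ?N (\<lambda>x. jacobian \<phi> (at x))"
      by (rule L2_continuous[OF c(1) Kf(5,4)]) (rule L2_continuous[OF c(2) Kf(5,4)])
    have m [measurable]: "\<phi> \<in> borel_measurable borel" "(\<lambda>x. jacobian \<phi> (at x)) \<in> borel_measurable borel"
      using borel_measurable_continuous_onI[OF c(1)] borel_measurable_continuous_onI[OF c(2)] by simp_all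
    note sm [measurable] = L2D(1)[OF s(1)] L2D(1)[OF s(2)]
    have "(\<integral>\<^sup>+x. ennreal ((norm (\<phi> x))\<^sup>2 + (norm (jacobian \<phi> (at x)))\<^sup>2) * indicator K x \<partial>lborel)
        = (\<integral>\<^sup>+x. ennreal ((norm (\<phi> x))\<^sup>2 + (norm (jacobian \<phi> (at x)))\<^sup>2) \<partial>?N)"
      by (rule nn_integral_interior_convex[OF Kf(2)]) measurable
    also have "\<dots> = (\<integral>\<^sup>+x. ennreal ((norm (\<phi> x))\<^sup>2) + ennreal ((norm (jacobian \<phi> (at x)))\<^sup>2) \<partial>?N)"
      by simp
    also have "\<dots> = (\<integral>\<^sup>+x. ennreal ((norm (\<phi> x))\<^sup>2) \<partial>?N) + (\<integral>\<^sup>+x. ennreal ((norm (jacobian \<phi> (at x)))\<^sup>2) \<partial>?N)"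
      by (rule nn_integral_add) measurable
    also have "\<dots> = ennreal ((L2_norm ?N \<phi>)\<^sup>2 + (L2_norm ?N (\<lambda>x. jacobian \<phi> (at x)))\<^sup>2)"
      using s by (simp add: L2_norm_squared_nn_integral)
    finally have I: "(\<integral>\<^sup>+x. ennreal ((norm (\<phi> x))\<^sup>2 + (norm (jacobian \<phi> (at x)))\<^sup>2) * indicator K x \<partial>lborel)
        = ennreal ((L2_norm ?N \<phi>)\<^sup>2 + (L2_norm ?N (\<lambda>x. jacobian \<phi> (at x)))\<^sup>2)" .
    have "ennreal ((L2_norm (surface_measure E) \<phi>)\<^sup>2)
        \<le> ennreal M * ennreal ((L2_norm ?N \<phi>)\<^sup>2 + (L2_norm ?N (\<lambda>x. jacobian \<phi> (at x)))\<^sup>2)"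
      using M(2)[OF \<phi>] unfolding I L2_norm_squared_nn_integral[OF sq] .
    also have "\<dots> = ennreal (M * ((L2_norm ?N \<phi>)\<^sup>2 + (L2_norm ?N (\<lambda>x. jacobian \<phi> (at x)))\<^sup>2))"
      by (rule ennreal_mult[symmetric]) (use M(1) in auto)
    finally show "(L2_norm (surface_measure E) \<phi>)\<^sup>2
        \<le> M * ((L2_norm ?N \<phi>)\<^sup>2 + (L2_norm ?N (\<lambda>x. jacobian \<phi> (at x)))\<^sup>2)"
      using M(1) by (subst (asm) ennreal_le_iff) auto
  qed
qed

section \<open>Traces\<close>

lemma L2_surface_continuous:
  fixes \<phi> :: "'a::euclidean_space \<Rightarrow> 'b::euclidean_space"
  assumes S: "finite (charged_hyperplanes S)" "bounded S" "S \<in> sets borel" and \<phi>: "continuous_on UNIV \<phi>"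
  shows "square_integrable (surface_measure S) \<phi>"
proof -
  obtain B where B: "\<And>x. x \<in> S \<Longrightarrow> norm (\<phi> x) \<le> B" using continuous_bounded_on[OF \<phi> S(2)] by blast
  interpret finite_measure "surface_measure S" by (rule finite_measure_surface_measure[OF S])
  have "emeasure (surface_measure S) (- S) = 0"
    using S(3) by (simp add: emeasure_surface_measure)
  then have "AE x in surface_measure S. x \<notin> - S"
    by (intro AE_not_in) (use S(3) in \<open>auto simp: null_sets_def\<close>)
  then have "AE x in surface_measure S. (norm (\<phi> x))\<^sup>2 \<le> B\<^sup>2"
    by eventually_elim (simp add: B power_mono)
  moreover have "\<phi> \<in> borel_measurable (surface_measure S)"
    using borel_measurable_continuous_onI[OF \<phi>] by (simp cong: measurable_cong_sets)
  ultimately show ?thesis by (intro L2_dominated[where g = "\<lambda>x. B\<^sup>2"]) simp_all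
qed

lemma facet_facts:
  fixes K :: "(real^'d) set"
  assumes K: "int CARD('d) simplex K" and E: "E facet_of K"
  shows "finite (charged_hyperplanes E)" "bounded E" "E \<in> sets borel"
proof -
  have c: "compact E" using facet_polytope[OF K E] by (rule polytope_imp_compact)
  show "bounded E" "E \<in> sets borel" using c by (auto intro: compact_imp_bounded borel_compact)
  show "finite (charged_hyperplanes E)"
    using charged_hyperplanes_flat[OF facet_hyperplane[OF K E] hull_subset] by (rule finite_subset) simp
qed

text \<open>Approximation in \<open>H\<^sup>1\<close> by smooth fields, as in the definition of traces but without reference to
  boundary values, so that one sequence can be used on several simplices and faces.\<close>

definition H1_approx ::
  "(real^'d) set \<Rightarrow> (real^'d \<Rightarrow> real^'d) \<Rightarrow> (nat \<Rightarrow> real^'d \<Rightarrow> real^'d) \<Rightarrow> bool" where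
  "H1_approx U v \<phi> \<longleftrightarrow> v \<in> H1 U \<and> (\<forall>n. smooth (\<phi> n)) \<and>
     (\<lambda>n. L2_norm (lebesgue_on U) (\<lambda>x. \<phi> n x - v x)) \<longlonglongrightarrow> 0 \<and>
     (\<lambda>n. L2_norm (lebesgue_on U) (\<lambda>x. jacobian (\<phi> n) (at x) - weak_grad U v x)) \<longlonglongrightarrow> 0"

lemma H1_approxD:
  assumes "H1_approx U v \<phi>"
  shows "v \<in> H1 U" "\<And>n. smooth (\<phi> n)"
    "(\<lambda>n. L2_norm (lebesgue_on U) (\<lambda>x. \<phi> n x - v x)) \<longlonglongrightarrow> 0"
    "(\<lambda>n. L2_norm (lebesgue_on U) (\<lambda>x. jacobian (\<phi> n) (at x) - weak_grad U v x)) \<longlonglongrightarrow> 0"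
  using assms by (simp_all add: H1_approx_def)

lemma has_trace_iff:
  "has_trace U S v g \<longleftrightarrow> square_integrable (surface_measure S) g \<and>
     (\<exists>\<phi>. H1_approx U v \<phi> \<and> (\<lambda>n. L2_norm (surface_measure S) (\<lambda>x. \<phi> n x - g x)) \<longlonglongrightarrow> 0)"
  unfolding has_trace_def H1_approx_def by (rule iffI; elim exE conjE; intro exI conjI; assumption)

lemma H1_L2:
  assumes "v \<in> H1 U"
  shows "square_integrable (lebesgue_on U) v" "square_integrable (lebesgue_on U) (weak_grad U v)"
  using is_weak_grad_weak_grad[OF assms] assms by (auto simp: H1_def is_weak_grad_def)

lemma smooth_L2:
  fixes \<phi> :: "real^'d \<Rightarrow> real^'d"
  assumes "smooth \<phi>" "open U" "bounded U"
  shows "square_integrable (lebesgue_on U) \<phi>" "square_integrable (lebesgue_on U) (\<lambda>x. jacobian \<phi> (at x))"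
  by (rule L2_continuous[OF smooth_continuous_on[OF assms(1)]]; use assms in simp)
     (rule L2_continuous[OF continuous_on_jacobian[OF assms(1)]]; use assms in simp)

lemma H1_diff:
  fixes v w :: "real^'d \<Rightarrow> real^'d"
  assumes U: "open U" "bounded U" and v: "v \<in> H1 U" and w: "w \<in> H1 U"
  shows "(\<lambda>x. v x - w x) \<in> H1 U"
    "AE x in lebesgue_on U. weak_grad U (\<lambda>x. v x - w x) x = weak_grad U v x - weak_grad U w x"
proof -
  note sv = H1_L2[OF v] and sw = H1_L2[OF w]
  have "is_weak_grad U (\<lambda>x. v x - w x) (\<lambda>x. weak_grad U v x - weak_grad U w x)"
    by (rule is_weak_grad_diff[OF U sv(1) is_weak_grad_weak_grad[OF v] sw(1) is_weak_grad_weak_grad[OF w]])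
  from weak_grad_unique[OF U L2_diff[OF sv(1) sw(1)] this]
  show "(\<lambda>x. v x - w x) \<in> H1 U"
    "AE x in lebesgue_on U. weak_grad U (\<lambda>x. v x - w x) x = weak_grad U v x - weak_grad U w x" .
qed

lemma H1_approx_diff:
  fixes v w :: "real^'d \<Rightarrow> real^'d"
  assumes U: "open U" "bounded U" and v: "H1_approx U v \<phi>" and w: "H1_approx U w \<psi>"
  shows "H1_approx U (\<lambda>x. v x - w x) (\<lambda>n x. \<phi> n x - \<psi> n x)"
proof -
  note V = H1_approxD[OF v] and W = H1_approxD[OF w]
  note sv = H1_L2[OF V(1)] and sw = H1_L2[OF W(1)]
  note D = H1_diff[OF U V(1) W(1)]
  have sd: "smooth (\<lambda>x. \<phi> n x - \<psi> n x)" for n by (rule smooth_diff[OF V(2) W(2)])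
  note s\<phi> = smooth_L2[OF V(2) U] and s\<psi> = smooth_L2[OF W(2) U]
  have "L2_norm (lebesgue_on U) (\<lambda>x. jacobian (\<lambda>x. \<phi> n x - \<psi> n x) (at x) - weak_grad U (\<lambda>x. v x - w x) x)
      = L2_norm (lebesgue_on U) (\<lambda>x. (jacobian (\<phi> n) (at x) - jacobian (\<psi> n) (at x)) - (weak_grad U v x - weak_grad U w x))" for n
  proof (rule L2_norm_cong_AE)
    show "(\<lambda>x. jacobian (\<lambda>x. \<phi> n x - \<psi> n x) (at x) - weak_grad U (\<lambda>x. v x - w x) x) \<in> borel_measurable (lebesgue_on U)"
      by (rule L2D(1)[OF L2_diff[OF smooth_L2(2)[OF sd U] H1_L2(2)[OF D(1)]]])
    show "(\<lambda>x. (jacobian (\<phi> n) (at x) - jacobian (\<psi> n) (at x)) - (weak_grad U v x - weak_grad U w x)) \<in> borel_measurable (lebesgue_on U)"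
      by (rule L2D(1)[OF L2_diff[OF L2_diff[OF s\<phi>(2) s\<psi>(2)] L2_diff[OF sv(2) sw(2)]]])
    show "AE x in lebesgue_on U. norm (jacobian (\<lambda>x. \<phi> n x - \<psi> n x) (at x) - weak_grad U (\<lambda>x. v x - w x) x)
        = norm ((jacobian (\<phi> n) (at x) - jacobian (\<psi> n) (at x)) - (weak_grad U v x - weak_grad U w x))"
      using D(2) by eventually_elim (simp add: jacobian_diff[OF V(2) W(2)])
  qed
  then show ?thesis
    unfolding H1_approx_def
    using D(1) sd L2_tendsto_diff[OF sv(1) sw(1) s\<phi>(1) s\<psi>(1) V(3) W(3)]
      L2_tendsto_diff[OF sv(2) sw(2) s\<phi>(2) s\<psi>(2) V(4) W(4)]
    by simp
qed

lemma L2_norm_tendsto_0_subset: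
  fixes f :: "nat \<Rightarrow> 'a::euclidean_space \<Rightarrow> 'b::euclidean_space"
  assumes "V \<subseteq> U" "V \<in> sets lebesgue" "U \<in> sets lebesgue" "\<And>n. square_integrable (lebesgue_on U) (f n)"
    "(\<lambda>n. L2_norm (lebesgue_on U) (f n)) \<longlonglongrightarrow> 0"
  shows "(\<lambda>n. L2_norm (lebesgue_on V) (f n)) \<longlonglongrightarrow> 0"
proof (rule tendsto_sandwich[OF _ _ tendsto_const assms(5)])
  have "L2_norm (lebesgue_on V) (f n) \<le> L2_norm (lebesgue_on U) (f n)" for n
    using L2_norm_squared_subset[OF assms(1-4)] by (rule power2_le_imp_le) simp
  then show "\<forall>\<^sub>F n in sequentially. L2_norm (lebesgue_on V) (f n) \<le> L2_norm (lebesgue_on U) (f n)" by simp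
qed simp

lemma H1_subset:
  fixes v :: "real^'d \<Rightarrow> real^'d"
  assumes UV: "open U" "open V" "bounded U" "V \<subseteq> U" and v: "v \<in> H1 U"
  shows "v \<in> H1 V" "AE x in lebesgue_on V. weak_grad V v x = weak_grad U v x"
proof -
  have m: "V \<in> sets lebesgue" "U \<in> sets lebesgue" using UV by auto
  have "bounded V" using UV(3,4) by (rule bounded_subset)
  from weak_grad_unique[OF UV(2) this L2_subset[OF UV(4) m H1_L2(1)[OF v]]
      is_weak_grad_subset[OF UV(1,2,4) is_weak_grad_weak_grad[OF v]]]
  show "v \<in> H1 V" "AE x in lebesgue_on V. weak_grad V v x = weak_grad U v x" .
qed

lemma H1_approx_subset:
  fixes v :: "real^'d \<Rightarrow> real^'d"
  assumes UV: "open U" "open V" "bounded U" "V \<subseteq> U" and v: "H1_approx U v \<phi>"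
  shows "H1_approx V v \<phi>"
proof -
  note A = H1_approxD[OF v]
  note sv = H1_L2[OF A(1)] and s\<phi> = smooth_L2[OF A(2) UV(1,3)]
  note R = H1_subset[OF UV A(1)]
  have m: "V \<in> sets lebesgue" "U \<in> sets lebesgue" using UV by auto
  have bV: "bounded V" using UV(3,4) by (rule bounded_subset)
  have "L2_norm (lebesgue_on V) (\<lambda>x. jacobian (\<phi> n) (at x) - weak_grad V v x)
      = L2_norm (lebesgue_on V) (\<lambda>x. jacobian (\<phi> n) (at x) - weak_grad U v x)" for n
  proof (rule L2_norm_cong_AE)
    have j: "square_integrable (lebesgue_on V) (\<lambda>x. jacobian (\<phi> n) (at x))"
      by (rule smooth_L2(2)[OF A(2) UV(2) bV])
    show "(\<lambda>x. jacobian (\<phi> n) (at x) - weak_grad V v x) \<in> borel_measurable (lebesgue_on V)"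
      by (rule L2D(1)[OF L2_diff[OF j H1_L2(2)[OF R(1)]]])
    show "(\<lambda>x. jacobian (\<phi> n) (at x) - weak_grad U v x) \<in> borel_measurable (lebesgue_on V)"
      by (rule L2D(1)[OF L2_diff[OF j L2_subset[OF UV(4) m sv(2)]]])
    show "AE x in lebesgue_on V. norm (jacobian (\<phi> n) (at x) - weak_grad V v x) = norm (jacobian (\<phi> n) (at x) - weak_grad U v x)"
      using R(2) by eventually_elim simp
  qed
  then show ?thesis
    unfolding H1_approx_def
    using R(1) A(2) L2_norm_tendsto_0_subset[OF UV(4) m L2_diff[OF s\<phi>(1) sv(1)] A(3)]
      L2_norm_tendsto_0_subset[OF UV(4) m L2_diff[OF s\<phi>(2) sv(2)] A(4)]
    by simp
qed

definition H1_error ::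
  "(real^'d) set \<Rightarrow> (real^'d \<Rightarrow> real^'d) \<Rightarrow> (real^'d \<Rightarrow> real^'d) \<Rightarrow> real" where
  "H1_error U v f = (L2_norm (lebesgue_on U) (\<lambda>x. f x - v x))\<^sup>2
     + (L2_norm (lebesgue_on U) (\<lambda>x. jacobian f (at x) - weak_grad U v x))\<^sup>2"

lemma H1_error_tendsto_0:
  assumes "H1_approx U v \<phi>" shows "(\<lambda>n. H1_error U v (\<phi> n)) \<longlonglongrightarrow> 0"
proof -
  have "(\<lambda>n. H1_error U v (\<phi> n)) \<longlonglongrightarrow> 0\<^sup>2 + 0\<^sup>2"
    unfolding H1_error_def by (intro tendsto_intros H1_approxD(3,4)[OF assms])
  then show ?thesis by simp
qed

text \<open>The trace inequality for \<open>f - g\<close>. Comparing both fields with \<open>v\<close> yields existence of the trace of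
  \<open>v\<close>, as approximating sequences are Cauchy sequences on the face, as well as its uniqueness.\<close>

lemma trace_difference_le:
  fixes K :: "(real^'d) set"
  assumes K: "int CARD('d) simplex K" and E: "E facet_of K" and v: "v \<in> H1 (interior K)"
  shows "\<exists>M>0. \<forall>f g. smooth f \<longrightarrow> smooth g \<longrightarrow>
    (L2_norm (surface_measure E) (\<lambda>x. f x - g x))\<^sup>2 \<le> M * (H1_error (interior K) v f + H1_error (interior K) v g)"
proof -
  let ?N = "lebesgue_on (interior K)" and ?S = "surface_measure E" and ?G = "weak_grad (interior K) v"
  note Kf = simplex_facts[OF K] and Ef = facet_facts[OF K E] and sv = H1_L2[OF v]
  obtain M where M: "0 \<le> M" "\<And>\<phi> :: real^'d \<Rightarrow> real^'d. smooth \<phi> \<Longrightarrow> square_integrable ?S \<phi> \<Longrightarrow>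
      (L2_norm ?S \<phi>)\<^sup>2 \<le> M * ((L2_norm ?N \<phi>)\<^sup>2 + (L2_norm ?N (\<lambda>x. jacobian \<phi> (at x)))\<^sup>2)"
    using trace_inequality[OF K E] by blast
  show ?thesis
  proof (intro exI[of _ "2 * M + 1"] conjI allI impI)
    show "0 < 2 * M + 1" using M(1) by simp
    fix f g :: "real^'d \<Rightarrow> real^'d" assume f: "smooth f" and g: "smooth g"
    note sf = smooth_L2[OF f open_interior Kf(5)]
      and sg = smooth_L2[OF g open_interior Kf(5)]
    have 1: "(L2_norm ?N (\<lambda>x. f x - g x))\<^sup>2
        \<le> 2 * (L2_norm ?N (\<lambda>x. f x - v x))\<^sup>2 + 2 * (L2_norm ?N (\<lambda>x. g x - v x))\<^sup>2"
      using L2_norm_diff_squared_le[OF L2_diff[OF sf(1) sv(1)] L2_diff[OF sg(1) sv(1)]]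
      by simp
    have 2: "(L2_norm ?N (\<lambda>x. jacobian (\<lambda>x. f x - g x) (at x)))\<^sup>2
        \<le> 2 * (L2_norm ?N (\<lambda>x. jacobian f (at x) - ?G x))\<^sup>2 + 2 * (L2_norm ?N (\<lambda>x. jacobian g (at x) - ?G x))\<^sup>2"
      using L2_norm_diff_squared_le[OF L2_diff[OF sf(2) sv(2)] L2_diff[OF sg(2) sv(2)]]
      by (simp add: jacobian_diff[OF f g])
    let ?e = "H1_error (interior K) v f + H1_error (interior K) v g"
    have "(L2_norm ?S (\<lambda>x. f x - g x))\<^sup>2
        \<le> M * ((L2_norm ?N (\<lambda>x. f x - g x))\<^sup>2 + (L2_norm ?N (\<lambda>x. jacobian (\<lambda>x. f x - g x) (at x)))\<^sup>2)"
      by (rule M(2)[OF smooth_diff[OF f g] L2_surface_continuous[OF Ef smooth_continuous_on[OF smooth_diff[OF f g]]]])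
    also have "\<dots> \<le> M * (2 * ?e)"
      using 1 2 M(1) unfolding H1_error_def by (intro mult_left_mono) auto
    also have "\<dots> \<le> (2 * M + 1) * ?e"
    proof -
      have "0 \<le> ?e" by (simp add: H1_error_def)
      then show ?thesis by (simp add: algebra_simps)
    qed
    finally show "(L2_norm ?S (\<lambda>x. f x - g x))\<^sup>2 \<le> (2 * M + 1) * ?e" .
  qed
qed

lemma H1_approx_boundary_limit:
  fixes K :: "(real^'d) set"
  assumes K: "int CARD('d) simplex K" and E: "E facet_of K" and v: "H1_approx (interior K) v \<phi>"
  obtains g where "square_integrable (surface_measure E) g"
    "(\<lambda>n. L2_norm (surface_measure E) (\<lambda>x. \<phi> n x - g x)) \<longlonglongrightarrow> 0"
proof -
  let ?S = "surface_measure E" and ?a = "\<lambda>n. H1_error (interior K) v (\<phi> n)"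
  note Ef = facet_facts[OF K E] and A = H1_approxD[OF v]
  have sE: "square_integrable ?S (\<phi> n)" for n
    by (rule L2_surface_continuous[OF Ef smooth_continuous_on[OF A(2)]])
  obtain M where M: "0 < M" and tr: "\<forall>f g. smooth f \<longrightarrow> smooth g \<longrightarrow>
      (L2_norm ?S (\<lambda>x. f x - g x))\<^sup>2 \<le> M * (H1_error (interior K) v f + H1_error (interior K) v g)"
    using trace_difference_le[OF K E A(1)] by (elim exE conjE) (rule that)
  have est: "(L2_norm ?S (\<lambda>x. \<phi> m x - \<phi> n x))\<^sup>2 \<le> M * (?a m + ?a n)" for m n
    by (rule tr[rule_format, OF A(2) A(2)])
  have cauchy: "\<exists>N. \<forall>m\<ge>N. \<forall>n\<ge>N. (L2_norm ?S (\<lambda>x. \<phi> m x - \<phi> n x))\<^sup>2 \<le> e" if e: "0 < e" for e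
  proof -
    have "0 < e / (2 * M)" using e M by simp
    then obtain N where N: "\<And>n. n \<ge> N \<Longrightarrow> ?a n < e / (2 * M)"
      using order_tendstoD(2)[OF H1_error_tendsto_0[OF v]] unfolding eventually_sequentially by blast
    have "M * (?a m + ?a n) \<le> e" if "m \<ge> N" "n \<ge> N" for m n
    proof -
      have "M * (?a m + ?a n) \<le> M * (e / M)"
        using N[OF that(1)] N[OF that(2)] M by (intro mult_left_mono) (simp_all add: field_simps)
      then show ?thesis using M by simp
    qed
    then have "(L2_norm ?S (\<lambda>x. \<phi> m x - \<phi> n x))\<^sup>2 \<le> e" if "m \<ge> N" "n \<ge> N" for m n
      using order_trans[OF est] that by simp
    then show ?thesis by blast
  qed
  show thesis
    by (rule L2_complete[OF finite_measure_surface_measure[OF Ef] sE cauchy]) (assumption | rule that)+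
qed

lemma has_trace_unique:
  fixes K :: "(real^'d) set"
  assumes K: "int CARD('d) simplex K" and E: "E facet_of K"
    and g: "has_trace (interior K) E v g" and h: "has_trace (interior K) E v h"
  shows "AE x in surface_measure E. g x = h x"
proof -
  let ?S = "surface_measure E" and ?I = "interior K"
  note Ef = facet_facts[OF K E]
  obtain \<phi> where \<phi>: "H1_approx ?I v \<phi>" "(\<lambda>n. L2_norm ?S (\<lambda>x. \<phi> n x - g x)) \<longlonglongrightarrow> 0"
    and sg: "square_integrable ?S g" using g unfolding has_trace_iff by blast
  obtain \<psi> where \<psi>: "H1_approx ?I v \<psi>" "(\<lambda>n. L2_norm ?S (\<lambda>x. \<psi> n x - h x)) \<longlonglongrightarrow> 0"
    and sh: "square_integrable ?S h" using h unfolding has_trace_iff by blast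
  note A = H1_approxD[OF \<phi>(1)] and B = H1_approxD[OF \<psi>(1)]
  have s\<phi>: "square_integrable ?S (\<phi> n)" for n
    by (rule L2_surface_continuous[OF Ef smooth_continuous_on[OF A(2)]])
  have s\<psi>: "square_integrable ?S (\<psi> n)" for n
    by (rule L2_surface_continuous[OF Ef smooth_continuous_on[OF B(2)]])
  obtain M where tr: "\<forall>f g. smooth f \<longrightarrow> smooth g \<longrightarrow>
      (L2_norm ?S (\<lambda>x. f x - g x))\<^sup>2 \<le> M * (H1_error ?I v f + H1_error ?I v g)"
    using trace_difference_le[OF K E A(1)] by (elim exE conjE) (rule that)
  have le: "(L2_norm ?S (\<lambda>x. \<phi> n x - \<psi> n x))\<^sup>2 \<le> M * (H1_error ?I v (\<phi> n) + H1_error ?I v (\<psi> n))" for n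
    by (rule tr[rule_format, OF A(2) B(2)])
  have "(\<lambda>n. M * (H1_error ?I v (\<phi> n) + H1_error ?I v (\<psi> n))) \<longlonglongrightarrow> M * (0 + 0)"
    by (intro tendsto_intros H1_error_tendsto_0 \<phi>(1) \<psi>(1))
  then have R: "(\<lambda>n. M * (H1_error ?I v (\<phi> n) + H1_error ?I v (\<psi> n))) \<longlonglongrightarrow> 0" by simp
  have "(\<lambda>n. (L2_norm ?S (\<lambda>x. \<phi> n x - \<psi> n x))\<^sup>2) \<longlonglongrightarrow> 0"
    by (rule tendsto_sandwich[OF _ _ tendsto_const R]) (simp_all add: le)
  then have lim0: "(\<lambda>n. L2_norm ?S (\<lambda>x. (\<phi> n x - \<psi> n x) - 0)) \<longlonglongrightarrow> 0" by simp
  have "AE x in ?S. g x - h x = 0"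
    by (rule L2_limit_unique[OF L2_diff[OF sg sh] L2_zero
          L2_diff[OF s\<phi> s\<psi>] L2_tendsto_diff[OF sg sh s\<phi> s\<psi> \<phi>(2) \<psi>(2)] lim0])
  then show ?thesis by eventually_elim simp
qed

lemma has_trace_trace_on:
  assumes "has_trace U S v g" shows "has_trace U S v (trace_on U S v)"
  unfolding trace_on_def using assms by (rule someI[of "has_trace U S v"])

lemma has_trace_diff:
  fixes K :: "(real^'d) set"
  assumes K: "int CARD('d) simplex K" and E: "E facet_of K"
    and g: "has_trace (interior K) E v g" and h: "has_trace (interior K) E w h"
  shows "has_trace (interior K) E (\<lambda>x. v x - w x) (\<lambda>x. g x - h x)"
proof -
  let ?S = "surface_measure E"
  note Kf = simplex_facts[OF K] and Ef = facet_facts[OF K E]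
  obtain \<phi> where \<phi>: "H1_approx (interior K) v \<phi>" "(\<lambda>n. L2_norm ?S (\<lambda>x. \<phi> n x - g x)) \<longlonglongrightarrow> 0"
    and sg: "square_integrable ?S g" using g unfolding has_trace_iff by blast
  obtain \<psi> where \<psi>: "H1_approx (interior K) w \<psi>" "(\<lambda>n. L2_norm ?S (\<lambda>x. \<psi> n x - h x)) \<longlonglongrightarrow> 0"
    and sh: "square_integrable ?S h" using h unfolding has_trace_iff by blast
  have s\<phi>: "square_integrable ?S (\<phi> n)" for n
    by (rule L2_surface_continuous[OF Ef smooth_continuous_on[OF H1_approxD(2)[OF \<phi>(1)]]])
  have s\<psi>: "square_integrable ?S (\<psi> n)" for n
    by (rule L2_surface_continuous[OF Ef smooth_continuous_on[OF H1_approxD(2)[OF \<psi>(1)]]])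
  show ?thesis
    unfolding has_trace_iff
    using L2_diff[OF sg sh] H1_approx_diff[OF open_interior Kf(5) \<phi>(1) \<psi>(1)]
      L2_tendsto_diff[OF sg sh s\<phi> s\<psi> \<phi>(2) \<psi>(2)] by blast
qed

lemma smooth_AE_H1:
  fixes p v :: "real^'d \<Rightarrow> real^'d"
  assumes U: "open U" "bounded U" and p: "smooth p" and v: "square_integrable (lebesgue_on U) v"
    and eq: "AE x in lebesgue_on U. v x = p x"
  shows "v \<in> H1 U" "AE x in lebesgue_on U. weak_grad U v x = jacobian p (at x)"
proof -
  have "AE x in lebesgue_on U. p x = v x" using eq by eventually_elim simp
  from is_weak_grad_cong_AE[OF is_weak_grad_smooth[OF U p] L2D(1)[OF smooth_L2(1)[OF p U]]
      L2D(1)[OF v] this]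
  have "is_weak_grad U v (\<lambda>x. jacobian p (at x))" .
  from weak_grad_unique[OF U v this]
  show "v \<in> H1 U" "AE x in lebesgue_on U. weak_grad U v x = jacobian p (at x)" .
qed

lemma has_trace_smooth:
  fixes K :: "(real^'d) set"
  assumes K: "int CARD('d) simplex K" and E: "E facet_of K"
    and p: "smooth p" and v: "square_integrable (lebesgue_on (interior K)) v"
    and eq: "AE x in lebesgue_on (interior K). v x = p x"
  shows "has_trace (interior K) E v p"
proof -
  let ?N = "lebesgue_on (interior K)"
  note Kf = simplex_facts[OF K] and Ef = facet_facts[OF K E]
  note R = smooth_AE_H1[OF open_interior Kf(5) p v eq]
  note sp = smooth_L2[OF p open_interior Kf(5)]
  have "L2_norm ?N (\<lambda>x. p x - v x) = L2_norm ?N (\<lambda>x. 0 :: real^'d)"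
  proof (rule L2_norm_cong_AE)
    show "AE x in ?N. norm (p x - v x) = norm (0 :: real^'d)" using eq by eventually_elim simp
  qed (use L2D(1)[OF L2_diff[OF sp(1) v]] in simp_all)
  moreover have "L2_norm ?N (\<lambda>x. jacobian p (at x) - weak_grad (interior K) v x) = L2_norm ?N (\<lambda>x. 0 :: real^'d^'d)"
  proof (rule L2_norm_cong_AE)
    show "AE x in ?N. norm (jacobian p (at x) - weak_grad (interior K) v x) = norm (0 :: real^'d^'d)"
      using R(2) by eventually_elim simp
  qed (use L2D(1)[OF L2_diff[OF sp(2) H1_L2(2)[OF R(1)]]] in simp_all)
  moreover have "L2_norm M (\<lambda>x. 0) = 0" for M :: "(real^'d) measure"
    by (simp add: L2_norm_def L2_inner_def)
  ultimately have "H1_approx (interior K) v (\<lambda>n. p)"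
    using R(1) p by (simp add: H1_approx_def L2_norm_def L2_inner_def)
  moreover have "square_integrable (surface_measure E) p"
    by (rule L2_surface_continuous[OF Ef smooth_continuous_on[OF p]])
  moreover have "(\<lambda>n::nat. L2_norm (surface_measure E) (\<lambda>x. p x - p x)) \<longlonglongrightarrow> 0"
    by (simp add: L2_norm_def L2_inner_def)
  ultimately show ?thesis unfolding has_trace_iff by blast
qed

section \<open>Neighbours in the mesh\<close>

lemma facet_supporting_hyperplane:
  fixes K :: "(real^'d) set"
  assumes K: "int CARD('d) simplex K" and E: "E facet_of K"
  obtains n c where "norm n = 1" "affine hull E = {x. n \<bullet> x = c}" "\<forall>y\<in>K. c \<le> n \<bullet> y"
proof -
  obtain C a where C: "finite C" "\<not> affine_dependent C" "card C = CARD('d) + 1" "K = convex hull C"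
    "a \<in> C" "E = convex hull (C - {a})"
    using simplex_facet_cases[OF K E] .
  obtain n c where n: "norm n = 1" and Hn: "affine hull E = {x. n \<bullet> x = c}"
    using hyperplane_normal_form[OF facet_hyperplane[OF K E]] .
  have D: "n \<bullet> v = c" if "v \<in> C - {a}" for v
  proof -
    have "v \<in> affine hull E" unfolding C(6) affine_hull_convex_hull using that by (rule hull_inc)
    then show ?thesis unfolding Hn by simp
  qed
  show thesis
  proof (cases "c \<le> n \<bullet> a")
    case True
    have "C \<subseteq> {y. n \<bullet> y \<ge> c}"
    proof
      fix v assume "v \<in> C"
      then show "v \<in> {y. n \<bullet> y \<ge> c}" using D[of v] True by (cases "v = a") auto
    qed
    then have "K \<subseteq> {y. n \<bullet> y \<ge> c}" unfolding C(4) by (rule hull_minimal) (rule convex_halfspace_ge)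
    then show thesis using that[OF n Hn] by blast
  next
    case False
    have "C \<subseteq> {y. n \<bullet> y \<le> c}"
    proof
      fix v assume "v \<in> C"
      then show "v \<in> {y. n \<bullet> y \<le> c}" using D[of v] False by (cases "v = a") auto
    qed
    then have "K \<subseteq> {y. n \<bullet> y \<le> c}" unfolding C(4) by (rule hull_minimal) (rule convex_halfspace_le)
    then show thesis using that[of "- n" "- c"] n Hn by auto
  qed
qed

lemma mesh_simplex:
  fixes K :: "(real^'d) set"
  assumes "polyhedral_domain \<Omega>" "simplicial_mesh \<Omega> \<T>" "K \<in> \<T>"
  shows "int CARD('d) simplex K" "K \<subseteq> closure \<Omega>" "interior K \<subseteq> \<Omega>"
proof -
  show "int CARD('d) simplex K" "K \<subseteq> closure \<Omega>" using assms by (auto simp: simplicial_mesh_def)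
  then have "interior K \<subseteq> interior (closure \<Omega>)" by (intro interior_mono)
  then show "interior K \<subseteq> \<Omega>" using assms(1) by (simp add: polyhedral_domain_def)
qed

text \<open>The neighbour is selected by a choice operator, so its existence has to be shown. Leaving \<open>K\<close> through a relative interior point of a facet that lies in the domain, one enters
  the union of the other simplices, which is closed and therefore contains that point. As two
  simplices meet in a common face, this face is the facet.\<close>

lemma mesh_neighbour:
  fixes K :: "(real^'d) set"
  assumes dom: "polyhedral_domain \<Omega>" and mesh: "simplicial_mesh \<Omega> \<T>" and K: "K \<in> \<T>" and E: "E \<in> faces_in \<Omega> K"
  shows "neighbour \<T> K E \<in> \<T>" "E facet_of neighbour \<T> K E"
proof -
  have EK: "E facet_of K" and Eri: "rel_interior E \<subseteq> \<Omega>" using E by (auto simp: faces_in_def)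
  note Ks = mesh_simplex(1)[OF dom mesh K]
  have fin: "finite \<T>" and meet: "\<And>S T. S \<in> \<T> \<Longrightarrow> T \<in> \<T> \<Longrightarrow> (S \<inter> T) face_of S" and cover: "\<Union>\<T> = closure \<Omega>"
    using mesh by (auto simp: simplicial_mesh_def triangulation_def)
  have op: "open \<Omega>" using dom by (simp add: polyhedral_domain_def)
  obtain n c where n: "norm n = 1" and Hn: "affine hull E = {x. n \<bullet> x = c}" and side: "\<forall>y\<in>K. c \<le> n \<bullet> y"
    using facet_supporting_hyperplane[OF Ks EK] .
  have cE: "convex E" using facet_polytope[OF Ks EK] by (rule polytope_imp_convex)
  have "E \<noteq> {}" using EK by (simp add: facet_of_def)
  then obtain x where x: "x \<in> rel_interior E" using rel_interior_eq_empty[OF cE] by blast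
  then have xE: "x \<in> E" using rel_interior_subset by blast
  then have nx: "n \<bullet> x = c" using hull_subset[of E affine] Hn by blast
  obtain r where r: "0 < r" "ball x r \<subseteq> \<Omega>" using op Eri x open_contains_ball by blast
  let ?U = "\<Union>(\<T> - {K})"
  have "closed ?U"
  proof (rule closed_Union)
    show "finite (\<T> - {K})" using fin by simp
    show "\<forall>T\<in>\<T> - {K}. closed T"
      using simplex_facts(1)[OF mesh_simplex(1)[OF dom mesh]] compact_imp_closed by blast
  qed
  moreover have "x \<in> closure ?U"
    unfolding closure_approachable
  proof (intro allI impI)
    fix e :: real assume e: "0 < e"
    define t where "t = min e r / 2"
    have t: "0 < t" "t < e" "t < r" using e r(1) by (auto simp: t_def)
    define z where "z = x - t *\<^sub>R n"
    have d: "dist z x = t" using n t by (simp add: z_def dist_norm)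
    have "z \<in> \<Omega>" using r(2) d t by (auto simp: dist_commute)
    then have "z \<in> \<Union>\<T>" using cover closure_subset by blast
    moreover have "z \<notin> K"
    proof
      assume "z \<in> K"
      then have "c \<le> n \<bullet> z" using side by blast
      then show False using nx n t by (simp add: z_def inner_diff_right norm_eq_1)
    qed
    ultimately show "\<exists>y\<in>?U. dist y x < e" using d t by blast
  qed
  ultimately have "x \<in> ?U" by simp
  then obtain K' where K': "K' \<in> \<T>" "K' \<noteq> K" "x \<in> K'" by blast
  note Ks' = mesh_simplex(1)[OF dom mesh K'(1)]
  have dim: "aff_dim K = int CARD('d)" "aff_dim K' = int CARD('d)"
    using aff_dim_simplex Ks Ks' by blast+
  have F: "(K \<inter> K') face_of K" by (rule meet[OF K K'(1)])
  have F': "(K \<inter> K') face_of K'" using meet[OF K'(1) K] by (simp add: Int_commute)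
  have EsubK: "E \<subseteq> K" using EK facet_of_imp_subset by blast
  have EF: "E \<subseteq> K \<inter> K'"
    by (rule subset_of_face_of[OF F EsubK]) (use x xE EsubK K'(3) in blast)
  have EfF: "E face_of (K \<inter> K')"
    by (rule face_of_subset[OF facet_of_imp_face_of[OF EK] EF]) blast
  have "K \<inter> K' \<noteq> K"
  proof
    assume eq: "K \<inter> K' = K"
    then have "aff_dim K < aff_dim K'"
      using face_of_aff_dim_lt[OF simplex_facts(2)[OF Ks'] F'] K'(2) by auto
    then show False using dim by simp
  qed
  then have "aff_dim (K \<inter> K') < aff_dim K"
    by (rule face_of_aff_dim_lt[OF simplex_facts(2)[OF Ks] F])
  moreover have "aff_dim E = aff_dim K - 1" using EK by (simp add: facet_of_def)
  moreover have "E = K \<inter> K' \<or> aff_dim E < aff_dim (K \<inter> K')"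
    using face_of_aff_dim_lt[OF convex_Int[OF simplex_facts(2)[OF Ks] simplex_facts(2)[OF Ks']] EfF] by blast
  ultimately have "E = K \<inter> K'" by linarith
  then have "E facet_of K'"
    using F' \<open>E \<noteq> {}\<close> \<open>aff_dim E = aff_dim K - 1\<close> dim by (simp add: facet_of_def)
  then have "\<exists>K'. K' \<in> \<T> \<and> K' \<noteq> K \<and> E facet_of K'" using K' by blast
  from someI_ex[OF this] show "neighbour \<T> K E \<in> \<T>" "E facet_of neighbour \<T> K E"
    unfolding neighbour_def by simp_all
qed

section \<open>Fields on a closed simplex and on its interior\<close>

text \<open>Weak gradients refer to the open simplex and norms to the closed one. The boundary of a convex set is
  a null set, and Lebesgue measurability is insensitive to null sets.\<close>

lemma frontier_convex_null:
  fixes K :: "'a::euclidean_space set"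
  assumes "convex K" shows "AE x in lebesgue. x \<notin> frontier K"
  using negligible_convex_frontier[OF assms] by (intro AE_not_in) (simp add: negligible_iff_null_sets)

lemma AE_lebesgue_on_convex:
  fixes K :: "'a::euclidean_space set"
  assumes K: "convex K" "K \<in> sets lebesgue" and P: "AE x in lebesgue_on (interior K). P x"
  shows "AE x in lebesgue_on K. P x"
proof -
  have "AE x in lebesgue. x \<in> interior K \<longrightarrow> P x" using P by (simp add: AE_restrict_space_iff)
  with frontier_convex_null[OF K(1)] have "AE x in lebesgue. x \<in> K \<longrightarrow> P x"
  proof eventually_elim
    case (elim x)
    then show ?case using closure_subset[of K] by (auto simp: frontier_def)
  qed
  then show ?thesis using K(2) by (simp add: AE_restrict_space_iff)
qed

lemma L2_lebesgue_on_convex: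
  fixes f :: "'a::euclidean_space \<Rightarrow> 'b::euclidean_space"
  assumes K: "convex K" "K \<in> sets lebesgue" and f: "square_integrable (lebesgue_on (interior K)) f"
  shows "square_integrable (lebesgue_on K) f"
proof -
  have m: "f \<in> borel_measurable (lebesgue_on K)"
  proof (rule measurableI)
    fix A :: "'b set" assume A: "A \<in> sets borel"
    have 1: "f -` A \<inter> interior K \<in> sets lebesgue"
      using measurable_sets[OF L2D(1)[OF f] A] by (simp add: sets_restrict_space_iff)
    have "f -` A \<inter> (K - interior K) \<subseteq> frontier K" using closure_subset[of K] by (auto simp: frontier_def)
    then have "negligible (f -` A \<inter> (K - interior K))"
      using negligible_subset negligible_convex_frontier[OF K(1)] by blast
    then have 2: "f -` A \<inter> (K - interior K) \<in> sets lebesgue"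
      by (simp add: negligible_iff_null_sets null_setsD2)
    have "f -` A \<inter> K = (f -` A \<inter> interior K) \<union> (f -` A \<inter> (K - interior K))"
      using interior_subset[of K] by blast
    then have "f -` A \<inter> K \<in> sets lebesgue" using sets.Un[OF 1 2] by simp
    then show "f -` A \<inter> space (lebesgue_on K) \<in> sets (lebesgue_on K)"
      using K(2) by (simp add: sets_restrict_space_iff)
  qed simp
  let ?g = "\<lambda>x. (norm (f x))\<^sup>2"
  have gK: "(\<lambda>x. indicator K x *\<^sub>R ?g x) \<in> borel_measurable lebesgue"
  proof -
    have "?g \<in> borel_measurable (lebesgue_on K)" using m by measurable
    then show ?thesis using K(2) by (subst (asm) borel_measurable_restrict_space_iff) simp_all
  qed
  have gi: "integrable lebesgue (\<lambda>x. indicator (interior K) x *\<^sub>R ?g x)"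
    using L2D(2)[OF f] by (subst (asm) integrable_restrict_space) simp_all
  have "AE x in lebesgue. indicator (interior K) x *\<^sub>R ?g x = indicator K x *\<^sub>R ?g x"
    using frontier_convex_null[OF K(1)]
  proof eventually_elim
    case (elim x)
    then show ?case using closure_subset[of K] interior_subset[of K] by (auto simp: frontier_def indicator_def)
  qed
  from integrable_cong_AE[OF borel_measurable_integrable[OF gi] gK this] gi
  have "integrable lebesgue (\<lambda>x. indicator K x *\<^sub>R ?g x)" by blast
  then have "integrable (lebesgue_on K) ?g" using K(2) by (subst integrable_restrict_space) simp_all
  with m show ?thesis by (simp add: square_integrable_def)
qed

section \<open>Strain and compliance\<close>

lemma bounded_linear_sym_part: "bounded_linear (\<lambda>G :: real^'d^'d. (1/2) *\<^sub>R (G + transpose G))"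
proof -
  have "linear (\<lambda>G :: real^'d^'d. (1/2) *\<^sub>R (G + transpose G))"
    by (rule linearI) (simp_all add: vec_eq_iff transpose_def algebra_simps)
  then show ?thesis by (simp add: linear_conv_bounded_linear)
qed

lemma L2_strain:
  fixes K :: "(real^'d) set"
  assumes K: "int CARD('d) simplex K" and v: "v \<in> H1 (interior K)"
  shows "square_integrable (lebesgue_on K) (strain (interior K) v)"
proof -
  note Kf = simplex_facts[OF K]
  have "K \<in> sets lebesgue" using Kf(3) by simp
  from L2_lebesgue_on_convex[OF Kf(2) this
      L2_linear[OF bounded_linear_sym_part H1_L2(2)[OF v]]]
  show ?thesis unfolding strain_def .
qed

lemma bounded_linear_compliance: "bounded_linear (compliance \<mu> lam :: real^'d^'d \<Rightarrow> real^'d^'d)"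
proof -
  have "linear (compliance \<mu> lam :: real^'d^'d \<Rightarrow> real^'d^'d)"
    by (rule linearI)
       (simp_all add: compliance_def trace_def vec_eq_iff sum.distrib sum_distrib_left algebra_simps add_divide_distrib)
  then show ?thesis by (simp add: linear_conv_bounded_linear)
qed

text \<open>On trace-free matrices the compliance is \<open>1 / (2 \<mu>)\<close>; on multiples of the identity it is smaller
  and vanishes as \<open>lam\<close> tends to infinity. This is what makes the constant independent of \<open>lam\<close>.\<close>

lemma norm_compliance_le:
  fixes \<tau> :: "real^'d^'d"
  assumes \<mu>: "0 < \<mu>" and lam: "0 < lam"
  shows "norm (compliance \<mu> lam \<tau>) \<le> (1 / (2 * \<mu>)) * norm \<tau>"
proof -
  define d where "d = real CARD('d)"
  define \<theta> where "\<theta> = lam / (2 * \<mu> + d * lam)"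
  have d: "0 < d" by (simp add: d_def)
  have pos: "0 < 2 * \<mu> + d * lam" using \<mu> lam d by (simp add: add_pos_pos)
  have \<theta>: "0 \<le> \<theta>" "d * \<theta> \<le> 1" using pos \<mu> lam d by (simp_all add: \<theta>_def pos_divide_le_eq)
  have tr: "\<tau> \<bullet> mat 1 = trace \<tau>"
    by (simp add: inner_vec_def mat_def trace_def if_distrib cong: if_cong)
  have dd: "(mat 1 :: real^'d^'d) \<bullet> mat 1 = d"
    by (simp add: inner_vec_def mat_def d_def if_distrib cong: if_cong)
  have "(norm (\<tau> - (\<theta> * trace \<tau>) *\<^sub>R mat 1))\<^sup>2 = (norm \<tau>)\<^sup>2 - \<theta> * (trace \<tau>)\<^sup>2 * (2 - d * \<theta>)"
    unfolding power2_norm_eq_inner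
    by (simp add: inner_simps inner_commute[of "mat 1" \<tau>] tr dd power2_eq_square algebra_simps)
  also have "\<dots> \<le> (norm \<tau>)\<^sup>2" using \<theta> by simp
  finally have "norm (\<tau> - (\<theta> * trace \<tau>) *\<^sub>R mat 1) \<le> norm \<tau>" by (rule power2_le_imp_le) simp
  moreover have "compliance \<mu> lam \<tau> = (1 / (2 * \<mu>)) *\<^sub>R (\<tau> - (\<theta> * trace \<tau>) *\<^sub>R mat 1)"
    by (simp add: compliance_def \<theta>_def d_def)
  ultimately show ?thesis using \<mu> by (simp add: divide_right_mono)
qed

section \<open>Piecewise polynomials and the exact solution on a simplex\<close>

lemma pw_poly_simplex:
  fixes K :: "(real^'d) set"
  assumes dom: "polyhedral_domain \<Omega>" and mesh: "simplicial_mesh \<Omega> \<T>" and K: "K \<in> \<T>"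
    and v: "v \<in> pw_poly \<Omega> \<T> m"
  obtains p where "smooth p" "square_integrable (lebesgue_on (interior K)) v"
    "AE x in lebesgue_on (interior K). v x = p x"
proof -
  note Ks = mesh_simplex[OF dom mesh K]
  note Kf = simplex_facts[OF Ks(1)]
  have "open \<Omega>" using dom by (simp add: polyhedral_domain_def)
  then have Om: "\<Omega> \<in> sets lebesgue" by simp
  have Km: "K \<in> sets lebesgue" using Kf(3) by simp
  obtain p where p: "vec_poly m p" "AE x in lebesgue_on K. v x = p x"
    using v K unfolding pw_poly_def by blast
  show thesis
  proof (rule that)
    show "smooth p" by (rule vec_poly_smooth[OF p(1)])
    have "square_integrable (lebesgue_on \<Omega>) v" using v by (simp add: pw_poly_def)
    then show "square_integrable (lebesgue_on (interior K)) v"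
      by (rule L2_subset[OF Ks(3) Kf(4) Om])
    show "AE x in lebesgue_on (interior K). v x = p x"
      by (rule AE_lebesgue_on_subset[OF interior_subset Kf(4) Km p(2)])
  qed
qed

lemma pw_poly_H1:
  fixes K :: "(real^'d) set"
  assumes "polyhedral_domain \<Omega>" "simplicial_mesh \<Omega> \<T>" "K \<in> \<T>" "v \<in> pw_poly \<Omega> \<T> m"
  shows "v \<in> H1 (interior K)"
proof -
  obtain p where "smooth p" "square_integrable (lebesgue_on (interior K)) v"
    "AE x in lebesgue_on (interior K). v x = p x"
    by (rule pw_poly_simplex[OF assms])
  then show ?thesis
    using smooth_AE_H1(1)[OF open_interior simplex_facts(5)[OF mesh_simplex(1)[OF assms(1-3)]]] by blast
qed

lemma pw_poly_trace:
  fixes K :: "(real^'d) set"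
  assumes "polyhedral_domain \<Omega>" "simplicial_mesh \<Omega> \<T>" "K \<in> \<T>" "v \<in> pw_poly \<Omega> \<T> m" and E: "E facet_of K"
  obtains p where "has_trace (interior K) E v p"
proof -
  obtain p where "smooth p" "square_integrable (lebesgue_on (interior K)) v"
    "AE x in lebesgue_on (interior K). v x = p x"
    by (rule pw_poly_simplex[OF assms(1-4)])
  from has_trace_smooth[OF mesh_simplex(1)[OF assms(1-3)] E this] show thesis by (rule that)
qed

lemma strain_diff_AE:
  fixes K :: "(real^'d) set"
  assumes K: "int CARD('d) simplex K" and v: "v \<in> H1 (interior K)" and w: "w \<in> H1 (interior K)"
  shows "AE x in lebesgue_on K. strain (interior K) (\<lambda>x. v x - w x) x = strain (interior K) v x - strain (interior K) w x"
proof -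
  note Kf = simplex_facts[OF K]
  have Km: "K \<in> sets lebesgue" using Kf(3) by simp
  show ?thesis
    using AE_lebesgue_on_convex[OF Kf(2) Km H1_diff(2)[OF open_interior Kf(5) v w]]
  proof eventually_elim
    case (elim x)
    then show ?case
      unfolding strain_def elim by (simp add: vec_eq_iff transpose_def algebra_simps)
  qed
qed

text \<open>One approximating sequence of the exact displacement serves both simplices at a face; so both
  traces are the limit of the same sequence.\<close>

lemma common_trace:
  fixes K :: "(real^'d) set"
  assumes dom: "polyhedral_domain \<Omega>" and mesh: "simplicial_mesh \<Omega> \<T>" and K: "K \<in> \<T>" and K': "K' \<in> \<T>"
    and E: "E facet_of K" and u: "H1_approx \<Omega> u \<phi>"
  obtains g where "has_trace (interior K) E u g" "has_trace (interior K') E u g"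
    "(\<lambda>n. L2_norm (surface_measure E) (\<lambda>x. \<phi> n x - g x)) \<longlonglongrightarrow> 0"
proof -
  have Om: "open \<Omega>" "bounded \<Omega>" using dom by (auto simp: polyhedral_domain_def)
  have a: "H1_approx (interior K) u \<phi>" "H1_approx (interior K') u \<phi>"
    by (rule H1_approx_subset[OF Om(1) open_interior Om(2) mesh_simplex(3)[OF dom mesh K] u])
       (rule H1_approx_subset[OF Om(1) open_interior Om(2) mesh_simplex(3)[OF dom mesh K'] u])
  obtain g where g: "square_integrable (surface_measure E) g"
    "(\<lambda>n. L2_norm (surface_measure E) (\<lambda>x. \<phi> n x - g x)) \<longlonglongrightarrow> 0"
    using H1_approx_boundary_limit[OF mesh_simplex(1)[OF dom mesh K] E a(1)] .
  show thesis
    by (rule that) (use a g in \<open>auto simp: has_trace_iff\<close>)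
qed

text \<open>The traces of \<open>u\<close> from both sides agree and cancel, so that the two jumps differ by a sign only.\<close>

lemma L2_norm_jump:
  fixes K :: "(real^'d) set"
  assumes dom: "polyhedral_domain \<Omega>" and mesh: "simplicial_mesh \<Omega> \<T>" and K: "K \<in> \<T>"
    and E: "E \<in> faces_in \<Omega> K" and u: "H1_approx \<Omega> u \<phi>" and w: "w \<in> pw_poly \<Omega> \<T> m"
  shows "L2_norm (surface_measure E) (jump \<T> K E w) = L2_norm (surface_measure E) (jump \<T> K E (\<lambda>x. u x - w x))"
proof -
  let ?S = "surface_measure E"
  define K' where "K' = neighbour \<T> K E"
  have K': "K' \<in> \<T>" "E facet_of K'" unfolding K'_def by (rule mesh_neighbour[OF dom mesh K E])+
  have EK: "E facet_of K" using E by (simp add: faces_in_def)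
  note Ks = mesh_simplex(1)[OF dom mesh K] and Ks' = mesh_simplex(1)[OF dom mesh K'(1)]
  obtain g where g: "has_trace (interior K) E u g" "has_trace (interior K') E u g"
    using common_trace[OF dom mesh K K'(1) EK u] .
  obtain p where p: "has_trace (interior K) E w p" using pw_poly_trace[OF dom mesh K w EK] .
  obtain q where q: "has_trace (interior K') E w q" using pw_poly_trace[OF dom mesh K'(1) w K'(2)] .
  note d = has_trace_diff[OF Ks EK g(1) p] and d' = has_trace_diff[OF Ks' K'(2) g(2) q]
  note t = has_trace_trace_on[OF p] has_trace_trace_on[OF q] has_trace_trace_on[OF d] has_trace_trace_on[OF d']
  have sq: "square_integrable ?S (trace_on (interior K) E w)" "square_integrable ?S (trace_on (interior K') E w)"
    "square_integrable ?S (trace_on (interior K) E (\<lambda>x. u x - w x))"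
    "square_integrable ?S (trace_on (interior K') E (\<lambda>x. u x - w x))"
    using t by (simp_all add: has_trace_def)
  show ?thesis
  proof (rule L2_norm_cong_AE)
    show "jump \<T> K E w \<in> borel_measurable ?S"
      unfolding jump_def K'_def[symmetric] by (rule L2D(1)[OF L2_diff[OF sq(1,2)]])
    show "jump \<T> K E (\<lambda>x. u x - w x) \<in> borel_measurable ?S"
      unfolding jump_def K'_def[symmetric] by (rule L2D(1)[OF L2_diff[OF sq(3,4)]])
    show "AE x in ?S. norm (jump \<T> K E w x) = norm (jump \<T> K E (\<lambda>x. u x - w x) x)"
      using has_trace_unique[OF Ks EK t(1) p] has_trace_unique[OF Ks' K'(2) t(2) q]
        has_trace_unique[OF Ks EK t(3) d] has_trace_unique[OF Ks' K'(2) t(4) d']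
    proof eventually_elim
      case (elim x)
      then show ?case unfolding jump_def K'_def[symmetric] by (simp add: norm_minus_commute)
    qed
  qed
qed

text \<open>The approximating sequence \<open>\<phi>\<close> of \<open>u\<close> tends to 0 on \<open>\<Gamma>D\<close>, hence also on the face \<open>E\<close>, the surface
  measure of which is dominated by that of \<open>\<Gamma>D\<close>. So \<open>u\<close> has trace 0 on \<open>E\<close>.\<close>

lemma L2_norm_Dirichlet_trace:
  fixes K :: "(real^'d) set"
  assumes dom: "polyhedral_domain \<Omega>" and bd: "boundary_splitting \<Omega> \<Gamma>D \<Gamma>N"
    and mesh: "simplicial_mesh \<Omega> \<T>" and K: "K \<in> \<T>" and E: "E \<in> faces_in \<Gamma>D K"
    and u: "H1_approx \<Omega> u \<phi>" and u0: "(\<lambda>n. L2_norm (surface_measure \<Gamma>D) (\<lambda>x. \<phi> n x - 0)) \<longlonglongrightarrow> 0"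
    and w: "w \<in> pw_poly \<Omega> \<T> m"
  shows "L2_norm (surface_measure E) (trace_on (interior K) E w)
    = L2_norm (surface_measure E) (trace_on (interior K) E (\<lambda>x. u x - w x))"
proof -
  let ?S = "surface_measure E"
  have EK: "E facet_of K" and Eri: "rel_interior E \<subseteq> \<Gamma>D" using E by (simp_all add: faces_in_def)
  note Ks = mesh_simplex(1)[OF dom mesh K]
  note Ef = facet_facts[OF Ks EK]
  have G: "\<Gamma>D \<in> sets borel" "\<Gamma>D \<subseteq> frontier \<Omega>" "0 < emeasure (surface_measure (frontier \<Omega>)) \<Gamma>D"
    using bd by (auto simp: boundary_splitting_def)
  have bO: "bounded \<Omega>" using dom by (simp add: polyhedral_domain_def)
  have Fb: "frontier \<Omega> \<in> sets borel" using frontier_closed by (rule borel_closed)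
  have "finite (charged_hyperplanes (frontier \<Omega>))" by (rule finite_charged_hyperplanes[OF Fb G(1,3)])
  then have fin: "finite (charged_hyperplanes \<Gamma>D)"
    using charged_hyperplanes_mono[OF G(2) Fb] by (rule rev_finite_subset)
  have "\<Gamma>D \<subseteq> closure \<Omega>" using G(2) by (auto simp: frontier_def)
  with bounded_closure[OF bO] have bD: "bounded \<Gamma>D" by (rule bounded_subset)
  have le: "surface_measure E \<le> surface_measure \<Gamma>D"
    by (rule surface_measure_mono_rel_interior[OF facet_hyperplane[OF Ks EK] hull_subset facet_polytope[OF Ks EK] Eri G(1) fin])
  have c: "continuous_on UNIV (\<phi> n)" for n by (rule smooth_continuous_on[OF H1_approxD(2)[OF u]])
  have sq: "square_integrable ?S (\<phi> n)" for n by (rule L2_surface_continuous[OF Ef c])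
  have sqD: "square_integrable (surface_measure \<Gamma>D) (\<phi> n)" for n
    by (rule L2_surface_continuous[OF fin bD G(1) c])
  have "L2_norm ?S (\<phi> n) \<le> L2_norm (surface_measure \<Gamma>D) (\<phi> n)" for n
  proof -
    have "ennreal ((L2_norm ?S (\<phi> n))\<^sup>2) \<le> ennreal ((L2_norm (surface_measure \<Gamma>D) (\<phi> n))\<^sup>2)"
      unfolding L2_norm_squared_nn_integral[OF sq] L2_norm_squared_nn_integral[OF sqD]
      by (rule nn_integral_mono_measure[OF _ le]) simp
    then have "(L2_norm ?S (\<phi> n))\<^sup>2 \<le> (L2_norm (surface_measure \<Gamma>D) (\<phi> n))\<^sup>2" by simp
    then show ?thesis by (rule power2_le_imp_le) simp
  qed
  then have le_ev: "\<forall>\<^sub>F n in sequentially. L2_norm ?S (\<phi> n) \<le> L2_norm (surface_measure \<Gamma>D) (\<phi> n)" by simp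
  have "(\<lambda>n. L2_norm (surface_measure \<Gamma>D) (\<phi> n)) \<longlonglongrightarrow> 0" using u0 by simp
  with le_ev have "(\<lambda>n. L2_norm ?S (\<phi> n)) \<longlonglongrightarrow> 0"
    by (rule tendsto_sandwich[OF _ _ tendsto_const, rotated]) simp
  then have lim0: "(\<lambda>n. L2_norm ?S (\<lambda>x. \<phi> n x - 0)) \<longlonglongrightarrow> 0" by simp
  have uK: "H1_approx (interior K) u \<phi>"
    using dom by (intro H1_approx_subset[OF _ open_interior bO mesh_simplex(3)[OF dom mesh K] u])
      (simp add: polyhedral_domain_def)
  have g: "has_trace (interior K) E u (\<lambda>x. 0)"
    unfolding has_trace_iff using L2_zero uK lim0 by blast
  obtain p where p: "has_trace (interior K) E w p" using pw_poly_trace[OF dom mesh K w EK] .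
  note d = has_trace_diff[OF Ks EK g p]
  note t = has_trace_trace_on[OF p] has_trace_trace_on[OF d]
  have sqt: "square_integrable ?S (trace_on (interior K) E w)"
    "square_integrable ?S (trace_on (interior K) E (\<lambda>x. u x - w x))"
    using t by (simp_all add: has_trace_def)
  show ?thesis
  proof (rule L2_norm_cong_AE[OF L2D(1)[OF sqt(1)] L2D(1)[OF sqt(2)]])
    show "AE x in ?S. norm (trace_on (interior K) E w x) = norm (trace_on (interior K) E (\<lambda>x. u x - w x) x)"
      using has_trace_unique[OF Ks EK t(1) p] has_trace_unique[OF Ks EK t(2) d] by eventually_elim simp
  qed
qed

lemma jump_terms_eq:
  fixes K :: "(real^'d) set"
  assumes dom: "polyhedral_domain \<Omega>" and bd: "boundary_splitting \<Omega> \<Gamma>D \<Gamma>N"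
    and mesh: "simplicial_mesh \<Omega> \<T>" and K: "K \<in> \<T>"
    and u: "u \<in> H1D \<Omega> \<Gamma>D" and w: "w \<in> pw_poly \<Omega> \<T> m"
  shows "jump_terms \<Omega> \<Gamma>D \<T> K w = jump_terms \<Omega> \<Gamma>D \<T> K (\<lambda>x. u x - w x)"
proof -
  have "has_trace \<Omega> \<Gamma>D u (\<lambda>x. 0)" using u by (simp add: H1D_def)
  then obtain \<phi> where \<phi>: "H1_approx \<Omega> u \<phi>" "(\<lambda>n. L2_norm (surface_measure \<Gamma>D) (\<lambda>x. \<phi> n x - 0)) \<longlonglongrightarrow> 0"
    unfolding has_trace_iff by blast
  show ?thesis
    unfolding jump_terms_def
    by (simp add: L2_norm_jump[OF dom mesh K _ \<phi>(1) w] L2_norm_Dirichlet_trace[OF dom bd mesh K _ \<phi> w])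
qed

lemma jump_terms_nonneg:
  fixes K :: "(real^'d) set"
  assumes K: "int CARD('d) simplex K" shows "0 \<le> jump_terms \<Omega> \<Gamma>D \<T> K v"
proof -
  have "0 \<le> diameter E" if "E \<in> faces_in S K" for E S
    using that facet_facts(2)[OF K, of E] by (intro diameter_ge_0) (simp add: faces_in_def)
  then show ?thesis
    unfolding jump_terms_def by (intro add_nonneg_nonneg mult_nonneg_nonneg sum_nonneg) auto
qed

section \<open>Efficiency of the indicator\<close>

text \<open>Testing the first equation with the residual itself, and using \<open>2 a \<bullet> b \<le> |a|\<^sup>2 + |b|\<^sup>2\<close>.\<close>

lemma residual_norm_le:
  fixes s r w c :: "'a \<Rightarrow> 'b::euclidean_space"
  assumes r: "square_integrable M r" and w: "square_integrable M w" and c: "square_integrable M c"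
    and eq: "L2_inner M r r + L2_inner M w r = L2_inner M c r"
  shows "(L2_norm M r)\<^sup>2 \<le> (L2_norm M (\<lambda>x. c x - w x))\<^sup>2"
proof -
  let ?s = "\<lambda>x. c x - w x"
  note s = L2_diff[OF c w]
  have "(LINT x|M. ?s x \<bullet> r x) = (LINT x|M. c x \<bullet> r x - w x \<bullet> r x)" by (simp add: inner_diff_left)
  also have "\<dots> = L2_inner M c r - L2_inner M w r"
    unfolding L2_inner_def
    by (rule Bochner_Integration.integral_diff[OF L2_integrable_inner[OF c r]
          L2_integrable_inner[OF w r]])
  finally have "2 * (L2_norm M r)\<^sup>2 = (LINT x|M. 2 * (?s x \<bullet> r x))"
    using eq by (simp add: L2_norm_squared L2_inner_def power2_norm_eq_inner)
  also have "\<dots> \<le> (LINT x|M. (norm (?s x))\<^sup>2 + (norm (r x))\<^sup>2)"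
  proof (rule integral_mono)
    show "integrable M (\<lambda>x. 2 * (?s x \<bullet> r x))"
      using L2_integrable_inner[OF s r] by simp
    show "integrable M (\<lambda>x. (norm (?s x))\<^sup>2 + (norm (r x))\<^sup>2)"
      using L2D(2)[OF s] L2D(2)[OF r] by (rule Bochner_Integration.integrable_add)
    show "2 * (?s x \<bullet> r x) \<le> (norm (?s x))\<^sup>2 + (norm (r x))\<^sup>2" for x
      using zero_le_power2[of "norm (?s x - r x)"] unfolding power2_norm_eq_inner
      by (simp add: inner_diff_left inner_diff_right inner_commute)
  qed
  also have "\<dots> = (L2_norm M ?s)\<^sup>2 + (L2_norm M r)\<^sup>2"
    unfolding L2_norm_squared
    by (rule Bochner_Integration.integral_add[OF L2D(2)[OF s] L2D(2)[OF r]])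
  finally show ?thesis by simp
qed

text \<open>By the constitutive law for the exact solution the residual is
  \<open>\<epsilon>(u - w) - C (\<sigma> - \<sigma>h)\<close>, where \<open>C\<close> is the compliance, and \<open>C\<close> is bounded by \<open>1 / (2 \<mu>)\<close>.\<close>

lemma constitutive_residual_le:
  fixes K :: "(real^'d) set"
  assumes dom: "polyhedral_domain \<Omega>" and mesh: "simplicial_mesh \<Omega> \<T>" and K: "K \<in> \<T>"
    and \<mu>: "0 < \<mu>" and lam: "0 < lam"
    and u: "u \<in> H1 \<Omega>" and \<sigma>: "square_integrable (lebesgue_on \<Omega>) \<sigma>"
    and \<sigma>h: "square_integrable (lebesgue_on \<Omega>) \<sigma>h"
    and eq: "AE x in lebesgue_on \<Omega>. compliance \<mu> lam (\<sigma> x) - strain \<Omega> u x = 0"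
    and w: "w \<in> H1 (interior K)"
  shows "(L2_norm (lebesgue_on K) (\<lambda>x. compliance \<mu> lam (\<sigma>h x) - strain (interior K) w x))\<^sup>2
    \<le> 2 * (L2_norm (lebesgue_on K) (strain (interior K) (\<lambda>x. u x - w x)))\<^sup>2
      + 2 * ((1 / (2 * \<mu>)) * L2_norm (lebesgue_on K) (\<lambda>x. \<sigma> x - \<sigma>h x))\<^sup>2"
    and "square_integrable (lebesgue_on K) (\<lambda>x. compliance \<mu> lam (\<sigma>h x))"
proof -
  let ?N = "lebesgue_on K" and ?I = "interior K"
  note Ks = mesh_simplex[OF dom mesh K]
  note Kf = simplex_facts[OF Ks(1)]
  have Om: "open \<Omega>" "bounded \<Omega>" using dom by (simp_all add: polyhedral_domain_def)
  then have Omm: "\<Omega> \<in> sets lebesgue" by simp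
  have Km: "K \<in> sets lebesgue" using Kf(3) by simp
  have toK: "square_integrable ?N f" if "square_integrable (lebesgue_on \<Omega>) f" for f :: "real^'d \<Rightarrow> real^'d^'d"
    by (rule L2_lebesgue_on_convex[OF Kf(2) Km L2_subset[OF Ks(3) Kf(4) Omm that]])
  interpret C: bounded_linear "compliance \<mu> lam :: real^'d^'d \<Rightarrow> real^'d^'d" by (rule bounded_linear_compliance)
  note C = L2_linear[OF bounded_linear_compliance]
  have sd: "square_integrable ?N (\<lambda>x. \<sigma> x - \<sigma>h x)" by (rule L2_diff[OF toK[OF \<sigma>] toK[OF \<sigma>h]])
  show sCh: "square_integrable ?N (\<lambda>x. compliance \<mu> lam (\<sigma>h x))" by (rule C[OF toK[OF \<sigma>h]])
  note uK = H1_subset[OF Om(1) open_interior Om(2) Ks(3) u]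
  note uw = H1_diff(1)[OF open_interior Kf(5) uK(1) w]
  have e1: "square_integrable ?N (strain ?I (\<lambda>x. u x - w x))" by (rule L2_strain[OF Ks(1) uw])
  have e2: "square_integrable ?N (\<lambda>x. compliance \<mu> lam (\<sigma> x - \<sigma>h x))" by (rule C[OF sd])
  have e3: "square_integrable ?N (\<lambda>x. compliance \<mu> lam (\<sigma>h x) - strain ?I w x)"
    by (rule L2_diff[OF sCh L2_strain[OF Ks(1) w]])
  have "AE x in lebesgue_on ?I. compliance \<mu> lam (\<sigma> x) = strain ?I u x"
    using AE_lebesgue_on_subset[OF Ks(3) Kf(4) Omm eq] uK(2)
    by eventually_elim (simp add: strain_def)
  then have "AE x in ?N. compliance \<mu> lam (\<sigma> x) = strain ?I u x"
    by (rule AE_lebesgue_on_convex[OF Kf(2) Km])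
  with strain_diff_AE[OF Ks(1) uK(1) w]
  have "AE x in ?N. norm (compliance \<mu> lam (\<sigma>h x) - strain ?I w x)
      = norm (strain ?I (\<lambda>x. u x - w x) x - compliance \<mu> lam (\<sigma> x - \<sigma>h x))"
    by eventually_elim (simp add: C.diff)
  from L2_norm_cong_AE[OF L2D(1)[OF e3] L2D(1)[OF L2_diff[OF e1 e2]] this]
  have "(L2_norm ?N (\<lambda>x. compliance \<mu> lam (\<sigma>h x) - strain ?I w x))\<^sup>2
      \<le> 2 * (L2_norm ?N (strain ?I (\<lambda>x. u x - w x)))\<^sup>2 + 2 * (L2_norm ?N (\<lambda>x. compliance \<mu> lam (\<sigma> x - \<sigma>h x)))\<^sup>2"
    using L2_norm_diff_squared_le[OF e1 e2] by simp
  also have "(L2_norm ?N (\<lambda>x. compliance \<mu> lam (\<sigma> x - \<sigma>h x)))\<^sup>2 \<le> ((1 / (2 * \<mu>)) * L2_norm ?N (\<lambda>x. \<sigma> x - \<sigma>h x))\<^sup>2"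
  proof -
    have "(L2_norm ?N (\<lambda>x. compliance \<mu> lam (\<sigma> x - \<sigma>h x)))\<^sup>2 \<le> (L2_norm ?N (\<lambda>x. (1 / (2 * \<mu>)) *\<^sub>R (\<sigma> x - \<sigma>h x)))\<^sup>2"
    proof (rule L2_norm_squared_mono[OF e2 L2_linear[OF bounded_linear_scaleR_right sd]])
      have "norm (compliance \<mu> lam (\<sigma> x - \<sigma>h x)) \<le> norm ((1 / (2 * \<mu>)) *\<^sub>R (\<sigma> x - \<sigma>h x))" for x
        using norm_compliance_le[OF \<mu> lam, of "\<sigma> x - \<sigma>h x"] \<mu> by simp
      then show "AE x in ?N. norm (compliance \<mu> lam (\<sigma> x - \<sigma>h x)) \<le> norm ((1 / (2 * \<mu>)) *\<^sub>R (\<sigma> x - \<sigma>h x))"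
        by simp
    qed
    also have "\<dots> = ((1 / (2 * \<mu>)) * L2_norm ?N (\<lambda>x. \<sigma> x - \<sigma>h x))\<^sup>2"
      unfolding L2_norm_squared power_mult_distrib norm_scaleR using \<mu> by simp
    finally show ?thesis .
  qed
  finally show "(L2_norm ?N (\<lambda>x. compliance \<mu> lam (\<sigma>h x) - strain ?I w x))\<^sup>2
    \<le> 2 * (L2_norm ?N (strain ?I (\<lambda>x. u x - w x)))\<^sup>2
      + 2 * ((1 / (2 * \<mu>)) * L2_norm ?N (\<lambda>x. \<sigma> x - \<sigma>h x))\<^sup>2" by simp
qed

lemma coproj_space_H1:
  fixes K :: "(real^'d) set"
  assumes dom: "polyhedral_domain \<Omega>" and mesh: "simplicial_mesh \<Omega> \<T>" and K: "K \<in> \<T>"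
    and r: "r \<in> coproj_space \<Omega> \<T> fam m"
  shows "r \<in> H1 (interior K)"
proof -
  obtain v p where vp: "r = (\<lambda>x. v x - p x)" "v \<in> pw_poly \<Omega> \<T> m" "p \<in> pw_poly \<Omega> \<T> (disp_degree fam)"
    using r unfolding coproj_space_def is_L2_projection_def disp_space_def by blast
  show ?thesis
    unfolding vp(1)
    by (rule H1_diff(1)[OF open_interior simplex_facts(5)[OF mesh_simplex(1)[OF dom mesh K]]
          pw_poly_H1[OF dom mesh K vp(2)] pw_poly_H1[OF dom mesh K vp(3)]])
qed

text \<open>Here \<open>r\<close>, \<open>s\<close>, \<open>e\<close>, \<open>a\<close> stand for the norms of \<open>\<epsilon>(rh)\<close>, of the constitutive residual, of \<open>\<epsilon>(u - wh)\<close>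
  and of the stress error, and \<open>J\<close> for the jump terms. The factor 4 before the square root comes from
  replacing \<open>r\<close> by \<open>s\<close> and from splitting \<open>s\<close> in two.\<close>

lemma indicator_arithmetic:
  fixes \<mu> r s e a J :: real
  assumes \<mu>: "0 < \<mu>" and r: "r\<^sup>2 \<le> s\<^sup>2" and s: "s\<^sup>2 \<le> 2 * e\<^sup>2 + 2 * ((1 / (2 * \<mu>)) * a)\<^sup>2"
    and J: "0 \<le> J" and a: "0 \<le> a"
  shows "sqrt (\<mu> * r\<^sup>2 + \<mu> * s\<^sup>2 + \<mu> * J) \<le> 2 * (\<mu> powr (-1/2) * a + \<mu> powr (1/2) * sqrt (e\<^sup>2 + J))"
proof -
  let ?n = "sqrt (e\<^sup>2 + J)" and ?A = "\<mu> powr (-1/2) * a"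
  let ?B = "\<mu> powr (1/2) * ?n"
  have p1: "(\<mu> powr (-1/2))\<^sup>2 = 1 / \<mu>"
    using \<mu> by (simp add: power2_eq_square powr_add[symmetric] powr_minus_divide)
  have p2: "(\<mu> powr (1/2))\<^sup>2 = \<mu>" using \<mu> by (simp add: power2_eq_square powr_add[symmetric])
  have n2: "?n\<^sup>2 = e\<^sup>2 + J" using J by simp
  have "\<mu> * r\<^sup>2 + \<mu> * s\<^sup>2 + \<mu> * J \<le> 2 * (\<mu> * s\<^sup>2) + \<mu> * J"
    using mult_left_mono[OF r, of \<mu>] \<mu> by simp
  also have "\<dots> \<le> 2 * (\<mu> * (2 * e\<^sup>2 + 2 * ((1 / (2 * \<mu>)) * a)\<^sup>2)) + \<mu> * J"
    using mult_left_mono[OF s, of \<mu>] \<mu> by simp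
  also have "\<dots> = 4 * (\<mu> * e\<^sup>2) + a\<^sup>2 / \<mu> + \<mu> * J"
    using \<mu> by (simp add: field_simps power2_eq_square)
  also have "\<dots> \<le> 4 * (a\<^sup>2 / \<mu> + \<mu> * (e\<^sup>2 + J))"
  proof -
    have "0 \<le> a\<^sup>2 / \<mu>" "0 \<le> \<mu> * J" using \<mu> J by simp_all
    then show ?thesis unfolding distrib_left by linarith
  qed
  also have "\<dots> = 4 * (?A\<^sup>2 + ?B\<^sup>2)"
    unfolding power_mult_distrib p1 p2 n2 by simp
  also have "\<dots> \<le> (2 * (?A + ?B))\<^sup>2"
  proof -
    have "0 \<le> ?A * ?B" using a J by simp
    then show ?thesis by (simp add: power2_sum power_mult_distrib)
  qed
  finally have le: "\<mu> * r\<^sup>2 + \<mu> * s\<^sup>2 + \<mu> * J \<le> (2 * (?A + ?B))\<^sup>2" .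
  show ?thesis by (rule real_le_lsqrt[OF _ le]) (use a J in simp)
qed

theorem theorem4p8:
  fixes \<Omega> \<Gamma>D \<Gamma>N :: "(real^'d) set"
    and \<mu> :: real
    and fam :: mixed_family
    and S :: "(real^'d) set \<Rightarrow> (real^'d \<Rightarrow> real^'d^'d) set"
  assumes "CARD('d) = 2 \<or> CARD('d) = 3"
    and "polyhedral_domain \<Omega>"
    and "boundary_splitting \<Omega> \<Gamma>D \<Gamma>N"
    and "0 < \<mu>"
    and "is_stress_family fam S"
  shows "\<exists>C :: real \<Rightarrow> real. (\<forall>lam>0. 0 < C lam) \<and> Bfun C at_top \<and>
    (\<forall>lam>0. \<forall>\<T> f g u \<sigma> uh \<sigma>h rh wh.
       simplicial_mesh \<Omega> \<T> \<and> mesh_fits_boundary \<Omega> \<Gamma>D \<Gamma>N \<T> \<and>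
       square_integrable (lebesgue_on \<Omega>) f \<and> square_integrable (surface_measure \<Gamma>N) g \<and>
       elasticity_solution \<Omega> \<Gamma>D \<Gamma>N \<mu> lam f g u \<sigma> \<and>
       discrete_mixed_solution fam S \<Omega> \<Gamma>N \<T> \<mu> lam f g \<sigma>h uh \<and>
       local_residual_solution fam \<Omega> \<T> \<mu> lam \<sigma>h uh rh wh \<longrightarrow>
       (\<forall>K\<in>\<T>. error_indicator \<Omega> \<Gamma>D \<T> \<mu> lam \<sigma>h rh wh K
          \<le> C lam * (\<mu> powr (-1/2) * L2_norm (lebesgue_on K) (\<lambda>x. \<sigma> x - \<sigma>h x)
                      + \<mu> powr (1/2) * local_norm \<Omega> \<Gamma>D \<T> K (\<lambda>x. u x - wh x))))"
proof (intro exI[of _ "\<lambda>lam. 2"] conjI allI impI ballI)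
  show "Bfun (\<lambda>lam::real. 2::real) at_top" by (rule Bfun_const)
next
  fix lam :: real and \<T> f g u \<sigma> uh \<sigma>h rh wh K
  assume lam: "0 < lam"
    and H: "simplicial_mesh \<Omega> \<T> \<and> mesh_fits_boundary \<Omega> \<Gamma>D \<Gamma>N \<T> \<and>
       square_integrable (lebesgue_on \<Omega>) f \<and> square_integrable (surface_measure \<Gamma>N) g \<and>
       elasticity_solution \<Omega> \<Gamma>D \<Gamma>N \<mu> lam f g u \<sigma> \<and>
       discrete_mixed_solution fam S \<Omega> \<Gamma>N \<T> \<mu> lam f g \<sigma>h uh \<and>
       local_residual_solution fam \<Omega> \<T> \<mu> lam \<sigma>h uh rh wh"
    and K: "K \<in> \<T>"
  note dom = assms(2)
  have mesh: "simplicial_mesh \<Omega> \<T>" using H by blast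
  have el: "elasticity_solution \<Omega> \<Gamma>D \<Gamma>N \<mu> lam f g u \<sigma>" using H by blast
  have dm: "discrete_mixed_solution fam S \<Omega> \<Gamma>N \<T> \<mu> lam f g \<sigma>h uh" using H by blast
  have lr: "local_residual_solution fam \<Omega> \<T> \<mu> lam \<sigma>h uh rh wh" using H by blast
  have u: "u \<in> H1D \<Omega> \<Gamma>D" "u \<in> H1 \<Omega>" using el by (simp_all add: elasticity_solution_def H1D_def)
  have \<sigma>: "square_integrable (lebesgue_on \<Omega>) \<sigma>" using el by (simp add: elasticity_solution_def Hdiv_def)
  have law: "AE x in lebesgue_on \<Omega>. compliance \<mu> lam (\<sigma> x) - strain \<Omega> u x = 0"
    using el unfolding elasticity_solution_def by blast
  have \<sigma>h: "square_integrable (lebesgue_on \<Omega>) \<sigma>h"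
    using dm by (simp add: discrete_mixed_solution_def stress_space_g_def stress_space_def Hdiv_def)
  define l where "l = post_degree fam"
  have rh: "rh \<in> coproj_space \<Omega> \<T> fam (l + 1)" and wh: "wh \<in> pw_poly \<Omega> \<T> l"
    using lr unfolding local_residual_solution_def Let_def l_def by blast+
  have res: "L2_inner (lebesgue_on K) (strain (interior K) rh) (strain (interior K) rh)
      + L2_inner (lebesgue_on K) (strain (interior K) wh) (strain (interior K) rh)
      = L2_inner (lebesgue_on K) (\<lambda>x. compliance \<mu> lam (\<sigma>h x)) (strain (interior K) rh)"
    using lr K rh unfolding local_residual_solution_def Let_def l_def by blast
  note Ks = mesh_simplex(1)[OF dom mesh K]
  have whH: "wh \<in> H1 (interior K)" by (rule pw_poly_H1[OF dom mesh K wh])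
  have rhH: "rh \<in> H1 (interior K)" by (rule coproj_space_H1[OF dom mesh K rh])
  note con = constitutive_residual_le[OF dom mesh K assms(4) lam u(2) \<sigma> \<sigma>h law whH]
  have r: "(L2_norm (lebesgue_on K) (strain (interior K) rh))\<^sup>2
      \<le> (L2_norm (lebesgue_on K) (\<lambda>x. compliance \<mu> lam (\<sigma>h x) - strain (interior K) wh x))\<^sup>2"
    by (rule residual_norm_le[OF L2_strain[OF Ks rhH] L2_strain[OF Ks whH] con(2) res])
  show "error_indicator \<Omega> \<Gamma>D \<T> \<mu> lam \<sigma>h rh wh K
      \<le> 2 * (\<mu> powr (-1/2) * L2_norm (lebesgue_on K) (\<lambda>x. \<sigma> x - \<sigma>h x)
              + \<mu> powr (1/2) * local_norm \<Omega> \<Gamma>D \<T> K (\<lambda>x. u x - wh x))"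
    unfolding error_indicator_def local_norm_def jump_terms_eq[OF dom assms(3) mesh K u(1) wh]
    by (rule indicator_arithmetic[OF assms(4) r con(1) jump_terms_nonneg[OF Ks] L2_norm_nonneg])
qed simp

end
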